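(* Let $X$ be a smooth projective variety over a perfect field $k$ of characteristic $p>0$ with a fixed rational point $\xi:\mathrm{Spec}(k)\to X$. Let $F_X:X\to X$ be the (absolute) Frobenius map, and let $V,V'$ be vector bundles of rank $r$ on $X$ satisfying $V=F_X^*(V')$. Then for any frame $\beta:\xi^*V\cong\mathcal{O}_{\mathrm{Spec}(k)}^{\oplus r}$ there is a unique frame $\beta':\xi^*V'\cong\mathcal{O}_{\mathrm{Spec}(k)}^{\oplus r}$ such that $\beta=F_k^*(\beta')$, where $F_k:\mathrm{Spec}(k)\to\mathrm{Spec}(k)$ is the Frobenius morphism and $F_k^*(\beta')$ denotes $$\xi^*V=F_k^*(\xi^*V')\xrightarrow{F_k^*(\beta')}F_k^*(\mathcal{O}_{\mathrm{Spec}(k)}^{\oplus r})=\mathcal{O}_{\mathrm{Spec}(k)}^{\oplus r}.$$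
   Context: A frame of a rank $r$ vector bundle $V$ at $\xi$ is an isomorphism $\xi^*V\cong\mathcal{O}_{\mathrm{Spec}(k)}^{\oplus r}$. The identification $\xi^*V=\xi^*F_X^*V'=F_k^*\xi^*V'$ comes from $F_X\circ\xi=\xi\circ F_k$. *)

theory Defs
  imports
    "HOL-Algebra.Algebra"
    "HOL-Algebra.Free_Abelian_Groups"
    "HOL-Algebra.Indexed_Polynomials"
    "HOL-Analysis.Abstract_Topology"
    "HOL-Combinatorics.Permutations"
begin

section \<open>Commutative algebra\<close>

definition ring_char :: "('a, 'z) ring_scheme \<Rightarrow> nat" where
  "ring_char R =
     (if \<exists>n::nat. n > 0 \<and> [n] \<cdot>\<^bsub>R\<^esub> \<one>\<^bsub>R\<^esub> = \<zero>\<^bsub>R\<^esub>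
      then (LEAST n::nat. n > 0 \<and> [n] \<cdot>\<^bsub>R\<^esub> \<one>\<^bsub>R\<^esub> = \<zero>\<^bsub>R\<^esub>) else 0)"

definition perfect_field :: "('a, 'z) ring_scheme \<Rightarrow> bool" where
  "perfect_field K \<longleftrightarrow>
     field K \<and> (ring_char K = 0 \<or> (\<forall>a\<in>carrier K. \<exists>b\<in>carrier K. b [^]\<^bsub>K\<^esub> ring_char K = a))"

definition local_ring :: "('a, 'z) ring_scheme \<Rightarrow> bool" where
  "local_ring R \<longleftrightarrow> cring R \<and> (\<exists>!I. maximalideal I R)"

text \<open>Localisation at a multiplicative set: the fraction \<open>a/s\<close> is the set of all pairs
  representing it; operations on classes are unions over representatives.\<close>

definition fraction :: "('a, 'z) ring_scheme \<Rightarrow> 'a set \<Rightarrow> 'a \<Rightarrow> 'a \<Rightarrow> ('a \<times> 'a) set" where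
  "fraction A S a s =
     {(b, t). b \<in> carrier A \<and> t \<in> S \<and>
        (\<exists>u\<in>S. u \<otimes>\<^bsub>A\<^esub> (a \<otimes>\<^bsub>A\<^esub> t) = u \<otimes>\<^bsub>A\<^esub> (b \<otimes>\<^bsub>A\<^esub> s))}"

definition localization :: "('a, 'z) ring_scheme \<Rightarrow> 'a set \<Rightarrow> ('a \<times> 'a) set ring" where
  "localization A S =
     \<lparr>carrier = {fraction A S a s | a s. a \<in> carrier A \<and> s \<in> S},
      monoid.mult = (\<lambda>x y. \<Union>(a, s)\<in>x. \<Union>(b, t)\<in>y. fraction A S (a \<otimes>\<^bsub>A\<^esub> b) (s \<otimes>\<^bsub>A\<^esub> t)),
      one = fraction A S \<one>\<^bsub>A\<^esub> \<one>\<^bsub>A\<^esub>,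
      ring.zero = fraction A S \<zero>\<^bsub>A\<^esub> \<one>\<^bsub>A\<^esub>,
      ring.add = (\<lambda>x y. \<Union>(a, s)\<in>x. \<Union>(b, t)\<in>y.
               fraction A S ((a \<otimes>\<^bsub>A\<^esub> t) \<oplus>\<^bsub>A\<^esub> (b \<otimes>\<^bsub>A\<^esub> s)) (s \<otimes>\<^bsub>A\<^esub> t))\<rparr>"

text \<open>\<open>R[x\<^sub>i | i \<in> I]\<close>; monomials are multisets of variables, as in
  \<^theory>\<open>HOL-Algebra.Indexed_Polynomials\<close>, which provides everything but the product.\<close>

definition mpoly_ring :: "('a, 'z) ring_scheme \<Rightarrow> 'c set \<Rightarrow> ('c multiset \<Rightarrow> 'a) ring" where
  "mpoly_ring R I =
     \<lparr>carrier = ring.indexed_pset R I (carrier R),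
      monoid.mult = (\<lambda>P Q m. \<Oplus>\<^bsub>R\<^esub>a\<in>{a. a \<subseteq># m}. P a \<otimes>\<^bsub>R\<^esub> Q (m - a)),
      one = ring.indexed_const R \<one>\<^bsub>R\<^esub>,
      ring.zero = ring.indexed_const R \<zero>\<^bsub>R\<^esub>,
      ring.add = ring.indexed_padd R\<rparr>"

definition homogeneous_part ::
    "('a, 'z) ring_scheme \<Rightarrow> 'c set \<Rightarrow> nat \<Rightarrow> ('c multiset \<Rightarrow> 'a) set" where
  "homogeneous_part R I d =
     {P \<in> carrier (mpoly_ring R I). \<forall>m. P m \<noteq> \<zero>\<^bsub>R\<^esub> \<longrightarrow> size m = d}"

definition partial_deriv ::
    "('a, 'z) ring_scheme \<Rightarrow> 'c \<Rightarrow> ('c multiset \<Rightarrow> 'a) \<Rightarrow> 'c multiset \<Rightarrow> 'a" where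
  "partial_deriv R i P = (\<lambda>m. [Suc (count m i)] \<cdot>\<^bsub>R\<^esub> P (add_mset i m))"

definition ring_det :: "('a, 'z) ring_scheme \<Rightarrow> nat \<Rightarrow> (nat \<Rightarrow> nat \<Rightarrow> 'a) \<Rightarrow> 'a" where
  "ring_det R n A =
     (\<Oplus>\<^bsub>R\<^esub>\<sigma>\<in>{\<sigma>. \<sigma> permutes {..<n}}. [sign \<sigma>] \<cdot>\<^bsub>R\<^esub> (\<Otimes>\<^bsub>R\<^esub>i\<in>{..<n}. A i (\<sigma> i)))"

definition module_hom ::
    "('a, 'z) ring_scheme \<Rightarrow> ('a, 'm) module \<Rightarrow> ('a, 'n) module \<Rightarrow> ('m \<Rightarrow> 'n) \<Rightarrow> bool" where
  "module_hom R M N h \<longleftrightarrow>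
     h \<in> carrier M \<rightarrow> carrier N \<and>
     (\<forall>x\<in>carrier M. \<forall>y\<in>carrier M. h (x \<oplus>\<^bsub>M\<^esub> y) = h x \<oplus>\<^bsub>N\<^esub> h y) \<and>
     (\<forall>a\<in>carrier R. \<forall>x\<in>carrier M. h (a \<odot>\<^bsub>M\<^esub> x) = a \<odot>\<^bsub>N\<^esub> h x)"

text \<open>Extension of scalars \<open>M \<otimes>\<^sub>R S\<close> along \<open>\<phi> : R \<rightarrow> S\<close>: the free abelian group on
  \<open>M \<times> S\<close> modulo the bilinearity relations. The fields \<open>mult\<close> and \<open>one\<close>, which the library's
  record for modules inherits from rings, carry no meaning for modules.\<close>

definition tensor_relations ::
    "('a, 'z) ring_scheme \<Rightarrow> ('a, 'm) module \<Rightarrow> ('b, 'y) ring_scheme \<Rightarrow> ('a \<Rightarrow> 'b)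
      \<Rightarrow> ('m \<times> 'b \<Rightarrow>\<^sub>0 int) set" where
  "tensor_relations R M S \<phi> =
     {frag_of (x \<oplus>\<^bsub>M\<^esub> y, s) - frag_of (x, s) - frag_of (y, s) | x y s.
        x \<in> carrier M \<and> y \<in> carrier M \<and> s \<in> carrier S}
     \<union> {frag_of (x, s \<oplus>\<^bsub>S\<^esub> t) - frag_of (x, s) - frag_of (x, t) | x s t.
        x \<in> carrier M \<and> s \<in> carrier S \<and> t \<in> carrier S}
     \<union> {frag_of (a \<odot>\<^bsub>M\<^esub> x, s) - frag_of (x, \<phi> a \<otimes>\<^bsub>S\<^esub> s) | a x s.
        a \<in> carrier R \<and> x \<in> carrier M \<and> s \<in> carrier S}"

definition tensor_kernel ::
    "('a, 'z) ring_scheme \<Rightarrow> ('a, 'm) module \<Rightarrow> ('b, 'y) ring_scheme \<Rightarrow> ('a \<Rightarrow> 'b)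
      \<Rightarrow> ('m \<times> 'b \<Rightarrow>\<^sub>0 int) set" where
  "tensor_kernel R M S \<phi> =
     generate (free_Abelian_group (carrier M \<times> carrier S)) (tensor_relations R M S \<phi>)"

definition tensor_class ::
    "('a, 'z) ring_scheme \<Rightarrow> ('a, 'm) module \<Rightarrow> ('b, 'y) ring_scheme \<Rightarrow> ('a \<Rightarrow> 'b)
      \<Rightarrow> ('m \<times> 'b \<Rightarrow>\<^sub>0 int) \<Rightarrow> ('m \<times> 'b \<Rightarrow>\<^sub>0 int) set" where
  "tensor_class R M S \<phi> z =
     tensor_kernel R M S \<phi> #>\<^bsub>free_Abelian_group (carrier M \<times> carrier S)\<^esub> z"

definition base_change ::
    "('a, 'z) ring_scheme \<Rightarrow> ('a, 'm) module \<Rightarrow> ('b, 'y) ring_scheme \<Rightarrow> ('a \<Rightarrow> 'b)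
      \<Rightarrow> ('b, ('m \<times> 'b \<Rightarrow>\<^sub>0 int) set) module" where
  "base_change R M S \<phi> =
     (let G = free_Abelian_group (carrier M \<times> carrier S) Mod tensor_kernel R M S \<phi> in
      \<lparr>carrier = carrier G, monoid.mult = undefined, one = undefined,
       ring.zero = \<one>\<^bsub>G\<^esub>, ring.add = (\<lambda>C D. C \<otimes>\<^bsub>G\<^esub> D),
       smult = (\<lambda>a C. \<Union>z\<in>C. tensor_class R M S \<phi>
                  (frag_extend (\<lambda>(x, s). frag_of (x, a \<otimes>\<^bsub>S\<^esub> s)) z))\<rparr>)"

text \<open>The map \<open>h \<otimes> id : M \<otimes>\<^sub>R S \<rightarrow> M' \<otimes>\<^sub>R\<^sub>' S\<close>, where \<open>S\<close> is an algebra over \<open>R\<close> and \<open>R'\<close>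
  (via \<open>\<phi>'\<close>); only the data of the target enter the formula.\<close>

definition base_change_map ::
    "('c, 'z) ring_scheme \<Rightarrow> ('c, 'n) module \<Rightarrow> ('b, 'y) ring_scheme \<Rightarrow> ('c \<Rightarrow> 'b) \<Rightarrow> ('m \<Rightarrow> 'n)
      \<Rightarrow> ('m \<times> 'b \<Rightarrow>\<^sub>0 int) set \<Rightarrow> ('n \<times> 'b \<Rightarrow>\<^sub>0 int) set" where
  "base_change_map R' M' S \<phi>' h C =
     (\<Union>z\<in>C. tensor_class R' M' S \<phi>' (frag_extend (\<lambda>(x, s). frag_of (h x, s)) z))"


section \<open>Ringed spaces and schemes\<close>

text \<open>Sections and restriction maps are only meaningful on open sets. (Spaces are called \<open>\<XX>\<close>
  because the plain letter is notation for the indeterminate in \<^theory>\<open>HOL-Algebra.Polynomials\<close>.)\<close>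

record ('x, 'a) ringed_space =
  top_space :: "'x topology"
  sections :: "'x set \<Rightarrow> 'a ring"
  restr :: "'x set \<Rightarrow> 'x set \<Rightarrow> 'a \<Rightarrow> 'a"

abbreviation points :: "('x, 'a) ringed_space \<Rightarrow> 'x set" where
  "points \<XX> \<equiv> topspace (top_space \<XX>)"

abbreviation is_open :: "('x, 'a) ringed_space \<Rightarrow> 'x set \<Rightarrow> bool" where
  "is_open \<XX> \<equiv> openin (top_space \<XX>)"

definition sheaf_gluing ::
    "'x topology \<Rightarrow> ('x set \<Rightarrow> ('s, 'z) partial_object_scheme) \<Rightarrow> ('x set \<Rightarrow> 'x set \<Rightarrow> 's \<Rightarrow> 's)
      \<Rightarrow> bool" where
  "sheaf_gluing T F \<rho> \<longleftrightarrow>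
     (\<forall>\<U> s. (\<forall>U\<in>\<U>. openin T U \<and> s U \<in> carrier (F U)) \<and>
            (\<forall>U\<in>\<U>. \<forall>V\<in>\<U>. \<rho> U (U \<inter> V) (s U) = \<rho> V (U \<inter> V) (s V))
        \<longrightarrow> (\<exists>!t. t \<in> carrier (F (\<Union>\<U>)) \<and> (\<forall>U\<in>\<U>. \<rho> (\<Union>\<U>) U t = s U)))"

locale ringed_space =
  fixes \<XX> :: "('x, 'a) ringed_space"
  assumes cring_sections: "is_open \<XX> U \<Longrightarrow> cring (sections \<XX> U)"
    and restr_hom: "\<lbrakk>is_open \<XX> U; is_open \<XX> V; V \<subseteq> U\<rbrakk>
        \<Longrightarrow> restr \<XX> U V \<in> ring_hom (sections \<XX> U) (sections \<XX> V)"
    and restr_id: "\<lbrakk>is_open \<XX> U; s \<in> carrier (sections \<XX> U)\<rbrakk> \<Longrightarrow> restr \<XX> U U s = s"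
    and restr_trans: "\<lbrakk>is_open \<XX> U; is_open \<XX> V; is_open \<XX> W; V \<subseteq> U; W \<subseteq> V;
        s \<in> carrier (sections \<XX> U)\<rbrakk> \<Longrightarrow> restr \<XX> V W (restr \<XX> U V s) = restr \<XX> U W s"
    and gluing: "sheaf_gluing (top_space \<XX>) (sections \<XX>) (restr \<XX>)"

definition germ ::
    "'x topology \<Rightarrow> ('x set \<Rightarrow> ('s, 'z) partial_object_scheme) \<Rightarrow> ('x set \<Rightarrow> 'x set \<Rightarrow> 's \<Rightarrow> 's)
      \<Rightarrow> 'x \<Rightarrow> 'x set \<Rightarrow> 's \<Rightarrow> ('x set \<times> 's) set" where
  "germ T F \<rho> x U s =
     {(V, t). openin T V \<and> x \<in> V \<and> t \<in> carrier (F V) \<and>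
        (\<exists>W. openin T W \<and> x \<in> W \<and> W \<subseteq> U \<inter> V \<and> \<rho> U W s = \<rho> V W t)}"

definition germs ::
    "'x topology \<Rightarrow> ('x set \<Rightarrow> ('s, 'z) partial_object_scheme) \<Rightarrow> ('x set \<Rightarrow> 'x set \<Rightarrow> 's \<Rightarrow> 's)
      \<Rightarrow> 'x \<Rightarrow> ('x set \<times> 's) set set" where
  "germs T F \<rho> x = {germ T F \<rho> x U s | U s. openin T U \<and> x \<in> U \<and> s \<in> carrier (F U)}"

abbreviation rgerm :: "('x, 'a) ringed_space \<Rightarrow> 'x \<Rightarrow> 'x set \<Rightarrow> 'a \<Rightarrow> ('x set \<times> 'a) set" where
  "rgerm \<XX> \<equiv> germ (top_space \<XX>) (sections \<XX>) (restr \<XX>)"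

definition stalk :: "('x, 'a) ringed_space \<Rightarrow> 'x \<Rightarrow> ('x set \<times> 'a) set ring" where
  "stalk \<XX> x =
     \<lparr>carrier = germs (top_space \<XX>) (sections \<XX>) (restr \<XX>) x,
      monoid.mult = (\<lambda>C D. \<Union>(U, s)\<in>C. \<Union>(V, t)\<in>D. rgerm \<XX> x (U \<inter> V)
                (restr \<XX> U (U \<inter> V) s \<otimes>\<^bsub>sections \<XX> (U \<inter> V)\<^esub> restr \<XX> V (U \<inter> V) t)),
      one = rgerm \<XX> x (points \<XX>) \<one>\<^bsub>sections \<XX> (points \<XX>)\<^esub>,
      ring.zero = rgerm \<XX> x (points \<XX>) \<zero>\<^bsub>sections \<XX> (points \<XX>)\<^esub>,
      ring.add = (\<lambda>C D. \<Union>(U, s)\<in>C. \<Union>(V, t)\<in>D. rgerm \<XX> x (U \<inter> V)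
                (restr \<XX> U (U \<inter> V) s \<oplus>\<^bsub>sections \<XX> (U \<inter> V)\<^esub> restr \<XX> V (U \<inter> V) t))\<rparr>"

definition locally_ringed_space :: "('x, 'a) ringed_space \<Rightarrow> bool" where
  "locally_ringed_space \<XX> \<longleftrightarrow> ringed_space \<XX> \<and> (\<forall>x\<in>points \<XX>. local_ring (stalk \<XX> x))"

text \<open>For a morphism \<open>f : \<XX> \<rightarrow> Y\<close> and \<open>V \<subseteq> Y\<close> open, \<open>sharp f V\<close> is
  \<open>\<O>\<^sub>Y(V) \<rightarrow> \<O>\<^sub>\<XX>(f\<^sup>-\<^sup>1(V))\<close>.\<close>

record ('x, 'a, 'y, 'b) space_map =
  base :: "'x \<Rightarrow> 'y"
  sharp :: "'y set \<Rightarrow> 'b \<Rightarrow> 'a"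

definition preimage ::
    "('x, 'a) ringed_space \<Rightarrow> ('x, 'a, 'y, 'b) space_map \<Rightarrow> 'y set \<Rightarrow> 'x set" where
  "preimage \<XX> f V = {x \<in> points \<XX>. base f x \<in> V}"

definition rs_morphism ::
    "('x, 'a) ringed_space \<Rightarrow> ('y, 'b) ringed_space \<Rightarrow> ('x, 'a, 'y, 'b) space_map \<Rightarrow> bool" where
  "rs_morphism \<XX> Y f \<longleftrightarrow>
     continuous_map (top_space \<XX>) (top_space Y) (base f) \<and>
     (\<forall>V. is_open Y V \<longrightarrow>
        sharp f V \<in> ring_hom (sections Y V) (sections \<XX> (preimage \<XX> f V))) \<and>
     (\<forall>V W. is_open Y V \<and> is_open Y W \<and> W \<subseteq> V \<longrightarrow>
        (\<forall>b\<in>carrier (sections Y V).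
           restr \<XX> (preimage \<XX> f V) (preimage \<XX> f W) (sharp f V b) = sharp f W (restr Y V W b)))"

definition stalk_map ::
    "('x, 'a) ringed_space \<Rightarrow> ('y, 'b) ringed_space \<Rightarrow> ('x, 'a, 'y, 'b) space_map \<Rightarrow> 'x
      \<Rightarrow> ('y set \<times> 'b) set \<Rightarrow> ('x set \<times> 'a) set" where
  "stalk_map \<XX> Y f x C = (\<Union>(V, b)\<in>C. rgerm \<XX> x (preimage \<XX> f V) (sharp f V b))"

definition lrs_morphism ::
    "('x, 'a) ringed_space \<Rightarrow> ('y, 'b) ringed_space \<Rightarrow> ('x, 'a, 'y, 'b) space_map \<Rightarrow> bool" where
  "lrs_morphism \<XX> Y f \<longleftrightarrow>
     rs_morphism \<XX> Y f \<and>
     (\<forall>x\<in>points \<XX>. \<forall>c\<in>carrier (stalk Y (base f x)).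
        stalk_map \<XX> Y f x c \<in> Units (stalk \<XX> x) \<longrightarrow> c \<in> Units (stalk Y (base f x)))"

text \<open>Equality of morphisms, disregarding values outside the carriers.\<close>

definition morphism_eq ::
    "('x, 'a) ringed_space \<Rightarrow> ('y, 'b) ringed_space \<Rightarrow> ('x, 'a, 'y, 'b) space_map
      \<Rightarrow> ('x, 'a, 'y, 'b) space_map \<Rightarrow> bool" where
  "morphism_eq \<XX> Y f g \<longleftrightarrow>
     (\<forall>x\<in>points \<XX>. base f x = base g x) \<and>
     (\<forall>V. is_open Y V \<longrightarrow> (\<forall>b\<in>carrier (sections Y V). sharp f V b = sharp g V b))"

definition id_morphism :: "('x, 'a, 'x, 'a) space_map" where
  "id_morphism = \<lparr>base = (\<lambda>x. x), sharp = (\<lambda>U a. a)\<rparr>"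

text \<open>\<open>comp_morphism Y g f\<close> is \<open>g \<circ> f\<close> for \<open>f : \<XX> \<rightarrow> Y\<close>, \<open>g : Y \<rightarrow> Z\<close>.\<close>

definition comp_morphism ::
    "('y, 'b) ringed_space \<Rightarrow> ('y, 'b, 'z, 'c) space_map \<Rightarrow> ('x, 'a, 'y, 'b) space_map
      \<Rightarrow> ('x, 'a, 'z, 'c) space_map" where
  "comp_morphism Y g f =
     \<lparr>base = (\<lambda>x. base g (base f x)),
      sharp = (\<lambda>W c. sharp f (preimage Y g W) (sharp g W c))\<rparr>"

definition rs_isomorphism ::
    "('x, 'a) ringed_space \<Rightarrow> ('y, 'b) ringed_space \<Rightarrow> ('x, 'a, 'y, 'b) space_map \<Rightarrow> bool" where
  "rs_isomorphism \<XX> Y f \<longleftrightarrow>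
     rs_morphism \<XX> Y f \<and>
     (\<exists>g. rs_morphism Y \<XX> g \<and> morphism_eq \<XX> \<XX> (comp_morphism Y g f) id_morphism \<and>
          morphism_eq Y Y (comp_morphism \<XX> f g) id_morphism)"

definition open_subspace :: "('x, 'a) ringed_space \<Rightarrow> 'x set \<Rightarrow> ('x, 'a) ringed_space" where
  "open_subspace \<XX> U = \<XX>\<lparr>top_space := subtopology (top_space \<XX>) U\<rparr>"

definition sections_ring :: "'p set \<Rightarrow> ('p \<Rightarrow> 'l ring) \<Rightarrow> ('p \<Rightarrow> 'l) set \<Rightarrow> ('p \<Rightarrow> 'l) ring" where
  "sections_ring U L C =
     \<lparr>carrier = {\<sigma> \<in> (\<Pi>\<^sub>E P\<in>U. carrier (L P)). \<sigma> \<in> C},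
      monoid.mult = (\<lambda>\<sigma> \<tau>. \<lambda>P\<in>U. \<sigma> P \<otimes>\<^bsub>L P\<^esub> \<tau> P),
      one = (\<lambda>P\<in>U. \<one>\<^bsub>L P\<^esub>),
      ring.zero = (\<lambda>P\<in>U. \<zero>\<^bsub>L P\<^esub>),
      ring.add = (\<lambda>\<sigma> \<tau>. \<lambda>P\<in>U. \<sigma> P \<oplus>\<^bsub>L P\<^esub> \<tau> P)\<rparr>"

definition spec_topology :: "('a, 'z) ring_scheme \<Rightarrow> 'a set topology" where
  "spec_topology A = topology_generated_by {{P. primeideal P A \<and> a \<notin> P} | a. a \<in> carrier A}"

definition Spec :: "('a, 'z) ring_scheme \<Rightarrow> ('a set, 'a set \<Rightarrow> ('a \<times> 'a) set) ringed_space" where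
  "Spec A =
     \<lparr>top_space = spec_topology A,
      sections = (\<lambda>U. sections_ring U (\<lambda>P. localization A (carrier A - P))
         {\<sigma>. \<forall>P\<in>U. \<exists>V a s. openin (spec_topology A) V \<and> P \<in> V \<and> V \<subseteq> U \<and>
               a \<in> carrier A \<and> s \<in> carrier A \<and>
               (\<forall>Q\<in>V. s \<notin> Q \<and> \<sigma> Q = fraction A (carrier A - Q) a s)}),
      restr = (\<lambda>U V \<sigma>. restrict \<sigma> V)\<rparr>"

text \<open>An open set isomorphic to \<open>Spec A\<close> for some ring \<open>A\<close> is isomorphic to the spectrum of its
  ring of sections, so no quantification over rings (and their types) is needed.\<close>

definition affine_open :: "('x, 'a) ringed_space \<Rightarrow> 'x set \<Rightarrow> bool" where
  "affine_open \<XX> U \<longleftrightarrow>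
     is_open \<XX> U \<and> (\<exists>f. rs_isomorphism (open_subspace \<XX> U) (Spec (sections \<XX> U)) f)"

definition scheme :: "('x, 'a) ringed_space \<Rightarrow> bool" where
  "scheme \<XX> \<longleftrightarrow>
     locally_ringed_space \<XX> \<and> (\<forall>x\<in>points \<XX>. \<exists>U. x \<in> U \<and> affine_open \<XX> U)"

definition integral_scheme :: "('x, 'a) ringed_space \<Rightarrow> bool" where
  "integral_scheme \<XX> \<longleftrightarrow>
     scheme \<XX> \<and> points \<XX> \<noteq> {} \<and> (\<forall>U. is_open \<XX> U \<and> U \<noteq> {} \<longrightarrow> domain (sections \<XX> U))"

text \<open>The structure map \<open>k \<rightarrow> \<O>\<^sub>\<XX>(U)\<close> of a scheme \<open>\<pi> : \<XX> \<rightarrow> Spec k\<close>.\<close>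

definition scalar ::
    "'k ring \<Rightarrow> ('x, 'a) ringed_space
      \<Rightarrow> ('x, 'a, 'k set, 'k set \<Rightarrow> ('k \<times> 'k) set) space_map \<Rightarrow> 'x set \<Rightarrow> 'k \<Rightarrow> 'a" where
  "scalar k \<XX> \<pi> U c =
     restr \<XX> (points \<XX>) U
       (sharp \<pi> (points (Spec k))
          (\<lambda>P\<in>points (Spec k). fraction k (carrier k - P) c \<one>\<^bsub>k\<^esub>))"


subsection \<open>Projective space\<close>

text \<open>Proj of a ring \<open>A\<close> with homogeneous parts \<open>H d\<close>.\<close>

definition proj_point :: "('a, 'z) ring_scheme \<Rightarrow> (nat \<Rightarrow> 'a set) \<Rightarrow> 'a set \<Rightarrow> bool" where
  "proj_point A H P \<longleftrightarrow>
     primeideal P A \<and> P = genideal A (P \<inter> (\<Union>d. H d)) \<and> \<not> (\<Union>d\<in>{0<..}. H d) \<subseteq> P"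

definition proj_topology :: "('a, 'z) ring_scheme \<Rightarrow> (nat \<Rightarrow> 'a set) \<Rightarrow> 'a set topology" where
  "proj_topology A H = topology_generated_by {{P. proj_point A H P \<and> a \<notin> P} | a d. a \<in> H d}"

definition homogeneous_localization ::
    "('a, 'z) ring_scheme \<Rightarrow> (nat \<Rightarrow> 'a set) \<Rightarrow> 'a set \<Rightarrow> ('a \<times> 'a) set ring" where
  "homogeneous_localization A H P =
     (localization A ((\<Union>d. H d) - P))
       \<lparr>carrier := {fraction A ((\<Union>d. H d) - P) a s | a s d. a \<in> H d \<and> s \<in> H d \<and> s \<notin> P}\<rparr>"

definition Proj ::
    "('a, 'z) ring_scheme \<Rightarrow> (nat \<Rightarrow> 'a set)
      \<Rightarrow> ('a set, 'a set \<Rightarrow> ('a \<times> 'a) set) ringed_space" where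
  "Proj A H =
     \<lparr>top_space = proj_topology A H,
      sections = (\<lambda>U. sections_ring U (homogeneous_localization A H)
         {\<sigma>. \<forall>P\<in>U. \<exists>V a s d. openin (proj_topology A H) V \<and> P \<in> V \<and> V \<subseteq> U \<and>
               a \<in> H d \<and> s \<in> H d \<and>
               (\<forall>Q\<in>V. s \<notin> Q \<and> \<sigma> Q = fraction A ((\<Union>d. H d) - Q) a s)}),
      restr = (\<lambda>U V \<sigma>. restrict \<sigma> V)\<rparr>"

definition projective_space ::
    "'k ring \<Rightarrow> nat \<Rightarrow> ((nat multiset \<Rightarrow> 'k) set,
       (nat multiset \<Rightarrow> 'k) set \<Rightarrow> ((nat multiset \<Rightarrow> 'k) \<times> (nat multiset \<Rightarrow> 'k)) set) ringed_space"
  where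
  "projective_space k n = Proj (mpoly_ring k {..n}) (homogeneous_part k {..n})"

definition projective_space_structure ::
    "'k ring \<Rightarrow> nat \<Rightarrow> ((nat multiset \<Rightarrow> 'k) set,
       (nat multiset \<Rightarrow> 'k) set \<Rightarrow> ((nat multiset \<Rightarrow> 'k) \<times> (nat multiset \<Rightarrow> 'k)) set,
       'k set, 'k set \<Rightarrow> ('k \<times> 'k) set) space_map" where
  "projective_space_structure k n =
     (let A = mpoly_ring k {..n}; H = homogeneous_part k {..n};
          b = (\<lambda>Q. {c \<in> carrier k. ring.indexed_const k c \<in> Q})
      in \<lparr>base = b,
          sharp = (\<lambda>W \<sigma>. \<lambda>Q\<in>{Q \<in> points (projective_space k n). b Q \<in> W}.
             \<Union>(c, s)\<in>\<sigma> (b Q).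
               fraction A ((\<Union>d. H d) - Q) (ring.indexed_const k c) (ring.indexed_const k s))\<rparr>)"

definition closed_immersion ::
    "('x, 'a) ringed_space \<Rightarrow> ('y, 'b) ringed_space \<Rightarrow> ('x, 'a, 'y, 'b) space_map \<Rightarrow> bool" where
  "closed_immersion \<XX> Y f \<longleftrightarrow>
     lrs_morphism \<XX> Y f \<and>
     embedding_map (top_space \<XX>) (top_space Y) (base f) \<and>
     closedin (top_space Y) (base f ` points \<XX>) \<and>
     (\<forall>V a y. is_open Y V \<and> a \<in> carrier (sections \<XX> (preimage \<XX> f V)) \<and> y \<in> V \<longrightarrow>
        (\<exists>W b. is_open Y W \<and> y \<in> W \<and> W \<subseteq> V \<and> b \<in> carrier (sections Y W) \<and>
           sharp f W b = restr \<XX> (preimage \<XX> f V) (preimage \<XX> f W) a))"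


subsection \<open>Smooth projective varieties\<close>

type_synonym ('x, 'a, 'k) over_field =
  "('x, 'a, 'k set, 'k set \<Rightarrow> ('k \<times> 'k) set) space_map"

definition projective_over :: "'k ring \<Rightarrow> ('x, 'a) ringed_space \<Rightarrow> ('x, 'a, 'k) over_field \<Rightarrow> bool"
  where
  "projective_over k \<XX> \<pi> \<longleftrightarrow>
     (\<exists>n i. closed_immersion \<XX> (projective_space k n) i \<and>
        morphism_eq \<XX> (Spec k)
          (comp_morphism (projective_space k n) (projective_space_structure k n) i) \<pi>)"

text \<open>Locally \<open>\<XX>\<close> is \<open>Spec k[x\<^sub>0,\<dots>,x\<^sub>n\<^sub>-\<^sub>1]/(f\<^sub>0,\<dots>,f\<^sub>c\<^sub>-\<^sub>1)\<close> with invertible Jacobian determinant of the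
  \<open>f\<^sub>i\<close> with respect to \<open>x\<^sub>0,\<dots>,x\<^sub>c\<^sub>-\<^sub>1\<close>; the presentation is given by the surjection \<open>ev\<close>.\<close>

definition smooth_over :: "'k ring \<Rightarrow> ('x, 'a) ringed_space \<Rightarrow> ('x, 'a, 'k) over_field \<Rightarrow> bool"
  where
  "smooth_over k \<XX> \<pi> \<longleftrightarrow>
     (\<forall>x\<in>points \<XX>. \<exists>U n c f ev.
        x \<in> U \<and> affine_open \<XX> U \<and> c \<le> n \<and>
        f \<in> {..<c} \<rightarrow> carrier (mpoly_ring k {..<n}) \<and>
        ev \<in> ring_hom (mpoly_ring k {..<n}) (sections \<XX> U) \<and>
        (\<forall>a\<in>carrier k. ev (ring.indexed_const k a) = scalar k \<XX> \<pi> U a) \<and>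
        ev ` carrier (mpoly_ring k {..<n}) = carrier (sections \<XX> U) \<and>
        a_kernel (mpoly_ring k {..<n}) (sections \<XX> U) ev
          = genideal (mpoly_ring k {..<n}) (f ` {..<c}) \<and>
        ring_det (sections \<XX> U) c (\<lambda>i j. ev (partial_deriv k j (f i))) \<in> Units (sections \<XX> U))"

text \<open>A closed subscheme of projective space is automatically separated and of finite type.\<close>

definition smooth_projective_variety ::
    "'k ring \<Rightarrow> ('x, 'a) ringed_space \<Rightarrow> ('x, 'a, 'k) over_field \<Rightarrow> bool" where
  "smooth_projective_variety k \<XX> \<pi> \<longleftrightarrow>
     integral_scheme \<XX> \<and> lrs_morphism \<XX> (Spec k) \<pi> \<and>
     projective_over k \<XX> \<pi> \<and> smooth_over k \<XX> \<pi>"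

definition rational_point ::
    "'k ring \<Rightarrow> ('x, 'a) ringed_space \<Rightarrow> ('x, 'a, 'k) over_field
      \<Rightarrow> ('k set, 'k set \<Rightarrow> ('k \<times> 'k) set, 'x, 'a) space_map \<Rightarrow> bool" where
  "rational_point k \<XX> \<pi> \<xi> \<longleftrightarrow>
     lrs_morphism (Spec k) \<XX> \<xi> \<and>
     morphism_eq (Spec k) (Spec k) (comp_morphism \<XX> \<pi> \<xi>) id_morphism"

definition frobenius :: "nat \<Rightarrow> ('x, 'a) ringed_space \<Rightarrow> ('x, 'a, 'x, 'a) space_map" where
  "frobenius p \<XX> = \<lparr>base = (\<lambda>x. x), sharp = (\<lambda>U a. a [^]\<^bsub>sections \<XX> U\<^esub> p)\<rparr>"


section \<open>Sheaves of modules\<close>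

record ('x, 'a, 'm) module_sheaf =
  msections :: "'x set \<Rightarrow> ('a, 'm) module"
  mrestr :: "'x set \<Rightarrow> 'x set \<Rightarrow> 'm \<Rightarrow> 'm"

locale module_sheaf = ringed_space \<XX>
  for \<XX> :: "('x, 'a) ringed_space" +
  fixes M :: "('x, 'a, 'm) module_sheaf"
  assumes module_sections: "is_open \<XX> U \<Longrightarrow> module (sections \<XX> U) (msections M U)"
    and mrestr_closed: "\<lbrakk>is_open \<XX> U; is_open \<XX> V; V \<subseteq> U\<rbrakk>
        \<Longrightarrow> mrestr M U V \<in> carrier (msections M U) \<rightarrow> carrier (msections M V)"
    and mrestr_add: "\<lbrakk>is_open \<XX> U; is_open \<XX> V; V \<subseteq> U;
        s \<in> carrier (msections M U); t \<in> carrier (msections M U)\<rbrakk>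
        \<Longrightarrow> mrestr M U V (s \<oplus>\<^bsub>msections M U\<^esub> t)
              = mrestr M U V s \<oplus>\<^bsub>msections M V\<^esub> mrestr M U V t"
    and mrestr_smult: "\<lbrakk>is_open \<XX> U; is_open \<XX> V; V \<subseteq> U;
        a \<in> carrier (sections \<XX> U); s \<in> carrier (msections M U)\<rbrakk>
        \<Longrightarrow> mrestr M U V (a \<odot>\<^bsub>msections M U\<^esub> s)
              = restr \<XX> U V a \<odot>\<^bsub>msections M V\<^esub> mrestr M U V s"
    and mrestr_id: "\<lbrakk>is_open \<XX> U; s \<in> carrier (msections M U)\<rbrakk> \<Longrightarrow> mrestr M U U s = s"
    and mrestr_trans: "\<lbrakk>is_open \<XX> U; is_open \<XX> V; is_open \<XX> W; V \<subseteq> U; W \<subseteq> V;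
        s \<in> carrier (msections M U)\<rbrakk> \<Longrightarrow> mrestr M V W (mrestr M U V s) = mrestr M U W s"
    and mgluing: "sheaf_gluing (top_space \<XX>) (msections M) (mrestr M)"

text \<open>Morphisms are normalised to be \<^const>\<open>undefined\<close> outside open sets and carriers, so that
  equality of morphisms is equality in HOL.\<close>

type_synonym ('x, 'm, 'n) sheaf_map = "'x set \<Rightarrow> 'm \<Rightarrow> 'n"

definition normalize_map ::
    "('x, 'a) ringed_space \<Rightarrow> ('x, 'a, 'm) module_sheaf \<Rightarrow> ('x, 'm, 'n) sheaf_map
      \<Rightarrow> ('x, 'm, 'n) sheaf_map" where
  "normalize_map \<XX> M \<phi> = (\<lambda>U\<in>{U. is_open \<XX> U}. \<lambda>s\<in>carrier (msections M U). \<phi> U s)"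

definition sheaf_hom ::
    "('x, 'a) ringed_space \<Rightarrow> ('x, 'a, 'm) module_sheaf \<Rightarrow> ('x, 'a, 'n) module_sheaf
      \<Rightarrow> ('x, 'm, 'n) sheaf_map \<Rightarrow> bool" where
  "sheaf_hom \<XX> M N \<phi> \<longleftrightarrow>
     normalize_map \<XX> M \<phi> = \<phi> \<and>
     (\<forall>U. is_open \<XX> U \<longrightarrow> module_hom (sections \<XX> U) (msections M U) (msections N U) (\<phi> U)) \<and>
     (\<forall>U V. is_open \<XX> U \<and> is_open \<XX> V \<and> V \<subseteq> U \<longrightarrow>
        (\<forall>s\<in>carrier (msections M U). mrestr N U V (\<phi> U s) = \<phi> V (mrestr M U V s)))"

definition sheaf_iso ::
    "('x, 'a) ringed_space \<Rightarrow> ('x, 'a, 'm) module_sheaf \<Rightarrow> ('x, 'a, 'n) module_sheaf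
      \<Rightarrow> ('x, 'm, 'n) sheaf_map \<Rightarrow> bool" where
  "sheaf_iso \<XX> M N \<phi> \<longleftrightarrow>
     sheaf_hom \<XX> M N \<phi> \<and>
     (\<forall>U. is_open \<XX> U \<longrightarrow> bij_betw (\<phi> U) (carrier (msections M U)) (carrier (msections N U)))"

definition sheaf_comp ::
    "('x, 'a) ringed_space \<Rightarrow> ('x, 'a, 'm) module_sheaf \<Rightarrow> ('x, 'n, 'l) sheaf_map
      \<Rightarrow> ('x, 'm, 'n) sheaf_map \<Rightarrow> ('x, 'm, 'l) sheaf_map" where
  "sheaf_comp \<XX> M \<psi> \<phi> = normalize_map \<XX> M (\<lambda>U s. \<psi> U (\<phi> U s))"

definition sheaf_inv ::
    "('x, 'a) ringed_space \<Rightarrow> ('x, 'a, 'm) module_sheaf \<Rightarrow> ('x, 'a, 'n) module_sheaf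
      \<Rightarrow> ('x, 'm, 'n) sheaf_map \<Rightarrow> ('x, 'n, 'm) sheaf_map" where
  "sheaf_inv \<XX> M N \<phi> = normalize_map \<XX> N (\<lambda>U. inv_into (carrier (msections M U)) (\<phi> U))"

definition free_sheaf ::
    "('x, 'a) ringed_space \<Rightarrow> nat \<Rightarrow> ('x, 'a, nat \<Rightarrow> 'a) module_sheaf" where
  "free_sheaf \<XX> r =
     \<lparr>msections = (\<lambda>U.
        \<lparr>carrier = (\<Pi>\<^sub>E i\<in>{..<r}. carrier (sections \<XX> U)), monoid.mult = undefined, one = undefined,
         ring.zero = (\<lambda>i\<in>{..<r}. \<zero>\<^bsub>sections \<XX> U\<^esub>),
         ring.add = (\<lambda>v w. \<lambda>i\<in>{..<r}. v i \<oplus>\<^bsub>sections \<XX> U\<^esub> w i),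
         smult = (\<lambda>a v. \<lambda>i\<in>{..<r}. a \<otimes>\<^bsub>sections \<XX> U\<^esub> v i)\<rparr>),
      mrestr = (\<lambda>U V v. \<lambda>i\<in>{..<r}. restr \<XX> U V (v i))\<rparr>"

definition vector_bundle ::
    "('x, 'a) ringed_space \<Rightarrow> nat \<Rightarrow> ('x, 'a, 'm) module_sheaf \<Rightarrow> bool" where
  "vector_bundle \<XX> r M \<longleftrightarrow>
     module_sheaf \<XX> M \<and>
     (\<forall>x\<in>points \<XX>. \<exists>U \<phi>. is_open \<XX> U \<and> x \<in> U \<and>
        sheaf_iso (open_subspace \<XX> U) M (free_sheaf (open_subspace \<XX> U) r) \<phi>)"

abbreviation mgerm ::
    "('x, 'a) ringed_space \<Rightarrow> ('x, 'a, 'm) module_sheaf \<Rightarrow> 'x \<Rightarrow> 'x set \<Rightarrow> 'm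
      \<Rightarrow> ('x set \<times> 'm) set" where
  "mgerm \<XX> M \<equiv> germ (top_space \<XX>) (msections M) (mrestr M)"

definition mstalk ::
    "('x, 'a) ringed_space \<Rightarrow> ('x, 'a, 'm) module_sheaf \<Rightarrow> 'x
      \<Rightarrow> (('x set \<times> 'a) set, ('x set \<times> 'm) set) module" where
  "mstalk \<XX> M x =
     \<lparr>carrier = germs (top_space \<XX>) (msections M) (mrestr M) x,
      monoid.mult = undefined, one = undefined,
      ring.zero = mgerm \<XX> M x (points \<XX>) \<zero>\<^bsub>msections M (points \<XX>)\<^esub>,
      ring.add = (\<lambda>C D. \<Union>(U, s)\<in>C. \<Union>(V, t)\<in>D. mgerm \<XX> M x (U \<inter> V)
                (mrestr M U (U \<inter> V) s \<oplus>\<^bsub>msections M (U \<inter> V)\<^esub> mrestr M V (U \<inter> V) t)),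
      smult = (\<lambda>c C. \<Union>(U, a)\<in>c. \<Union>(V, s)\<in>C. mgerm \<XX> M x (U \<inter> V)
                (restr \<XX> U (U \<inter> V) a \<odot>\<^bsub>msections M (U \<inter> V)\<^esub> mrestr M V (U \<inter> V) s))\<rparr>"

definition mstalk_map ::
    "('x, 'a) ringed_space \<Rightarrow> ('x, 'a, 'n) module_sheaf \<Rightarrow> ('x, 'm, 'n) sheaf_map \<Rightarrow> 'x
      \<Rightarrow> ('x set \<times> 'm) set \<Rightarrow> ('x set \<times> 'n) set" where
  "mstalk_map \<XX> N \<phi> x C = (\<Union>(U, s)\<in>C. mgerm \<XX> N x U (\<phi> U s))"


section \<open>Pullback of sheaves of modules\<close>

text \<open>
  For \<open>f : \<XX> \<rightarrow> Y\<close>, \<open>f\<^sup>*M = f\<^sup>-\<^sup>1M \<otimes> \<O>\<^sub>\<XX>\<close> (over \<open>f\<^sup>-\<^sup>1\<O>\<^sub>Y\<close>) is the sheaf associated with a presheaf whose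
  stalk at \<open>x\<close> is the base change of \<open>M\<^bsub>f(x)\<^esub>\<close> along \<open>\<O>\<^bsub>Y,f(x)\<^esub> \<rightarrow> \<O>\<^bsub>\<XX>,x\<^esub>\<close>. Its sections are the families of
  elements of the stalks which locally come from one finite sum of tensors \<open>m \<otimes> a\<close>, with \<open>m\<close> a
  section of \<open>M\<close> and \<open>a\<close> a section of \<open>\<O>\<^sub>\<XX>\<close>.
\<close>

type_synonym ('x, 'a, 'y, 'm) pullback_section =
  "'x \<Rightarrow> (('y set \<times> 'm) set \<times> ('x set \<times> 'a) set \<Rightarrow>\<^sub>0 int) set"

definition pullback_stalk ::
    "('x, 'a) ringed_space \<Rightarrow> ('y, 'b) ringed_space \<Rightarrow> ('x, 'a, 'y, 'b) space_map
      \<Rightarrow> ('y, 'b, 'm) module_sheaf \<Rightarrow> 'x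
      \<Rightarrow> (('x set \<times> 'a) set, (('y set \<times> 'm) set \<times> ('x set \<times> 'a) set \<Rightarrow>\<^sub>0 int) set) module" where
  "pullback_stalk \<XX> Y f M x =
     base_change (stalk Y (base f x)) (mstalk Y M (base f x)) (stalk \<XX> x) (stalk_map \<XX> Y f x)"

definition pullback_class ::
    "('x, 'a) ringed_space \<Rightarrow> ('y, 'b) ringed_space \<Rightarrow> ('x, 'a, 'y, 'b) space_map
      \<Rightarrow> ('y, 'b, 'm) module_sheaf \<Rightarrow> 'x
      \<Rightarrow> (('y set \<times> 'm) set \<times> ('x set \<times> 'a) set \<Rightarrow>\<^sub>0 int)
      \<Rightarrow> (('y set \<times> 'm) set \<times> ('x set \<times> 'a) set \<Rightarrow>\<^sub>0 int) set" where
  "pullback_class \<XX> Y f M x =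
     tensor_class (stalk Y (base f x)) (mstalk Y M (base f x)) (stalk \<XX> x) (stalk_map \<XX> Y f x)"

definition pullback_sections ::
    "('x, 'a) ringed_space \<Rightarrow> ('y, 'b) ringed_space \<Rightarrow> ('x, 'a, 'y, 'b) space_map
      \<Rightarrow> ('y, 'b, 'm) module_sheaf \<Rightarrow> 'x set \<Rightarrow> ('x, 'a, 'y, 'm) pullback_section set" where
  "pullback_sections \<XX> Y f M U =
     {s \<in> (\<Pi>\<^sub>E x\<in>U. carrier (pullback_stalk \<XX> Y f M x)).
        \<forall>x\<in>U. \<exists>W V ms. is_open \<XX> W \<and> x \<in> W \<and> W \<subseteq> U \<and> is_open Y V \<and> base f ` W \<subseteq> V \<and>
          set ms \<subseteq> carrier (msections M V) \<times> carrier (sections \<XX> W) \<and>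
          (\<forall>y\<in>W. s y = pullback_class \<XX> Y f M y
             (\<Sum>(m, a)\<leftarrow>ms. frag_of (mgerm Y M (base f y) V m, rgerm \<XX> y W a)))}"

definition pullback ::
    "('x, 'a) ringed_space \<Rightarrow> ('y, 'b) ringed_space \<Rightarrow> ('x, 'a, 'y, 'b) space_map
      \<Rightarrow> ('y, 'b, 'm) module_sheaf
      \<Rightarrow> ('x, 'a, ('x, 'a, 'y, 'm) pullback_section) module_sheaf" where
  "pullback \<XX> Y f M =
     \<lparr>msections = (\<lambda>U.
        \<lparr>carrier = pullback_sections \<XX> Y f M U, monoid.mult = undefined, one = undefined,
         ring.zero = (\<lambda>x\<in>U. \<zero>\<^bsub>pullback_stalk \<XX> Y f M x\<^esub>),
         ring.add = (\<lambda>s t. \<lambda>x\<in>U. s x \<oplus>\<^bsub>pullback_stalk \<XX> Y f M x\<^esub> t x),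
         smult = (\<lambda>a s. \<lambda>x\<in>U. rgerm \<XX> x U a \<odot>\<^bsub>pullback_stalk \<XX> Y f M x\<^esub> s x)\<rparr>),
      mrestr = (\<lambda>U V s. restrict s V)\<rparr>"

text \<open>\<open>f\<^sup>*\<phi> : f\<^sup>*M \<rightarrow> f\<^sup>*N\<close> for \<open>\<phi> : M \<rightarrow> N\<close>.\<close>

definition pullback_map ::
    "('x, 'a) ringed_space \<Rightarrow> ('y, 'b) ringed_space \<Rightarrow> ('x, 'a, 'y, 'b) space_map
      \<Rightarrow> ('y, 'b, 'm) module_sheaf \<Rightarrow> ('y, 'b, 'n) module_sheaf \<Rightarrow> ('y, 'm, 'n) sheaf_map
      \<Rightarrow> ('x, ('x, 'a, 'y, 'm) pullback_section, ('x, 'a, 'y, 'n) pullback_section) sheaf_map"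
  where
  "pullback_map \<XX> Y f M N \<phi> =
     normalize_map \<XX> (pullback \<XX> Y f M) (\<lambda>U s. \<lambda>x\<in>U.
       base_change_map (stalk Y (base f x)) (mstalk Y N (base f x)) (stalk \<XX> x)
         (stalk_map \<XX> Y f x) (mstalk_map Y N \<phi> (base f x)) (s x))"

text \<open>The adjunction unit \<open>M(V) \<rightarrow> (f\<^sup>*M)(f\<^sup>-\<^sup>1(V))\<close>, \<open>m \<mapsto> m \<otimes> 1\<close>.\<close>

definition pullback_unit ::
    "('x, 'a) ringed_space \<Rightarrow> ('y, 'b) ringed_space \<Rightarrow> ('x, 'a, 'y, 'b) space_map
      \<Rightarrow> ('y, 'b, 'm) module_sheaf \<Rightarrow> 'y set \<Rightarrow> 'm \<Rightarrow> ('x, 'a, 'y, 'm) pullback_section" where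
  "pullback_unit \<XX> Y f M V m =
     (\<lambda>x\<in>preimage \<XX> f V. pullback_class \<XX> Y f M x
        (frag_of (mgerm Y M (base f x) V m, \<one>\<^bsub>stalk \<XX> x\<^esub>)))"

text \<open>The canonical isomorphism \<open>(g \<circ> f)\<^sup>*M \<rightarrow> f\<^sup>*(g\<^sup>*M)\<close> for \<open>f : \<XX> \<rightarrow> Y\<close>, \<open>g : Y \<rightarrow> Z\<close>; on the stalk at
  \<open>x\<close> it sends \<open>m \<otimes> a\<close> to \<open>(m \<otimes> 1) \<otimes> a\<close>.\<close>

definition pullback_comp ::
    "('x, 'a) ringed_space \<Rightarrow> ('y, 'b) ringed_space \<Rightarrow> ('z, 'c) ringed_space
      \<Rightarrow> ('x, 'a, 'y, 'b) space_map \<Rightarrow> ('y, 'b, 'z, 'c) space_map \<Rightarrow> ('z, 'c, 'm) module_sheaf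
      \<Rightarrow> ('x, ('x, 'a, 'z, 'm) pullback_section,
           ('x, 'a, 'y, ('y, 'b, 'z, 'm) pullback_section) pullback_section) sheaf_map" where
  "pullback_comp \<XX> Y Z f g M =
     normalize_map \<XX> (pullback \<XX> Z (comp_morphism Y g f) M) (\<lambda>U s. \<lambda>x\<in>U.
       base_change_map (stalk Y (base f x)) (mstalk Y (pullback Y Z g M) (base f x)) (stalk \<XX> x)
         (stalk_map \<XX> Y f x)
         (\<lambda>C. \<Union>(V, m)\<in>C. mgerm Y (pullback Y Z g M) (base f x) (preimage Y g V)
                 (pullback_unit Y Z g M V m))
         (s x))"

text \<open>The canonical isomorphism \<open>\<O>\<^sub>\<XX>\<^sup>\<oplus>\<^sup>r \<rightarrow> f\<^sup>*(\<O>\<^sub>Y\<^sup>\<oplus>\<^sup>r)\<close>, \<open>a \<mapsto> \<Sum>\<^sub>i a\<^sub>i (e\<^sub>i \<otimes> 1)\<close>.\<close>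

definition pullback_free ::
    "('x, 'a) ringed_space \<Rightarrow> ('y, 'b) ringed_space \<Rightarrow> ('x, 'a, 'y, 'b) space_map \<Rightarrow> nat
      \<Rightarrow> ('x, nat \<Rightarrow> 'a, ('x, 'a, 'y, nat \<Rightarrow> 'b) pullback_section) sheaf_map" where
  "pullback_free \<XX> Y f r =
     (let P = pullback \<XX> Y f (free_sheaf Y r);
          e = (\<lambda>i. \<lambda>j\<in>{..<r}. if j = i then \<one>\<^bsub>sections Y (points Y)\<^esub> else \<zero>\<^bsub>sections Y (points Y)\<^esub>)
      in normalize_map \<XX> (free_sheaf \<XX> r) (\<lambda>U a.
           \<Oplus>\<^bsub>msections P U\<^esub>i\<in>{..<r}. a i \<odot>\<^bsub>msections P U\<^esub>
             mrestr P (points \<XX>) U (pullback_unit \<XX> Y f (free_sheaf Y r) (points Y) (e i))))"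


section \<open>Frames\<close>

type_synonym ('k, 'x, 'm) fibre_section =
  "('k set, 'k set \<Rightarrow> ('k \<times> 'k) set, 'x, 'm) pullback_section"

type_synonym ('k, 'x, 'm) frame_map =
  "('k set, ('k, 'x, 'm) fibre_section, nat \<Rightarrow> 'k set \<Rightarrow> ('k \<times> 'k) set) sheaf_map"

definition frame ::
    "'k ring \<Rightarrow> ('x, 'a) ringed_space \<Rightarrow> ('k set, 'k set \<Rightarrow> ('k \<times> 'k) set, 'x, 'a) space_map
      \<Rightarrow> nat \<Rightarrow> ('x, 'a, 'm) module_sheaf \<Rightarrow> ('k, 'x, 'm) frame_map \<Rightarrow> bool" where
  "frame k \<XX> \<xi> r V \<beta> \<longleftrightarrow> sheaf_iso (Spec k) (pullback (Spec k) \<XX> \<xi> V) (free_sheaf (Spec k) r) \<beta>"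

text \<open>The identification \<open>\<xi>\<^sup>*F\<^sub>\<XX>\<^sup>*V' = (F\<^sub>\<XX> \<circ> \<xi>)\<^sup>*V' = (\<xi> \<circ> F\<^sub>k)\<^sup>*V' = F\<^sub>k\<^sup>*\<xi>\<^sup>*V'\<close>. The two modules in
  the middle coincide because \<open>F\<^sub>\<XX> \<circ> \<xi>\<close> and \<open>\<xi> \<circ> F\<^sub>k\<close> agree on all sections.\<close>

definition frobenius_fibre_iso ::
    "nat \<Rightarrow> 'k ring \<Rightarrow> ('x, 'a) ringed_space
      \<Rightarrow> ('k set, 'k set \<Rightarrow> ('k \<times> 'k) set, 'x, 'a) space_map \<Rightarrow> ('x, 'a, 'm) module_sheaf
      \<Rightarrow> ('k set, ('k, 'x, ('x, 'a, 'x, 'm) pullback_section) fibre_section,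
           ('k, 'k set, ('k, 'x, 'm) fibre_section) fibre_section) sheaf_map" where
  "frobenius_fibre_iso p k \<XX> \<xi> V' =
     sheaf_comp (Spec k) (pullback (Spec k) \<XX> \<xi> (pullback \<XX> \<XX> (frobenius p \<XX>) V'))
       (pullback_comp (Spec k) (Spec k) \<XX> (frobenius p (Spec k)) \<xi> V')
       (sheaf_inv (Spec k)
          (pullback (Spec k) \<XX> (comp_morphism \<XX> (frobenius p \<XX>) \<xi>) V')
          (pullback (Spec k) \<XX> \<xi> (pullback \<XX> \<XX> (frobenius p \<XX>) V'))
          (pullback_comp (Spec k) \<XX> \<XX> \<xi> (frobenius p \<XX>) V'))"

text \<open>For \<open>\<beta>' : \<xi>\<^sup>*V' \<rightarrow> \<O>\<^sup>\<oplus>\<^sup>r\<close>, the composite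
  \<open>\<xi>\<^sup>*V \<rightarrow> \<xi>\<^sup>*F\<^sub>\<XX>\<^sup>*V' = F\<^sub>k\<^sup>*\<xi>\<^sup>*V' \<rightarrow> F\<^sub>k\<^sup>*(\<O>\<^sup>\<oplus>\<^sup>r) = \<O>\<^sup>\<oplus>\<^sup>r\<close>, where \<open>\<phi> : V \<rightarrow> F\<^sub>\<XX>\<^sup>*V'\<close> is the
  given identification \<open>V = F\<^sub>\<XX>\<^sup>*V'\<close>.\<close>

definition frobenius_pullback_frame ::
    "nat \<Rightarrow> 'k ring \<Rightarrow> ('x, 'a) ringed_space
      \<Rightarrow> ('k set, 'k set \<Rightarrow> ('k \<times> 'k) set, 'x, 'a) space_map \<Rightarrow> nat
      \<Rightarrow> ('x, 'a, 'n) module_sheaf \<Rightarrow> ('x, 'a, 'm) module_sheaf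
      \<Rightarrow> ('x, 'n, ('x, 'a, 'x, 'm) pullback_section) sheaf_map
      \<Rightarrow> ('k, 'x, 'm) frame_map \<Rightarrow> ('k, 'x, 'n) frame_map" where
  "frobenius_pullback_frame p k \<XX> \<xi> r V V' \<phi> \<beta>' =
     (let S = Spec k; F = frobenius p S; \<xi>V = pullback S \<XX> \<xi> V; \<xi>V' = pullback S \<XX> \<xi> V' in
      sheaf_comp S \<xi>V
        (sheaf_inv S (free_sheaf S r) (pullback S S F (free_sheaf S r)) (pullback_free S S F r))
        (sheaf_comp S \<xi>V
           (pullback_map S S F \<xi>V' (free_sheaf S r) \<beta>')
           (sheaf_comp S \<xi>V
              (frobenius_fibre_iso p k \<XX> \<xi> V')
              (pullback_map S \<XX> \<xi> V (pullback \<XX> \<XX> (frobenius p \<XX>) V') \<phi>))))"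

end

theory Submission
  imports Defs
begin

text \<open>
  Let \<open>S = Spec k\<close> and let \<open>F\<close> be its Frobenius. Since \<open>k\<close> is perfect, \<open>F\<close> is the identity on the
  single point of \<open>S\<close> and bijective on sections, that is, an automorphism of \<open>S\<close>. Therefore, for every
  module \<open>N\<close> on \<open>S\<close>, the adjunction unit \<open>u\<^sub>N : N \<rightarrow> F\<^sup>*N\<close>, \<open>n \<mapsto> n \<otimes> 1\<close>, is a bijection
  (\<open>scalar_extension.bij_betw_unit\<close>, \<open>one_point_twist.unit_bij\<close>), semilinear with respect to \<open>F\<close>. By
  naturality \<open>F\<^sup>*\<psi> = u \<circ> \<psi> \<circ> u\<^sup>-\<^sup>1\<close> for each \<open>\<psi> : N \<rightarrow> N'\<close>, so a given isomorphism \<open>\<gamma> : F\<^sup>*N \<rightarrow> F\<^sup>*N'\<close>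
  comes from exactly one map, namely \<open>\<psi> = u\<^sup>-\<^sup>1 \<circ> \<gamma> \<circ> u\<close>, in which the two Frobenius twists cancel, so
  that it is linear (\<open>one_point_twist.pullback_descent\<close>).

  The frames are put in this form by taking \<open>N = \<xi>\<^sup>*V'\<close> and \<open>N' = \<O>\<^sup>\<oplus>\<^sup>r\<close>. The equation
  \<open>\<beta> = F\<^sup>*(\<beta>')\<close> of the theorem composes the map \<open>F\<^sup>*\<beta>'\<close> with the identifications \<open>\<xi>\<^sup>*V \<cong> F\<^sup>*\<xi>\<^sup>*V'\<close> and
  \<open>F\<^sup>*\<O>\<^sup>\<oplus>\<^sup>r \<cong> \<O>\<^sup>\<oplus>\<^sup>r\<close>; once these are known to be isomorphisms, it says that \<open>F\<^sup>*\<beta>'\<close> is one particular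
  isomorphism \<open>\<gamma>\<close> built from \<open>\<beta>\<close> (\<open>frame_descent\<close>).

  Most of the work is in the identifications. The pullback of an isomorphism is an isomorphism
  (\<open>pullback_map_iso\<close>). The map \<open>(g \<circ> f)\<^sup>*M \<rightarrow> f\<^sup>*g\<^sup>*M\<close> is an isomorphism (\<open>pullback_comp_iso\<close>): on
  stalks it is \<open>M \<otimes>\<^sub>R T \<rightarrow> (g\<^sup>*M)\<^sub>y \<otimes>\<^sub>R\<^sub>' T\<close>, and an inverse on the image is found by evaluating germs of
  sections of \<open>g\<^sup>*M\<close> in \<open>M \<otimes>\<^sub>R R'\<close>, while the image is everything because \<open>(g\<^sup>*M)\<^sub>y\<close> is generated by the
  germs \<open>m \<otimes> 1\<close> (\<open>base_change_map_transitive\<close>). The morphisms \<open>F\<^sub>\<XX> \<circ> \<xi>\<close> and \<open>\<xi> \<circ> F\<close> induce the same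
  pullback because ring homomorphisms commute with \<open>p\<close>-th powers (\<open>pullback_cong\<close>). Finally
  \<open>\<O>\<^sup>\<oplus>\<^sup>r \<rightarrow> F\<^sup>*\<O>\<^sup>\<oplus>\<^sup>r\<close> is the unit of \<open>\<O>\<^sup>\<oplus>\<^sup>r\<close> composed with the extraction of \<open>p\<close>-th roots in each
  coordinate (\<open>one_point_twist.pullback_free_iso\<close>).

  On a one-point space the sections of a pullback over the point form the whole base change of the
  stalk (\<open>one_point_pullback.P_sections\<close>); this turns statements about sheaves on \<open>S\<close> into
  statements about modules.
\<close>

section \<open>Extension of scalars\<close>

definition pure_tensor where
  "pure_tensor R M S \<phi> m s = tensor_class R M S \<phi> (frag_of (m, s))"

locale scalar_extension =
  M: module R M + S: cring S
  for R :: "('a, 'z) ring_scheme" and M :: "('a, 'm) module" and S :: "('b, 'y) ring_scheme" +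
  fixes \<phi> :: "'a \<Rightarrow> 'b"
  assumes hom: "\<phi> \<in> ring_hom R S"
begin

abbreviation "Frags \<equiv> {z. Poly_Mapping.keys z \<subseteq> carrier M \<times> carrier S}"
abbreviation "Ker \<equiv> tensor_kernel R M S \<phi>"
abbreviation "cls \<equiv> tensor_class R M S \<phi>"
abbreviation "B \<equiv> base_change R M S \<phi>"
abbreviation "ten \<equiv> pure_tensor R M S \<phi>"

lemma hom_closed [simp]: "a \<in> carrier R \<Longrightarrow> \<phi> a \<in> carrier S"
  using hom by (rule ring_hom_closed)

lemma Frags_add: "z \<in> Frags \<Longrightarrow> w \<in> Frags \<Longrightarrow> z + w \<in> Frags"
  using keys_add[of z w] by auto

lemma Frags_diff: "z \<in> Frags \<Longrightarrow> w \<in> Frags \<Longrightarrow> z - w \<in> Frags"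
  using keys_diff[of z w] by auto

lemma relations_Frags: "tensor_relations R M S \<phi> \<subseteq> Frags"
proof
  have keys: "Poly_Mapping.keys (z - w) \<subseteq> A" if "Poly_Mapping.keys z \<subseteq> A" "Poly_Mapping.keys w \<subseteq> A"
    for z w :: "'m \<times> 'b \<Rightarrow>\<^sub>0 int" and A
    using that keys_diff[of z w] by blast
  fix z assume "z \<in> tensor_relations R M S \<phi>"
  then show "z \<in> Frags"
    unfolding tensor_relations_def
    by (elim UnE CollectE exE conjE) (simp_all add: keys)
qed

lemma Ker_subgroup: "subgroup Ker (free_Abelian_group (carrier M \<times> carrier S))"
  unfolding tensor_kernel_def
  by (rule group.generate_is_subgroup) (use relations_Frags in auto)

lemma Ker_Frags: "Ker \<subseteq> Frags"
  using subgroup.mem_carrier[OF Ker_subgroup] by (simp add: subset_eq)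

lemma Ker_zero: "0 \<in> Ker"
  using subgroup.one_closed[OF Ker_subgroup] by simp

lemma Ker_add: "z \<in> Ker \<Longrightarrow> w \<in> Ker \<Longrightarrow> z + w \<in> Ker"
  using subgroup.m_closed[OF Ker_subgroup] by simp

lemma Ker_minus: "z \<in> Ker \<Longrightarrow> - z \<in> Ker"
  using subgroup.m_inv_closed[OF Ker_subgroup, of z] Ker_Frags by auto

lemma Ker_diff: "z \<in> Ker \<Longrightarrow> w \<in> Ker \<Longrightarrow> z - w \<in> Ker"
  using Ker_add[of z "- w"] Ker_minus[of w] by simp

text \<open>
  The classes are cosets of the type-level group of formal sums, which reduces their equality to membership in the kernel.
\<close>

lemma cls_eq: "cls z = {w. w - z \<in> Ker}"
proof -
  have "cls z = (\<lambda>x. x + z) ` Ker"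
    unfolding tensor_class_def r_coset_def by auto
  also have "\<dots> = {w. w - z \<in> Ker}"
    by (auto intro!: image_eqI[where x = "_ - z"])
  finally show ?thesis .
qed

lemma cls_self: "z \<in> cls z"
  by (simp add: cls_eq Ker_zero)

lemma cls_eq_iff: "cls z = cls w \<longleftrightarrow> z - w \<in> Ker"
proof
  assume "cls z = cls w"
  then show "z - w \<in> Ker" using cls_self[of z] by (simp add: cls_eq)
next
  assume *: "z - w \<in> Ker"
  have "x - z \<in> Ker \<longleftrightarrow> x - w \<in> Ker" for x
    using Ker_add[of "x - z" "z - w"] Ker_diff[of "x - w" "z - w"] * by auto
  then show "cls z = cls w" by (simp add: cls_eq)
qed

lemma carrier_B: "carrier B = cls ` Frags"
  unfolding base_change_def tensor_class_def Let_def FactGroup_def RCOSETS_def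
  by auto

lemma cls_closed: "z \<in> Frags \<Longrightarrow> cls z \<in> carrier B"
  by (auto simp: carrier_B)

lemma add_B: assumes "z \<in> Frags" "w \<in> Frags"
  shows "cls z \<oplus>\<^bsub>B\<^esub> cls w = cls (z + w)"
proof -
  have "cls z \<oplus>\<^bsub>B\<^esub> cls w = {x + y | x y. x \<in> cls z \<and> y \<in> cls w}"
    unfolding base_change_def Let_def by (auto simp: FactGroup_def set_mult_def)
  also have "\<dots> = cls (z + w)"
  proof (intro equalityI subsetI)
    fix v assume "v \<in> {x + y | x y. x \<in> cls z \<and> y \<in> cls w}"
    then obtain x y where "v = x + y" "x - z \<in> Ker" "y - w \<in> Ker" by (auto simp: cls_eq)
    then show "v \<in> cls (z + w)"
      using Ker_add[of "x - z" "y - w"] by (simp add: cls_eq algebra_simps)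
  next
    fix v assume "v \<in> cls (z + w)"
    then have "v - w - z \<in> Ker" by (simp add: cls_eq algebra_simps)
    then have "v - w \<in> cls z" "w \<in> cls w" by (simp_all add: cls_eq Ker_zero)
    then show "v \<in> {x + y | x y. x \<in> cls z \<and> y \<in> cls w}"
      by (metis (mono_tags, lifting) diff_add_cancel mem_Collect_eq)
  qed
  finally show ?thesis .
qed

lemma zero_B: "\<zero>\<^bsub>B\<^esub> = cls 0"
  unfolding base_change_def Let_def by (auto simp: FactGroup_def cls_eq)

lemma abelian_group_B: "abelian_group B"
proof (rule abelian_groupI)
  fix x y z assume "x \<in> carrier B" "y \<in> carrier B" "z \<in> carrier B"
  then obtain a b c where "x = cls a" "y = cls b" "z = cls c" "a \<in> Frags" "b \<in> Frags" "c \<in> Frags"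
    by (auto simp: carrier_B)
  then show "x \<oplus>\<^bsub>B\<^esub> y \<oplus>\<^bsub>B\<^esub> z = x \<oplus>\<^bsub>B\<^esub> (y \<oplus>\<^bsub>B\<^esub> z)"
    using Frags_add[of a b] Frags_add[of b c] by (simp add: add_B algebra_simps)
next
  fix x y assume "x \<in> carrier B" "y \<in> carrier B"
  then obtain a b where "x = cls a" "y = cls b" "a \<in> Frags" "b \<in> Frags"
    by (auto simp: carrier_B)
  then show "x \<oplus>\<^bsub>B\<^esub> y \<in> carrier B" "x \<oplus>\<^bsub>B\<^esub> y = y \<oplus>\<^bsub>B\<^esub> x"
    using Frags_add[of a b] by (simp_all add: add_B cls_closed algebra_simps)
next
  show "\<zero>\<^bsub>B\<^esub> \<in> carrier B" by (simp add: zero_B cls_closed)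
next
  fix x assume "x \<in> carrier B"
  then obtain a where a: "x = cls a" "a \<in> Frags" by (auto simp: carrier_B)
  then show "\<zero>\<^bsub>B\<^esub> \<oplus>\<^bsub>B\<^esub> x = x" using add_B[of 0 a] by (simp add: zero_B)
  have "- a \<in> Frags" using a by simp
  then show "\<exists>y\<in>carrier B. y \<oplus>\<^bsub>B\<^esub> x = \<zero>\<^bsub>B\<^esub>"
    using a add_B[of "- a" a] by (intro bexI[of _ "cls (- a)"]) (simp_all add: zero_B cls_closed)
qed

lemma frag_of_Frags: "m \<in> carrier M \<Longrightarrow> s \<in> carrier S \<Longrightarrow> frag_of (m, s) \<in> Frags"
  by simp

lemma ten_closed [simp]: "m \<in> carrier M \<Longrightarrow> s \<in> carrier S \<Longrightarrow> ten m s \<in> carrier B"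
  by (simp add: pure_tensor_def cls_closed)

lemma relation_Ker: "z \<in> tensor_relations R M S \<phi> \<Longrightarrow> z \<in> Ker"
  unfolding tensor_kernel_def by (rule generate.incl)

lemma ten_add_left:
  assumes "x \<in> carrier M" "y \<in> carrier M" "s \<in> carrier S"
  shows "ten (x \<oplus>\<^bsub>M\<^esub> y) s = ten x s \<oplus>\<^bsub>B\<^esub> ten y s"
proof -
  have "frag_of (x \<oplus>\<^bsub>M\<^esub> y, s) - frag_of (x, s) - frag_of (y, s) \<in> Ker"
    by (rule relation_Ker) (use assms in \<open>auto simp: tensor_relations_def\<close>)
  then show ?thesis
    using assms by (simp add: pure_tensor_def add_B cls_eq_iff algebra_simps)
qed

lemma ten_add_right:
  assumes "x \<in> carrier M" "s \<in> carrier S" "t \<in> carrier S"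
  shows "ten x (s \<oplus>\<^bsub>S\<^esub> t) = ten x s \<oplus>\<^bsub>B\<^esub> ten x t"
proof -
  have "frag_of (x, s \<oplus>\<^bsub>S\<^esub> t) - frag_of (x, s) - frag_of (x, t) \<in> Ker"
    by (rule relation_Ker) (use assms in \<open>auto simp: tensor_relations_def\<close>)
  then show ?thesis
    using assms by (simp add: pure_tensor_def add_B cls_eq_iff algebra_simps)
qed

lemma ten_balanced:
  assumes "a \<in> carrier R" "x \<in> carrier M" "s \<in> carrier S"
  shows "ten (a \<odot>\<^bsub>M\<^esub> x) s = ten x (\<phi> a \<otimes>\<^bsub>S\<^esub> s)"
proof -
  have "frag_of (a \<odot>\<^bsub>M\<^esub> x, s) - frag_of (x, \<phi> a \<otimes>\<^bsub>S\<^esub> s) \<in> Ker"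
    by (rule relation_Ker) (use assms in \<open>auto simp: tensor_relations_def\<close>)
  then show ?thesis by (simp add: pure_tensor_def cls_eq_iff)
qed

text \<open>
  Formal sums have integer coefficients, but \<open>- (m \<otimes> s) = (- m) \<otimes> s\<close>, so pure tensors generate the base
  change under addition alone.
\<close>

lemma B_induct [consumes 1, case_names ten add]:
  assumes C: "C \<in> carrier B"
    and ten: "\<And>m s. m \<in> carrier M \<Longrightarrow> s \<in> carrier S \<Longrightarrow> P (ten m s)"
    and add: "\<And>C D. C \<in> carrier B \<Longrightarrow> D \<in> carrier B \<Longrightarrow> P C \<Longrightarrow> P D \<Longrightarrow> P (C \<oplus>\<^bsub>B\<^esub> D)"
  shows "P C"
proof -
  interpret B: abelian_group B by (rule abelian_group_B)
  have neg: "cls (- frag_of (m, s)) = ten (\<ominus>\<^bsub>M\<^esub> m) s" if "m \<in> carrier M" "s \<in> carrier S" for m s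
  proof -
    have "ten m s \<oplus>\<^bsub>B\<^esub> ten \<zero>\<^bsub>M\<^esub> s = ten m s"
      using ten_add_left[of m "\<zero>\<^bsub>M\<^esub>" s] that by simp
    then have "ten \<zero>\<^bsub>M\<^esub> s = \<zero>\<^bsub>B\<^esub>"
      using that by (subst (asm) B.add.l_cancel_one) simp_all
    then have "ten m s \<oplus>\<^bsub>B\<^esub> ten (\<ominus>\<^bsub>M\<^esub> m) s = \<zero>\<^bsub>B\<^esub>"
      using ten_add_left[of m "\<ominus>\<^bsub>M\<^esub> m" s] that by (simp add: M.M.r_neg)
    moreover have "ten m s \<oplus>\<^bsub>B\<^esub> cls (- frag_of (m, s)) = \<zero>\<^bsub>B\<^esub>"
      using that by (simp add: pure_tensor_def add_B zero_B)
    moreover have "cls (- frag_of (m, s)) \<in> carrier B" using that by (simp add: cls_closed)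
    ultimately show ?thesis
      using that B.add.right_cancel[of "ten m s" "cls (- frag_of (m, s))" "ten (\<ominus>\<^bsub>M\<^esub> m) s"]
      by (simp add: B.a_comm)
  qed
  have "z \<in> Frags \<and> P (cls z) \<and> P (cls (- z))" if "Poly_Mapping.keys z \<subseteq> carrier M \<times> carrier S" for z
    using that
  proof (induction z rule: frag_induction)
    case zero
    have "cls 0 = ten \<zero>\<^bsub>M\<^esub> \<zero>\<^bsub>S\<^esub> \<oplus>\<^bsub>B\<^esub> ten (\<ominus>\<^bsub>M\<^esub> \<zero>\<^bsub>M\<^esub>) \<zero>\<^bsub>S\<^esub>"
      using neg[of "\<zero>\<^bsub>M\<^esub>" "\<zero>\<^bsub>S\<^esub>"] add_B[of "frag_of (\<zero>\<^bsub>M\<^esub>, \<zero>\<^bsub>S\<^esub>)" "- frag_of (\<zero>\<^bsub>M\<^esub>, \<zero>\<^bsub>S\<^esub>)"]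
      by (simp add: pure_tensor_def)
    then have "P (cls 0)" by (simp add: add ten)
    then show ?case by simp
  next
    case (one x)
    then obtain m s where x: "x = (m, s)" "m \<in> carrier M" "s \<in> carrier S" by auto
    then have "P (ten m s)" "P (ten (\<ominus>\<^bsub>M\<^esub> m) s)" by (auto intro: ten)
    then show ?case using x neg by (simp add: pure_tensor_def)
  next
    case (diff a b)
    then have "cls a \<oplus>\<^bsub>B\<^esub> cls (- b) = cls (a - b)" "cls (- a) \<oplus>\<^bsub>B\<^esub> cls b = cls (- (a - b))"
      by (simp_all add: add_B)
    moreover have "P (cls a \<oplus>\<^bsub>B\<^esub> cls (- b))" "P (cls (- a) \<oplus>\<^bsub>B\<^esub> cls b)"
      using diff by (auto intro!: add simp: cls_closed)
    ultimately show ?case using diff Frags_diff[of a b] by simp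
  qed
  then show ?thesis using C by (auto simp: carrier_B)
qed

text \<open>
  An additive map on formal sums which respects the defining relations vanishes on the kernel that
  they generate, so the unions over representatives in \<^const>\<open>base_change\<close> and
  \<^const>\<open>base_change_map\<close> have a single member.
\<close>

lemma cls_const:
  fixes L :: "('e, 'l) ring_scheme"
  assumes L: "abelian_group L"
    and closed: "\<And>z. z \<in> Frags \<Longrightarrow> F z \<in> carrier L"
    and add: "\<And>z w. z \<in> Frags \<Longrightarrow> w \<in> Frags \<Longrightarrow> F (z + w) = F z \<oplus>\<^bsub>L\<^esub> F w"
    and left: "\<And>x y s. x \<in> carrier M \<Longrightarrow> y \<in> carrier M \<Longrightarrow> s \<in> carrier S \<Longrightarrow>
        F (frag_of (x \<oplus>\<^bsub>M\<^esub> y, s)) = F (frag_of (x, s)) \<oplus>\<^bsub>L\<^esub> F (frag_of (y, s))"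
    and right: "\<And>x s t. x \<in> carrier M \<Longrightarrow> s \<in> carrier S \<Longrightarrow> t \<in> carrier S \<Longrightarrow>
        F (frag_of (x, s \<oplus>\<^bsub>S\<^esub> t)) = F (frag_of (x, s)) \<oplus>\<^bsub>L\<^esub> F (frag_of (x, t))"
    and balanced: "\<And>a x s. a \<in> carrier R \<Longrightarrow> x \<in> carrier M \<Longrightarrow> s \<in> carrier S \<Longrightarrow>
        F (frag_of (a \<odot>\<^bsub>M\<^esub> x, s)) = F (frag_of (x, \<phi> a \<otimes>\<^bsub>S\<^esub> s))"
    and z: "z \<in> Frags" and w: "w \<in> cls z"
  shows "F w = F z"
proof -
  interpret L: abelian_group L by (rule L)
  let ?G = "free_Abelian_group (carrier M \<times> carrier S)"
  interpret F: group_hom ?G "add_monoid L" F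
    by (intro group_hom.intro group_hom_axioms.intro L.a_group homI) (simp_all add: closed add)
  have diff: "F (u - v) = \<zero>\<^bsub>L\<^esub>" if "u \<in> Frags" "v \<in> Frags" "F u = F v" for u v
  proof -
    have "F v = F (u - v) \<oplus>\<^bsub>L\<^esub> F v"
      using add[OF Frags_diff[OF that(1,2)] that(2)] that(3) by simp
    then show ?thesis
      using closed[OF Frags_diff[OF that(1,2)]] closed[OF that(2)] by (subst (asm) L.add.r_cancel_one') simp_all
  qed
  have ker_sub: "subgroup (kernel ?G (add_monoid L) F) ?G" by (rule F.subgroup_kernel)
  have "tensor_relations R M S \<phi> \<subseteq> kernel ?G (add_monoid L) F"
  proof
    fix u assume u: "u \<in> tensor_relations R M S \<phi>"
    have "F u = \<zero>\<^bsub>L\<^esub>" using u unfolding tensor_relations_def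
    proof (elim UnE CollectE exE conjE)
      fix x y s assume "u = frag_of (x \<oplus>\<^bsub>M\<^esub> y, s) - frag_of (x, s) - frag_of (y, s)"
        and xy: "x \<in> carrier M" "y \<in> carrier M" "s \<in> carrier S"
      then have u: "u = frag_of (x \<oplus>\<^bsub>M\<^esub> y, s) - (frag_of (x, s) + frag_of (y, s))" by simp
      show ?thesis using xy unfolding u
        by (intro diff frag_of_Frags Frags_add) (simp_all add: left add)
    next
      fix x s t assume "u = frag_of (x, s \<oplus>\<^bsub>S\<^esub> t) - frag_of (x, s) - frag_of (x, t)"
        and xy: "x \<in> carrier M" "s \<in> carrier S" "t \<in> carrier S"
      then have u: "u = frag_of (x, s \<oplus>\<^bsub>S\<^esub> t) - (frag_of (x, s) + frag_of (x, t))" by simp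
      show ?thesis using xy unfolding u
        by (intro diff frag_of_Frags Frags_add) (simp_all add: right add)
    next
      fix a x s assume u: "u = frag_of (a \<odot>\<^bsub>M\<^esub> x, s) - frag_of (x, \<phi> a \<otimes>\<^bsub>S\<^esub> s)"
        and xy: "a \<in> carrier R" "x \<in> carrier M" "s \<in> carrier S"
      show ?thesis unfolding u
        by (rule diff) (use xy in \<open>simp_all add: balanced\<close>)
    qed
    moreover have "u \<in> Frags" using relations_Frags u by blast
    ultimately show "u \<in> kernel ?G (add_monoid L) F" by (simp add: kernel_def)
  qed
  then have "Ker \<subseteq> kernel ?G (add_monoid L) F"
    unfolding tensor_kernel_def using group.generate_subgroup_incl[OF group_free_Abelian_group _ ker_sub] by blast
  then have k: "w - z \<in> Frags" "F (w - z) = \<zero>\<^bsub>L\<^esub>"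
    using w Ker_Frags by (auto simp: cls_eq kernel_def)
  then show ?thesis using add[of "w - z" z] z closed[OF z] by simp
qed

text \<open>
  The universal property of the base change. It is stated for additive maps, with linearity left to
  \<open>B_induct\<close>, because it is applied to maps which are linear over different rings.
\<close>

lemma balanced_lift:
  fixes L :: "('e, 'l) ring_scheme"
  assumes L: "abelian_group L"
    and closed: "\<And>x s. x \<in> carrier M \<Longrightarrow> s \<in> carrier S \<Longrightarrow> f x s \<in> carrier L"
    and left: "\<And>x y s. x \<in> carrier M \<Longrightarrow> y \<in> carrier M \<Longrightarrow> s \<in> carrier S \<Longrightarrow>
        f (x \<oplus>\<^bsub>M\<^esub> y) s = f x s \<oplus>\<^bsub>L\<^esub> f y s"
    and right: "\<And>x s t. x \<in> carrier M \<Longrightarrow> s \<in> carrier S \<Longrightarrow> t \<in> carrier S \<Longrightarrow>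
        f x (s \<oplus>\<^bsub>S\<^esub> t) = f x s \<oplus>\<^bsub>L\<^esub> f x t"
    and balanced: "\<And>a x s. a \<in> carrier R \<Longrightarrow> x \<in> carrier M \<Longrightarrow> s \<in> carrier S \<Longrightarrow>
        f (a \<odot>\<^bsub>M\<^esub> x) s = f x (\<phi> a \<otimes>\<^bsub>S\<^esub> s)"
  obtains h where "\<And>C. C \<in> carrier B \<Longrightarrow> h C \<in> carrier L"
    and "\<And>C D. C \<in> carrier B \<Longrightarrow> D \<in> carrier B \<Longrightarrow> h (C \<oplus>\<^bsub>B\<^esub> D) = h C \<oplus>\<^bsub>L\<^esub> h D"
    and "\<And>m s. m \<in> carrier M \<Longrightarrow> s \<in> carrier S \<Longrightarrow> h (ten m s) = f m s"
proof -
  interpret L: abelian_group L by (rule L)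
  let ?G = "free_Abelian_group (carrier M \<times> carrier S)"
  have "(\<lambda>(m, s). f m s) ` (carrier M \<times> carrier S) \<subseteq> carrier (add_monoid L)"
    using closed by auto
  then obtain F where F: "F \<in> Group.hom ?G (add_monoid L)"
    and of: "\<And>x. x \<in> carrier M \<times> carrier S \<Longrightarrow> F (frag_of x) = (\<lambda>(m, s). f m s) x"
    by (rule comm_group.free_Abelian_group_universal[OF L.a_comm_group]) blast
  have F_closed: "F z \<in> carrier L" if "z \<in> Frags" for z
    using hom_in_carrier[OF F, of z] that by simp
  have F_add: "F (z + w) = F z \<oplus>\<^bsub>L\<^esub> F w" if "z \<in> Frags" "w \<in> Frags" for z w
    using hom_mult[OF F, of z w] that by simp
  have const: "F w = F z" if "z \<in> Frags" "w \<in> cls z" for z w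
    by (rule cls_const[OF L F_closed F_add _ _ _ that]) (simp_all add: of left right balanced)
  define h where "h C = F (SOME z. z \<in> C)" for C
  have h: "h (cls z) = F z" if "z \<in> Frags" for z
    unfolding h_def using const[OF that] someI[of "\<lambda>w. w \<in> cls z", OF cls_self] by blast
  show ?thesis
  proof (rule that)
    show "h C \<in> carrier L" if "C \<in> carrier B" for C
      using that by (auto simp: carrier_B h F_closed)
    show "h (C \<oplus>\<^bsub>B\<^esub> D) = h C \<oplus>\<^bsub>L\<^esub> h D" if "C \<in> carrier B" "D \<in> carrier B" for C D
    proof -
      obtain z w where "C = cls z" "D = cls w" "z \<in> Frags" "w \<in> Frags"
        using \<open>C \<in> carrier B\<close> \<open>D \<in> carrier B\<close> by (auto simp: carrier_B)
      then show ?thesis using Frags_add[of z w] by (simp add: add_B h F_add)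
    qed
    show "h (ten m s) = f m s" if "m \<in> carrier M" "s \<in> carrier S" for m s
      using that h[of "frag_of (m, s)"] of[of "(m, s)"] by (simp add: pure_tensor_def)
  qed
qed

end

text \<open>
  The maps \<open>h \<otimes> q\<close> cover both places where the definitions extend a map by representatives: the scalar
  action on the base change (\<open>h\<close> the identity) and \<^const>\<open>base_change_map\<close> (\<open>q\<close> the identity).
\<close>

lemma tensor_map:
  fixes R :: "('a, 'z) ring_scheme" and M :: "('a, 'm) module" and S :: "('b, 'y) ring_scheme"
    and R' :: "('a2, 'z2) ring_scheme" and M' :: "('a2, 'm2) module" and S' :: "('b2, 'y2) ring_scheme"
  assumes "scalar_extension R M S \<phi>" and "scalar_extension R' M' S' \<phi>'"
    and h: "h \<in> carrier M \<rightarrow> carrier M'" and q: "q \<in> carrier S \<rightarrow> carrier S'"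
    and h_add: "\<And>x y. x \<in> carrier M \<Longrightarrow> y \<in> carrier M \<Longrightarrow> h (x \<oplus>\<^bsub>M\<^esub> y) = h x \<oplus>\<^bsub>M'\<^esub> h y"
    and q_add: "\<And>s t. s \<in> carrier S \<Longrightarrow> t \<in> carrier S \<Longrightarrow> q (s \<oplus>\<^bsub>S\<^esub> t) = q s \<oplus>\<^bsub>S'\<^esub> q t"
    and balanced: "\<And>a x s. a \<in> carrier R \<Longrightarrow> x \<in> carrier M \<Longrightarrow> s \<in> carrier S \<Longrightarrow>
        pure_tensor R' M' S' \<phi>' (h (a \<odot>\<^bsub>M\<^esub> x)) (q s) =
        pure_tensor R' M' S' \<phi>' (h x) (q (\<phi> a \<otimes>\<^bsub>S\<^esub> s))"
  defines "T \<equiv> \<lambda>C. \<Union>z\<in>C. tensor_class R' M' S' \<phi>' (frag_extend (\<lambda>(x, s). frag_of (h x, q s)) z)"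
  shows "C \<in> carrier (base_change R M S \<phi>) \<Longrightarrow> T C \<in> carrier (base_change R' M' S' \<phi>')"
    and "C \<in> carrier (base_change R M S \<phi>) \<Longrightarrow> D \<in> carrier (base_change R M S \<phi>) \<Longrightarrow>
      T (C \<oplus>\<^bsub>base_change R M S \<phi>\<^esub> D) = T C \<oplus>\<^bsub>base_change R' M' S' \<phi>'\<^esub> T D"
    and "m \<in> carrier M \<Longrightarrow> s \<in> carrier S \<Longrightarrow>
      T (pure_tensor R M S \<phi> m s) = pure_tensor R' M' S' \<phi>' (h m) (q s)"
proof -
  interpret A: scalar_extension R M S \<phi> by fact
  interpret A': scalar_extension R' M' S' \<phi>' by fact
  interpret B': abelian_group A'.B by (rule A'.abelian_group_B)
  let ?E = "frag_extend (\<lambda>(x, s). frag_of (h x, q s))"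
  define F where "F z = A'.cls (?E z)" for z
  have E: "?E z \<in> A'.Frags" if "z \<in> A.Frags" for z
  proof -
    have "Poly_Mapping.keys (case x of (m, s) \<Rightarrow> frag_of (h m, q s)) \<subseteq> carrier M' \<times> carrier S'"
      if "x \<in> Poly_Mapping.keys z" for x
      using that \<open>z \<in> A.Frags\<close> h q by (auto split: prod.splits)
    then show ?thesis using keys_frag_extend[of "\<lambda>(x, s). frag_of (h x, q s)" z] by blast
  qed
  have F_closed: "F z \<in> carrier A'.B" if "z \<in> A.Frags" for z
    using E[OF that] by (simp add: F_def A'.cls_closed)
  have F_add: "F (z + w) = F z \<oplus>\<^bsub>A'.B\<^esub> F w" if "z \<in> A.Frags" "w \<in> A.Frags" for z w
    using E[OF that(1)] E[OF that(2)] by (simp add: F_def frag_extend_add A'.add_B)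
  have F_of: "F (frag_of (m, s)) = A'.ten (h m) (q s)" for m s
    by (simp add: F_def pure_tensor_def)
  have const: "F w = F z" if "z \<in> A.Frags" "w \<in> A.cls z" for z w
  proof (rule A.cls_const[OF A'.abelian_group_B F_closed F_add _ _ _ that])
    fix x y s assume "x \<in> carrier M" "y \<in> carrier M" "s \<in> carrier S"
    then show "F (frag_of (x \<oplus>\<^bsub>M\<^esub> y, s)) = F (frag_of (x, s)) \<oplus>\<^bsub>A'.B\<^esub> F (frag_of (y, s))"
      using h q by (simp add: F_of h_add A'.ten_add_left Pi_iff)
  next
    fix x s t assume "x \<in> carrier M" "s \<in> carrier S" "t \<in> carrier S"
    then show "F (frag_of (x, s \<oplus>\<^bsub>S\<^esub> t)) = F (frag_of (x, s)) \<oplus>\<^bsub>A'.B\<^esub> F (frag_of (x, t))"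
      using h q by (simp add: F_of q_add A'.ten_add_right Pi_iff)
  qed (simp_all add: F_of balanced)
  have T: "T (A.cls z) = F z" if "z \<in> A.Frags" for z
    unfolding T_def using const[OF that] A.cls_self[of z] unfolding F_def by blast
  show "T C \<in> carrier A'.B" if "C \<in> carrier A.B"
    using that by (auto simp: A.carrier_B T F_closed)
  show "T (C \<oplus>\<^bsub>A.B\<^esub> D) = T C \<oplus>\<^bsub>A'.B\<^esub> T D" if "C \<in> carrier A.B" "D \<in> carrier A.B"
  proof -
    obtain z w where "C = A.cls z" "D = A.cls w" "z \<in> A.Frags" "w \<in> A.Frags"
      using \<open>C \<in> carrier A.B\<close> \<open>D \<in> carrier A.B\<close> by (auto simp: A.carrier_B)
    then show ?thesis using A.Frags_add[of z w] by (simp add: A.add_B T F_add)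
  qed
  show "T (A.ten m s) = A'.ten (h m) (q s)" if "m \<in> carrier M" "s \<in> carrier S"
    using T[of "frag_of (m, s)"] that F_of[of m s] by (simp add: pure_tensor_def)
qed

context scalar_extension
begin

lemma smult_B:
  assumes a: "a \<in> carrier S"
  shows "C \<in> carrier B \<Longrightarrow> a \<odot>\<^bsub>B\<^esub> C \<in> carrier B"
    and "C \<in> carrier B \<Longrightarrow> D \<in> carrier B \<Longrightarrow> a \<odot>\<^bsub>B\<^esub> (C \<oplus>\<^bsub>B\<^esub> D) = a \<odot>\<^bsub>B\<^esub> C \<oplus>\<^bsub>B\<^esub> a \<odot>\<^bsub>B\<^esub> D"
    and "m \<in> carrier M \<Longrightarrow> s \<in> carrier S \<Longrightarrow> a \<odot>\<^bsub>B\<^esub> ten m s = ten m (a \<otimes>\<^bsub>S\<^esub> s)"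
proof -
  have *: "a \<odot>\<^bsub>B\<^esub> C = (\<Union>z\<in>C. cls (frag_extend (\<lambda>(x, s). frag_of (x, a \<otimes>\<^bsub>S\<^esub> s)) z))" for C
    by (simp add: base_change_def Let_def)
  have bal: "ten (b \<odot>\<^bsub>M\<^esub> x) (a \<otimes>\<^bsub>S\<^esub> s) = ten x (a \<otimes>\<^bsub>S\<^esub> (\<phi> b \<otimes>\<^bsub>S\<^esub> s))"
    if "b \<in> carrier R" "x \<in> carrier M" "s \<in> carrier S" for b x s
    using that a by (simp add: ten_balanced S.m_lcomm)
  note T = tensor_map[where h = "\<lambda>x. x" and q = "\<lambda>s. a \<otimes>\<^bsub>S\<^esub> s", OF scalar_extension_axioms scalar_extension_axioms
      _ _ _ _ bal]
  show "C \<in> carrier B \<Longrightarrow> a \<odot>\<^bsub>B\<^esub> C \<in> carrier B"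
    unfolding * by (rule T(1)) (use a in \<open>auto simp: S.r_distr\<close>)
  show "C \<in> carrier B \<Longrightarrow> D \<in> carrier B \<Longrightarrow> a \<odot>\<^bsub>B\<^esub> (C \<oplus>\<^bsub>B\<^esub> D) = a \<odot>\<^bsub>B\<^esub> C \<oplus>\<^bsub>B\<^esub> a \<odot>\<^bsub>B\<^esub> D"
    unfolding * by (rule T(2)) (use a in \<open>auto simp: S.r_distr\<close>)
  show "m \<in> carrier M \<Longrightarrow> s \<in> carrier S \<Longrightarrow> a \<odot>\<^bsub>B\<^esub> ten m s = ten m (a \<otimes>\<^bsub>S\<^esub> s)"
    unfolding * by (rule T(3)) (use a in \<open>auto simp: S.r_distr\<close>)
qed

lemma module_B: "module S B"
proof (rule moduleI)
  interpret B: abelian_group B by (rule abelian_group_B)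
  fix a b x assume ab: "a \<in> carrier S" "b \<in> carrier S" and x: "x \<in> carrier B"
  from x show "(a \<oplus>\<^bsub>S\<^esub> b) \<odot>\<^bsub>B\<^esub> x = a \<odot>\<^bsub>B\<^esub> x \<oplus>\<^bsub>B\<^esub> b \<odot>\<^bsub>B\<^esub> x"
    by (induction rule: B_induct)
      (use ab in \<open>simp_all add: smult_B S.l_distr ten_add_right B.add.m_ac\<close>)
  from x show "(a \<otimes>\<^bsub>S\<^esub> b) \<odot>\<^bsub>B\<^esub> x = a \<odot>\<^bsub>B\<^esub> (b \<odot>\<^bsub>B\<^esub> x)"
    by (induction rule: B_induct) (use ab in \<open>simp_all add: smult_B S.m_assoc\<close>)
next
  fix x assume x: "x \<in> carrier B"
  from x show "\<one>\<^bsub>S\<^esub> \<odot>\<^bsub>B\<^esub> x = x"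
    by (induction rule: B_induct) (simp_all add: smult_B)
qed (simp_all add: smult_B abelian_group_B S.is_cring)

text \<open>
  Inverse to \<open>m \<mapsto> m \<otimes> 1\<close> is \<open>m \<otimes> s \<mapsto> \<phi>\<^sup>-\<^sup>1(s) m\<close>.
\<close>

lemma bij_betw_unit:
  assumes bij: "bij_betw \<phi> (carrier R) (carrier S)"
  shows "bij_betw (\<lambda>m. ten m \<one>\<^bsub>S\<^esub>) (carrier M) (carrier B)"
proof -
  let ?u = "\<lambda>m. ten m \<one>\<^bsub>S\<^esub>"
  define \<psi> where "\<psi> = inv_into (carrier R) \<phi>"
  have \<psi>: "\<psi> s \<in> carrier R" "\<phi> (\<psi> s) = s" if "s \<in> carrier S" for s
    using that bij unfolding \<psi>_def bij_betw_def by (auto simp: inv_into_into f_inv_into_f)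
  have \<psi>': "\<psi> (\<phi> a) = a" if "a \<in> carrier R" for a
    using that bij unfolding \<psi>_def bij_betw_def by (simp add: inv_into_f_f)
  have \<psi>_add: "\<psi> (s \<oplus>\<^bsub>S\<^esub> t) = \<psi> s \<oplus>\<^bsub>R\<^esub> \<psi> t" if "s \<in> carrier S" "t \<in> carrier S" for s t
    using ring_hom_add[OF hom, of "\<psi> s" "\<psi> t"] that \<psi>' \<psi> by (metis M.R.a_closed)
  have \<psi>_mult: "\<psi> (\<phi> a \<otimes>\<^bsub>S\<^esub> t) = \<psi> t \<otimes>\<^bsub>R\<^esub> a" if "a \<in> carrier R" "t \<in> carrier S" for a t
    using ring_hom_mult[OF hom, of a "\<psi> t"] that \<psi>'[of "a \<otimes>\<^bsub>R\<^esub> \<psi> t"] \<psi>[of t] by (simp add: M.R.m_comm)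
  have \<psi>_one: "\<psi> \<one>\<^bsub>S\<^esub> = \<one>\<^bsub>R\<^esub>"
    using ring_hom_one[OF hom] \<psi>'[of "\<one>\<^bsub>R\<^esub>"] by simp
  \<comment> \<open>The inverse map, defined on all tensors by the universal property.\<close>
  obtain h where h: "\<And>m s. m \<in> carrier M \<Longrightarrow> s \<in> carrier S \<Longrightarrow> h (ten m s) = \<psi> s \<odot>\<^bsub>M\<^esub> m"
  proof (rule balanced_lift[of M "\<lambda>m s. \<psi> s \<odot>\<^bsub>M\<^esub> m"])
    show "abelian_group M" by (rule M.abelian_group_axioms)
  qed (auto simp: \<psi> \<psi>_add \<psi>_mult M.smult_l_distr M.smult_r_distr M.smult_assoc1)
  have "inj_on ?u (carrier M)"
    by (rule inj_on_inverseI[where g = h]) (simp add: h \<psi>_one)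
  moreover have "?u ` carrier M = carrier B"
  proof (intro equalityI subsetI)
    fix C assume "C \<in> carrier B"
    then show "C \<in> ?u ` carrier M"
    proof (induction rule: B_induct)
      case (ten m s)
      then have "ten m s = ?u (\<psi> s \<odot>\<^bsub>M\<^esub> m)" by (simp add: ten_balanced \<psi>)
      then show ?case using ten \<psi> by blast
    next
      case (add C D)
      then obtain m n where mn: "C = ?u m" "D = ?u n" "m \<in> carrier M" "n \<in> carrier M" by auto
      then have "C \<oplus>\<^bsub>B\<^esub> D = ?u (m \<oplus>\<^bsub>M\<^esub> n)" by (simp add: ten_add_left)
      then show ?case using mn by blast
    qed
  qed auto
  ultimately show ?thesis by (simp add: bij_betw_def)
qed

end

text \<open>
  A \<open>\<theta>\<close>-semilinear map \<open>M \<rightarrow> M'\<close> induces a map of base changes to a common algebra \<open>S\<close>. The case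
  \<open>\<theta> = id\<close> is functoriality; the general case serves the map from a stalk to the stalk of a pullback.
\<close>

lemma base_change_map_semilinear:
  assumes "scalar_extension R M S \<phi>" and "scalar_extension R' M' S \<phi>'"
    and h: "h \<in> carrier M \<rightarrow> carrier M'" and \<theta>: "\<theta> \<in> carrier R \<rightarrow> carrier R'"
    and h_add: "\<And>x y. x \<in> carrier M \<Longrightarrow> y \<in> carrier M \<Longrightarrow> h (x \<oplus>\<^bsub>M\<^esub> y) = h x \<oplus>\<^bsub>M'\<^esub> h y"
    and h_smult: "\<And>a x. a \<in> carrier R \<Longrightarrow> x \<in> carrier M \<Longrightarrow> h (a \<odot>\<^bsub>M\<^esub> x) = \<theta> a \<odot>\<^bsub>M'\<^esub> h x"
    and \<theta>_comm: "\<And>a. a \<in> carrier R \<Longrightarrow> \<phi>' (\<theta> a) = \<phi> a"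
  shows "module_hom S (base_change R M S \<phi>) (base_change R' M' S \<phi>') (base_change_map R' M' S \<phi>' h)"
    and "\<And>m s. m \<in> carrier M \<Longrightarrow> s \<in> carrier S \<Longrightarrow>
      base_change_map R' M' S \<phi>' h (pure_tensor R M S \<phi> m s) = pure_tensor R' M' S \<phi>' (h m) s"
proof -
  interpret A: scalar_extension R M S \<phi> by fact
  interpret A': scalar_extension R' M' S \<phi>' by fact
  interpret B: module S A.B by (rule A.module_B)
  interpret B': module S A'.B by (rule A'.module_B)
  let ?H = "base_change_map R' M' S \<phi>' h"
  have bal: "A'.ten (h (a \<odot>\<^bsub>M\<^esub> x)) s = A'.ten (h x) (\<phi> a \<otimes>\<^bsub>S\<^esub> s)"
    if "a \<in> carrier R" "x \<in> carrier M" "s \<in> carrier S" for a x s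
    using that A'.ten_balanced[of "\<theta> a" "h x" s] \<theta> h by (simp add: h_smult \<theta>_comm Pi_iff)
  note T = tensor_map[where h = h and q = "\<lambda>s. s", OF assms(1) assms(2) h _ h_add _ bal,
      folded base_change_map_def]
  have closed: "?H C \<in> carrier A'.B" if "C \<in> carrier A.B" for C
    using T(1)[of C] that by simp
  have H_add: "?H (C \<oplus>\<^bsub>A.B\<^esub> D) = ?H C \<oplus>\<^bsub>A'.B\<^esub> ?H D" if "C \<in> carrier A.B" "D \<in> carrier A.B" for C D
    using T(2)[of C D] that by simp
  show H_ten: "?H (A.ten m s) = A'.ten (h m) s" if "m \<in> carrier M" "s \<in> carrier S" for m s
    using T(3)[of m s] that by simp
  have "?H (a \<odot>\<^bsub>A.B\<^esub> C) = a \<odot>\<^bsub>A'.B\<^esub> ?H C" if a: "a \<in> carrier S" and C: "C \<in> carrier A.B" for a C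
    using C
  proof (induction rule: A.B_induct)
    case (ten m s)
    then show ?case using a h by (simp add: A.smult_B A'.smult_B H_ten Pi_iff)
  next
    case (add C D)
    then show ?case using a by (simp add: B.smult_r_distr B'.smult_r_distr H_add closed)
  qed
  then show "module_hom S A.B A'.B ?H"
    unfolding module_hom_def using closed H_add by auto
qed

lemma base_change_map_bij:
  assumes "scalar_extension R M S \<phi>" and "scalar_extension R M' S \<phi>"
    and h: "module_hom R M M' h" and bij: "bij_betw h (carrier M) (carrier M')"
  shows "module_hom S (base_change R M S \<phi>) (base_change R M' S \<phi>) (base_change_map R M' S \<phi> h)"
    and "bij_betw (base_change_map R M' S \<phi> h) (carrier (base_change R M S \<phi>)) (carrier (base_change R M' S \<phi>))"
proof -
  interpret A: scalar_extension R M S \<phi> by fact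
  interpret A': scalar_extension R M' S \<phi> by fact
  let ?H = "base_change_map R M' S \<phi> h"
  define g where "g = inv_into (carrier M) h"
  have g: "g x \<in> carrier M" "h (g x) = x" if "x \<in> carrier M'" for x
    using that bij unfolding g_def bij_betw_def by (auto simp: inv_into_into f_inv_into_f)
  have g': "g (h x) = x" if "x \<in> carrier M" for x
    using that bij unfolding g_def bij_betw_def by (simp add: inv_into_f_f)
  have g_add: "g (x \<oplus>\<^bsub>M'\<^esub> y) = g x \<oplus>\<^bsub>M\<^esub> g y" if "x \<in> carrier M'" "y \<in> carrier M'" for x y
    using that h g g'[of "g x \<oplus>\<^bsub>M\<^esub> g y"] by (simp add: module_hom_def)
  have g_smult: "g (a \<odot>\<^bsub>M'\<^esub> x) = a \<odot>\<^bsub>M\<^esub> g x" if "a \<in> carrier R" "x \<in> carrier M'" for a x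
    using that h g g'[of "a \<odot>\<^bsub>M\<^esub> g x"] by (simp add: module_hom_def)
  let ?G = "base_change_map R M S \<phi> g"
  have h_fun: "h \<in> carrier M \<rightarrow> carrier M'" using h by (simp add: module_hom_def)
  have g_fun: "g \<in> carrier M' \<rightarrow> carrier M" using g by auto
  note H = base_change_map_semilinear[OF assms(1,2) h_fun, of "\<lambda>a. a"]
    and G = base_change_map_semilinear[OF assms(2,1) g_fun, of "\<lambda>a. a"]
  show hom: "module_hom S A.B A'.B ?H" by (rule H) (use h in \<open>auto simp: module_hom_def\<close>)
  have hom': "module_hom S A'.B A.B ?G" by (rule G) (auto simp: g_add g_smult)
  have H_ten: "?H (A.ten m s) = A'.ten (h m) s" if "m \<in> carrier M" "s \<in> carrier S" for m s
    by (rule H) (use h that in \<open>auto simp: module_hom_def\<close>)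
  have G_ten: "?G (A'.ten m s) = A.ten (g m) s" if "m \<in> carrier M'" "s \<in> carrier S" for m s
    by (rule G) (use that in \<open>auto simp: g_add g_smult\<close>)
  have GH: "?G (?H C) = C" if "C \<in> carrier A.B" for C
    using that
  proof (induction rule: A.B_induct)
    case (ten m s)
    then show ?case using h_fun by (simp add: H_ten G_ten g' Pi_iff)
  next
    case (add C D)
    then show ?case using hom hom' by (simp add: module_hom_def Pi_iff)
  qed
  have HG: "?H (?G D) = D" if "D \<in> carrier A'.B" for D
    using that
  proof (induction rule: A'.B_induct)
    case (ten m s)
    then show ?case using H_ten[of "g m" s] g[of m] by (simp add: G_ten)
  next
    case (add C D)
    then show ?case using hom hom' by (simp add: module_hom_def Pi_iff)
  qed
  show "bij_betw ?H (carrier A.B) (carrier A'.B)"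
    by (rule bij_betw_byWitness[where f' = ?G]) (use GH HG hom hom' in \<open>auto simp: module_hom_def\<close>)
qed

text \<open>
  Here \<open>N\<close> plays the role of the stalk of a pullback: it receives a semilinear map \<open>h\<close> from \<open>M\<close>, is
  generated by the image of \<open>h\<close>, and has an evaluation map \<open>ev\<close> to \<open>M \<otimes>\<^sub>R R'\<close> with \<open>ev (h m) = m \<otimes> 1\<close>.
  This suffices for \<open>M \<otimes>\<^sub>R S \<cong> N \<otimes>\<^sub>R\<^sub>' S\<close>, and avoids deciding when a section of a pullback with value
  \<open>0\<close> at a point vanishes near that point. Injectivity: \<open>n \<otimes> s \<mapsto> s \<cdot> (id \<otimes> \<psi>)(ev n)\<close> is a left inverse.
  Surjectivity: \<open>(b \<cdot> h m) \<otimes> s = h m \<otimes> \<psi>(b) s\<close>.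
\<close>

lemma base_change_map_transitive:
  assumes "scalar_extension R M S \<phi>" and "scalar_extension R M R' \<theta>" and "scalar_extension R' N S \<psi>"
    and comp: "\<And>a. a \<in> carrier R \<Longrightarrow> \<psi> (\<theta> a) = \<phi> a"
    and h: "h \<in> carrier M \<rightarrow> carrier N"
    and h_add: "\<And>x y. x \<in> carrier M \<Longrightarrow> y \<in> carrier M \<Longrightarrow> h (x \<oplus>\<^bsub>M\<^esub> y) = h x \<oplus>\<^bsub>N\<^esub> h y"
    and h_smult: "\<And>a x. a \<in> carrier R \<Longrightarrow> x \<in> carrier M \<Longrightarrow> h (a \<odot>\<^bsub>M\<^esub> x) = \<theta> a \<odot>\<^bsub>N\<^esub> h x"
    and ev: "module_hom R' N (base_change R M R' \<theta>) ev"
    and ev_h: "\<And>m. m \<in> carrier M \<Longrightarrow> ev (h m) = pure_tensor R M R' \<theta> m \<one>\<^bsub>R'\<^esub>"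
    and gen: "\<And>A n. n \<in> carrier N \<Longrightarrow> (\<And>b m. b \<in> carrier R' \<Longrightarrow> m \<in> carrier M \<Longrightarrow> b \<odot>\<^bsub>N\<^esub> h m \<in> A) \<Longrightarrow>
        (\<And>x y. x \<in> carrier N \<Longrightarrow> y \<in> carrier N \<Longrightarrow> x \<in> A \<Longrightarrow> y \<in> A \<Longrightarrow> x \<oplus>\<^bsub>N\<^esub> y \<in> A) \<Longrightarrow> n \<in> A"
  shows "module_hom S (base_change R M S \<phi>) (base_change R' N S \<psi>) (base_change_map R' N S \<psi> h)"
    and "bij_betw (base_change_map R' N S \<psi> h) (carrier (base_change R M S \<phi>)) (carrier (base_change R' N S \<psi>))"
proof -
  interpret A: scalar_extension R M S \<phi> by fact
  interpret A1: scalar_extension R M R' \<theta> by fact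
  interpret A': scalar_extension R' N S \<psi> by fact
  interpret B: module S A.B by (rule A.module_B)
  interpret B1: module R' A1.B by (rule A1.module_B)
  interpret B': module S A'.B by (rule A'.module_B)
  let ?H = "base_change_map R' N S \<psi> h"
  have h_closed: "h x \<in> carrier N" if "x \<in> carrier M" for x using h that by auto
  note H = base_change_map_semilinear[OF assms(1,3) h _ h_add h_smult comp]
  show hom: "module_hom S A.B A'.B ?H" by (rule H) auto
  have H_ten: "?H (A.ten m s) = A'.ten (h m) s" if "m \<in> carrier M" "s \<in> carrier S" for m s
    by (rule H) (use that in auto)
  have H_closed: "?H C \<in> carrier A'.B" if "C \<in> carrier A.B" for C
    using hom that by (auto simp: module_hom_def)
  have H_add: "?H (C \<oplus>\<^bsub>A.B\<^esub> D) = ?H C \<oplus>\<^bsub>A'.B\<^esub> ?H D" if "C \<in> carrier A.B" "D \<in> carrier A.B" for C D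
    using hom that by (auto simp: module_hom_def)
  have \<psi>_mult: "\<psi> (a \<otimes>\<^bsub>R'\<^esub> b) = \<psi> a \<otimes>\<^bsub>S\<^esub> \<psi> b" if "a \<in> carrier R'" "b \<in> carrier R'" for a b
    using ring_hom_mult[OF A'.hom] that by simp
  have \<psi>_add: "\<psi> (a \<oplus>\<^bsub>R'\<^esub> b) = \<psi> a \<oplus>\<^bsub>S\<^esub> \<psi> b" if "a \<in> carrier R'" "b \<in> carrier R'" for a b
    using ring_hom_add[OF A'.hom] that by simp
  \<comment> \<open>\<open>j = id \<otimes> \<psi>\<close> and the left inverse \<open>k\<close> of the map in question.\<close>
  obtain j where j_closed: "\<And>C. C \<in> carrier A1.B \<Longrightarrow> j C \<in> carrier A.B"
    and j_add: "\<And>C D. C \<in> carrier A1.B \<Longrightarrow> D \<in> carrier A1.B \<Longrightarrow> j (C \<oplus>\<^bsub>A1.B\<^esub> D) = j C \<oplus>\<^bsub>A.B\<^esub> j D"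
    and j_ten: "\<And>m s. m \<in> carrier M \<Longrightarrow> s \<in> carrier R' \<Longrightarrow> j (A1.ten m s) = A.ten m (\<psi> s)"
    by (rule A1.balanced_lift[OF A.abelian_group_B, of "\<lambda>m s. A.ten m (\<psi> s)"])
      (auto simp: A.ten_add_left A.ten_add_right A.ten_balanced \<psi>_mult \<psi>_add comp)
  have j_smult: "j (b \<odot>\<^bsub>A1.B\<^esub> C) = \<psi> b \<odot>\<^bsub>A.B\<^esub> j C" if b: "b \<in> carrier R'" and C: "C \<in> carrier A1.B" for b C
    using C
    by (induction rule: A1.B_induct)
      (use b in \<open>simp_all add: A1.smult_B A.smult_B j_ten j_add j_closed \<psi>_mult\<close>)
  have ev_closed: "ev n \<in> carrier A1.B" if "n \<in> carrier N" for n using ev that by (auto simp: module_hom_def)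
  have ev_add: "ev (n \<oplus>\<^bsub>N\<^esub> n') = ev n \<oplus>\<^bsub>A1.B\<^esub> ev n'" if "n \<in> carrier N" "n' \<in> carrier N" for n n'
    using ev that by (auto simp: module_hom_def)
  have ev_smult: "ev (b \<odot>\<^bsub>N\<^esub> n) = b \<odot>\<^bsub>A1.B\<^esub> ev n" if "b \<in> carrier R'" "n \<in> carrier N" for n b
    using ev that by (auto simp: module_hom_def)
  obtain k where k_add: "\<And>C D. C \<in> carrier A'.B \<Longrightarrow> D \<in> carrier A'.B \<Longrightarrow> k (C \<oplus>\<^bsub>A'.B\<^esub> D) = k C \<oplus>\<^bsub>A.B\<^esub> k D"
    and k_ten: "\<And>n s. n \<in> carrier N \<Longrightarrow> s \<in> carrier S \<Longrightarrow> k (A'.ten n s) = s \<odot>\<^bsub>A.B\<^esub> j (ev n)"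
  proof (rule A'.balanced_lift[OF A.abelian_group_B, of "\<lambda>n s. s \<odot>\<^bsub>A.B\<^esub> j (ev n)"])
    fix a x s assume "a \<in> carrier R'" "x \<in> carrier N" "s \<in> carrier S"
    then show "s \<odot>\<^bsub>A.B\<^esub> j (ev (a \<odot>\<^bsub>N\<^esub> x)) = (\<psi> a \<otimes>\<^bsub>S\<^esub> s) \<odot>\<^bsub>A.B\<^esub> j (ev x)"
      by (simp add: ev_smult j_smult ev_closed j_closed B.smult_assoc1[symmetric] A.S.m_comm)
  qed (auto simp: ev_closed j_closed ev_add j_add B.smult_l_distr B.smult_r_distr)
  have kH: "k (?H C) = C" if "C \<in> carrier A.B" for C
    using that
  proof (induction rule: A.B_induct)
    case (ten m s)
    have "\<psi> \<one>\<^bsub>R'\<^esub> = \<one>\<^bsub>S\<^esub>" using A'.hom by (rule ring_hom_one)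
    then show ?case using ten by (simp add: H_ten k_ten h_closed ev_h j_ten A.smult_B)
  qed (simp add: H_closed H_add k_add)
  have "inj_on ?H (carrier A.B)"
    by (rule inj_on_inverseI[where g = k]) (rule kH)
  moreover have "?H ` carrier A.B = carrier A'.B"
  proof (intro equalityI subsetI)
    have add: "C \<oplus>\<^bsub>A'.B\<^esub> D \<in> ?H ` carrier A.B" if "C \<in> ?H ` carrier A.B" "D \<in> ?H ` carrier A.B" for C D
    proof -
      obtain m n where mn: "C = ?H m" "D = ?H n" "m \<in> carrier A.B" "n \<in> carrier A.B" using \<open>C \<in> _\<close> \<open>D \<in> _\<close> by auto
      then have "C \<oplus>\<^bsub>A'.B\<^esub> D = ?H (m \<oplus>\<^bsub>A.B\<^esub> n)" by (simp add: H_add)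
      then show ?thesis using mn by blast
    qed
    fix C assume "C \<in> carrier A'.B"
    then show "C \<in> ?H ` carrier A.B"
    proof (induction rule: A'.B_induct)
      case (ten n s)
      from \<open>n \<in> carrier N\<close> have "n \<in> {n. A'.ten n s \<in> ?H ` carrier A.B}"
      proof (rule gen)
        fix b m assume bm: "b \<in> carrier R'" "m \<in> carrier M"
        then have "A'.ten (b \<odot>\<^bsub>N\<^esub> h m) s = ?H (A.ten m (\<psi> b \<otimes>\<^bsub>S\<^esub> s))"
          using ten by (simp add: A'.ten_balanced h_closed H_ten)
        then show "b \<odot>\<^bsub>N\<^esub> h m \<in> {n. A'.ten n s \<in> ?H ` carrier A.B}"
          using bm ten by auto
      qed (use ten in \<open>auto simp: A'.ten_add_left add\<close>)
      then show ?case by simp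
    qed (rule add)
  qed (auto simp: H_closed)
  ultimately show "bij_betw ?H (carrier A.B) (carrier A'.B)" by (simp add: bij_betw_def)
qed

section \<open>Stalks\<close>

text \<open>
  Common to rings and modules of sections, so that germs of both are treated together.
\<close>

locale set_presheaf =
  fixes T :: "'x topology" and F :: "'x set \<Rightarrow> ('s, 'z) partial_object_scheme"
    and \<rho> :: "'x set \<Rightarrow> 'x set \<Rightarrow> 's \<Rightarrow> 's"
  assumes rho_closed: "\<lbrakk>openin T U; openin T V; V \<subseteq> U; s \<in> carrier (F U)\<rbrakk> \<Longrightarrow> \<rho> U V s \<in> carrier (F V)"
    and rho_id: "\<lbrakk>openin T U; s \<in> carrier (F U)\<rbrakk> \<Longrightarrow> \<rho> U U s = s"
    and rho_trans: "\<lbrakk>openin T U; openin T V; openin T W; V \<subseteq> U; W \<subseteq> V; s \<in> carrier (F U)\<rbrakk>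
        \<Longrightarrow> \<rho> V W (\<rho> U V s) = \<rho> U W s"
begin

lemma germ_self: "\<lbrakk>openin T U; x \<in> U; s \<in> carrier (F U)\<rbrakk> \<Longrightarrow> (U, s) \<in> germ T F \<rho> x U s"
  unfolding germ_def by blast

lemma germ_memI:
  "\<lbrakk>openin T V; x \<in> V; t \<in> carrier (F V); openin T W; x \<in> W; W \<subseteq> U; W \<subseteq> V; \<rho> U W s = \<rho> V W t\<rbrakk>
    \<Longrightarrow> (V, t) \<in> germ T F \<rho> x U s"
  unfolding germ_def by blast

lemma germ_le:
  assumes U: "openin T U" "s \<in> carrier (F U)" and V: "openin T V" "t \<in> carrier (F V)"
    and W: "openin T W" "x \<in> W" "W \<subseteq> U" "W \<subseteq> V" and eq: "\<rho> U W s = \<rho> V W t"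
  shows "germ T F \<rho> x U s \<subseteq> germ T F \<rho> x V t"
proof clarify
  fix V' t' assume "(V', t') \<in> germ T F \<rho> x U s"
  then obtain N where V': "openin T V'" "x \<in> V'" "t' \<in> carrier (F V')"
    and N: "openin T N" "x \<in> N" "N \<subseteq> U" "N \<subseteq> V'" and eq': "\<rho> U N s = \<rho> V' N t'"
    unfolding germ_def by blast
  have o: "openin T (W \<inter> N)" using W N by blast
  have "\<rho> V (W \<inter> N) t = \<rho> W (W \<inter> N) (\<rho> V W t)"
    by (rule rho_trans[symmetric]) (use V W o in auto)
  also have "\<dots> = \<rho> W (W \<inter> N) (\<rho> U W s)" by (simp add: eq)
  also have "\<dots> = \<rho> U (W \<inter> N) s" by (rule rho_trans) (use U W o in auto)
  also have "\<dots> = \<rho> N (W \<inter> N) (\<rho> U N s)"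
    by (rule rho_trans[symmetric]) (use U N o in auto)
  also have "\<dots> = \<rho> N (W \<inter> N) (\<rho> V' N t')" by (simp add: eq')
  also have "\<dots> = \<rho> V' (W \<inter> N) t'" by (rule rho_trans) (use V' N o in auto)
  finally show "(V', t') \<in> germ T F \<rho> x V t"
    by (intro germ_memI[where W = "W \<inter> N"]) (use V' o W N in auto)
qed

lemma germ_eqI:
  assumes "openin T U" "s \<in> carrier (F U)" "openin T V" "t \<in> carrier (F V)"
    and "openin T W" "x \<in> W" "W \<subseteq> U" "W \<subseteq> V" "\<rho> U W s = \<rho> V W t"
  shows "germ T F \<rho> x U s = germ T F \<rho> x V t"
  using assms germ_le[of U s V t W x] germ_le[of V t U s W x] by auto

lemma germ_eqD:
  assumes "germ T F \<rho> x U s = germ T F \<rho> x V t" "openin T V" "x \<in> V" "t \<in> carrier (F V)"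
  obtains W where "openin T W" "x \<in> W" "W \<subseteq> U" "W \<subseteq> V" "\<rho> U W s = \<rho> V W t"
proof -
  have "(V, t) \<in> germ T F \<rho> x U s" using assms germ_self[of V x t] by simp
  then show ?thesis using that unfolding germ_def by blast
qed

lemma germ_mem:
  assumes "(V, t) \<in> germ T F \<rho> x U s" "openin T U" "s \<in> carrier (F U)"
  shows "openin T V" "x \<in> V" "t \<in> carrier (F V)" "germ T F \<rho> x V t = germ T F \<rho> x U s"
proof -
  obtain N where *: "openin T V" "x \<in> V" "t \<in> carrier (F V)"
    "openin T N" "x \<in> N" "N \<subseteq> U" "N \<subseteq> V" "\<rho> U N s = \<rho> V N t"
    using assms(1) unfolding germ_def by blast
  then show "openin T V" "x \<in> V" "t \<in> carrier (F V)" by auto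
  show "germ T F \<rho> x V t = germ T F \<rho> x U s"
    by (rule germ_eqI[of V t U s N]) (use * assms in auto)
qed

lemma germ_restrict:
  assumes "openin T U" "openin T W" "x \<in> W" "W \<subseteq> U" "s \<in> carrier (F U)"
  shows "germ T F \<rho> x W (\<rho> U W s) = germ T F \<rho> x U s"
  by (rule germ_eqI[of W _ U s W]) (use assms in \<open>auto simp: rho_closed rho_id\<close>)

lemma germ_in_germs: "\<lbrakk>openin T U; x \<in> U; s \<in> carrier (F U)\<rbrakk> \<Longrightarrow> germ T F \<rho> x U s \<in> germs T F \<rho> x"
  unfolding germs_def by blast

lemma germsE:
  assumes "C \<in> germs T F \<rho> x"
  obtains U s where "openin T U" "x \<in> U" "s \<in> carrier (F U)" "C = germ T F \<rho> x U s"
  using assms unfolding germs_def by blast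

lemma germs_common:
  assumes "C \<in> germs T F \<rho> x" "openin T V" "x \<in> V"
  obtains U s where "openin T U" "x \<in> U" "U \<subseteq> V" "s \<in> carrier (F U)" "C = germ T F \<rho> x U s"
proof -
  obtain U s where U: "openin T U" "x \<in> U" "s \<in> carrier (F U)" "C = germ T F \<rho> x U s"
    by (rule germsE[OF assms(1)])
  show ?thesis
    by (rule that[of "U \<inter> V" "\<rho> U (U \<inter> V) s"])
      (use assms U germ_restrict[of U "U \<inter> V" x s] in \<open>auto intro!: rho_closed\<close>)
qed

lemma germs_common2:
  assumes "C \<in> germs T F \<rho> x" "D \<in> germs T F \<rho> x" "openin T V" "x \<in> V"
  obtains U s t where "openin T U" "x \<in> U" "U \<subseteq> V" "s \<in> carrier (F U)" "C = germ T F \<rho> x U s"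
    "t \<in> carrier (F U)" "D = germ T F \<rho> x U t"
proof -
  obtain U s where U: "openin T U" "x \<in> U" "U \<subseteq> V" "s \<in> carrier (F U)" "C = germ T F \<rho> x U s"
    by (rule germs_common[OF assms(1,3,4)])
  obtain W t where W: "openin T W" "x \<in> W" "W \<subseteq> U" "t \<in> carrier (F W)" "D = germ T F \<rho> x W t"
    by (rule germs_common[OF assms(2) U(1,2)])
  show ?thesis
    by (rule that[of W "\<rho> U W s" t]) (use U W in \<open>auto simp: germ_restrict intro!: rho_closed\<close>)
qed

lemma germs_common3:
  assumes "C \<in> germs T F \<rho> x" "D \<in> germs T F \<rho> x" "E \<in> germs T F \<rho> x"
  obtains U s t u where "openin T U" "x \<in> U" "s \<in> carrier (F U)" "C = germ T F \<rho> x U s"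
    "t \<in> carrier (F U)" "D = germ T F \<rho> x U t" "u \<in> carrier (F U)" "E = germ T F \<rho> x U u"
proof -
  obtain U s where U: "openin T U" "x \<in> U" "s \<in> carrier (F U)" "C = germ T F \<rho> x U s"
    by (rule germsE[OF assms(1)])
  obtain W t u where W: "openin T W" "x \<in> W" "W \<subseteq> U" "t \<in> carrier (F W)" "D = germ T F \<rho> x W t"
      "u \<in> carrier (F W)" "E = germ T F \<rho> x W u"
    by (rule germs_common2[OF assms(2,3) U(1,2)])
  show ?thesis
    by (rule that[of W "\<rho> U W s" t u]) (use U W in \<open>auto simp: germ_restrict intro!: rho_closed\<close>)
qed

lemma UN_germ:
  assumes "openin T U" "x \<in> U" "s \<in> carrier (F U)"
    and "\<And>V t. \<lbrakk>openin T V; x \<in> V; t \<in> carrier (F V); germ T F \<rho> x V t = germ T F \<rho> x U s\<rbrakk> \<Longrightarrow> g V t = c"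
  shows "(\<Union>(V, t)\<in>germ T F \<rho> x U s. g V t) = c"
proof -
  have "g V t = c" if "(V, t) \<in> germ T F \<rho> x U s" for V t
    using germ_mem[OF that assms(1,3)] assms(4) by blast
  then show ?thesis using germ_self[OF assms(1-3)] by fastforce
qed

end

text \<open>
  The operations on stalks in \<^const>\<open>stalk\<close> and \<^const>\<open>mstalk\<close> are unions over all pairs of representatives.
  They are all instances of one operation \<open>f\<close> on sections which commutes with restriction.
\<close>

lemma germ_binop:
  assumes "set_presheaf T F \<rho>" and "set_presheaf T G \<sigma>" and "set_presheaf T H \<tau>"
    and closed: "\<And>U s t. \<lbrakk>openin T U; s \<in> carrier (F U); t \<in> carrier (G U)\<rbrakk> \<Longrightarrow> f U s t \<in> carrier (H U)"
    and natural: "\<And>U V s t. \<lbrakk>openin T U; openin T V; V \<subseteq> U; s \<in> carrier (F U); t \<in> carrier (G U)\<rbrakk>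
        \<Longrightarrow> \<tau> U V (f U s t) = f V (\<rho> U V s) (\<sigma> U V t)"
    and U: "openin T U" "x \<in> U" and s: "s \<in> carrier (F U)" and t: "t \<in> carrier (G U)"
  shows "(\<Union>(V, a)\<in>germ T F \<rho> x U s. \<Union>(W, b)\<in>germ T G \<sigma> x U t.
      germ T H \<tau> x (V \<inter> W) (f (V \<inter> W) (\<rho> V (V \<inter> W) a) (\<sigma> W (V \<inter> W) b))) = germ T H \<tau> x U (f U s t)"
proof -
  interpret F: set_presheaf T F \<rho> by fact
  interpret G: set_presheaf T G \<sigma> by fact
  interpret H: set_presheaf T H \<tau> by fact
  show ?thesis
  proof (rule F.UN_germ[OF U s], rule G.UN_germ[OF U t])
    fix V a W b
    assume V: "openin T V" "x \<in> V" "a \<in> carrier (F V)" "germ T F \<rho> x V a = germ T F \<rho> x U s"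
      and W: "openin T W" "x \<in> W" "b \<in> carrier (G W)" "germ T G \<sigma> x W b = germ T G \<sigma> x U t"
    obtain N where N: "openin T N" "x \<in> N" "N \<subseteq> V" "N \<subseteq> U" "\<rho> V N a = \<rho> U N s"
      by (rule F.germ_eqD[OF V(4) U s])
    obtain N' where N': "openin T N'" "x \<in> N'" "N' \<subseteq> W" "N' \<subseteq> U" "\<sigma> W N' b = \<sigma> U N' t"
      by (rule G.germ_eqD[OF W(4) U t])
    let ?N = "N \<inter> N'"
    have o: "openin T ?N" "openin T (V \<inter> W)" using N N' V W by auto
    have s': "\<rho> V ?N a = \<rho> U ?N s"
      using F.rho_trans[of V N ?N a] F.rho_trans[of U N ?N s] N o U V s by auto
    have t': "\<sigma> W ?N b = \<sigma> U ?N t"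
      using G.rho_trans[of W N' ?N b] G.rho_trans[of U N' ?N t] N' o U W t by auto
    have cl: "\<rho> V (V \<inter> W) a \<in> carrier (F (V \<inter> W))" "\<sigma> W (V \<inter> W) b \<in> carrier (G (V \<inter> W))"
      using F.rho_closed[of V "V \<inter> W" a] G.rho_closed[of W "V \<inter> W" b] V W o by auto
    have sub: "?N \<subseteq> V \<inter> W" "?N \<subseteq> U" "?N \<subseteq> V" "?N \<subseteq> W" using N N' by auto
    have "\<tau> (V \<inter> W) ?N (f (V \<inter> W) (\<rho> V (V \<inter> W) a) (\<sigma> W (V \<inter> W) b)) =
        f ?N (\<rho> (V \<inter> W) ?N (\<rho> V (V \<inter> W) a)) (\<sigma> (V \<inter> W) ?N (\<sigma> W (V \<inter> W) b))"
      by (rule natural) (use o sub cl in auto)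
    also have "\<rho> (V \<inter> W) ?N (\<rho> V (V \<inter> W) a) = \<rho> U ?N s"
      using F.rho_trans[of V "V \<inter> W" ?N a] V o sub s' by auto
    also have "\<sigma> (V \<inter> W) ?N (\<sigma> W (V \<inter> W) b) = \<sigma> U ?N t"
      using G.rho_trans[of W "V \<inter> W" ?N b] W o sub t' by auto
    also have "f ?N (\<rho> U ?N s) (\<sigma> U ?N t) = \<tau> U ?N (f U s t)"
      by (rule natural[symmetric]) (use U o sub s t in auto)
    finally show "germ T H \<tau> x (V \<inter> W) (f (V \<inter> W) (\<rho> V (V \<inter> W) a) (\<sigma> W (V \<inter> W) b)) =
        germ T H \<tau> x U (f U s t)"
      by (intro H.germ_eqI[where W = ?N]) (use o U cl s t sub closed N N' in auto)
  qed
qed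

text \<open>
  Stalks are taken of presheaves; this is the form in which \<open>Spec k\<close> enters the argument.
\<close>

locale ring_presheaf =
  fixes \<XX> :: "('x, 'a) ringed_space"
  assumes cring_sections: "is_open \<XX> U \<Longrightarrow> cring (sections \<XX> U)"
    and restr_hom: "\<lbrakk>is_open \<XX> U; is_open \<XX> V; V \<subseteq> U\<rbrakk> \<Longrightarrow> restr \<XX> U V \<in> ring_hom (sections \<XX> U) (sections \<XX> V)"
    and restr_id: "\<lbrakk>is_open \<XX> U; s \<in> carrier (sections \<XX> U)\<rbrakk> \<Longrightarrow> restr \<XX> U U s = s"
    and restr_trans: "\<lbrakk>is_open \<XX> U; is_open \<XX> V; is_open \<XX> W; V \<subseteq> U; W \<subseteq> V;
        s \<in> carrier (sections \<XX> U)\<rbrakk> \<Longrightarrow> restr \<XX> V W (restr \<XX> U V s) = restr \<XX> U W s"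
begin

sublocale set_presheaf "top_space \<XX>" "sections \<XX>" "restr \<XX>"
  by unfold_locales (auto intro: restr_id restr_trans ring_hom_closed[OF restr_hom])

lemma stalk_carrier: "carrier (stalk \<XX> x) = germs (top_space \<XX>) (sections \<XX>) (restr \<XX>) x"
  by (simp add: stalk_def)

lemma rgerm_closed: "\<lbrakk>is_open \<XX> U; x \<in> U; s \<in> carrier (sections \<XX> U)\<rbrakk> \<Longrightarrow> rgerm \<XX> x U s \<in> carrier (stalk \<XX> x)"
  by (simp add: stalk_carrier germ_in_germs)

lemmas stalkE = germsE[folded stalk_carrier]
lemmas stalk_common = germs_common[folded stalk_carrier]
lemmas stalk_common2 = germs_common2[folded stalk_carrier]
lemmas stalk_common3 = germs_common3[folded stalk_carrier]

lemma stalk_add: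
  assumes "is_open \<XX> U" "x \<in> U" "s \<in> carrier (sections \<XX> U)" "t \<in> carrier (sections \<XX> U)"
  shows "rgerm \<XX> x U s \<oplus>\<^bsub>stalk \<XX> x\<^esub> rgerm \<XX> x U t = rgerm \<XX> x U (s \<oplus>\<^bsub>sections \<XX> U\<^esub> t)"
  using germ_binop[OF set_presheaf_axioms set_presheaf_axioms set_presheaf_axioms,
      where f = "\<lambda>U s t. s \<oplus>\<^bsub>sections \<XX> U\<^esub> t" and U = U and x = x and s = s and t = t] assms
  by (simp add: stalk_def cring.cring_simprules cring_sections ring_hom_add[OF restr_hom])

lemma stalk_mult:
  assumes "is_open \<XX> U" "x \<in> U" "s \<in> carrier (sections \<XX> U)" "t \<in> carrier (sections \<XX> U)"
  shows "rgerm \<XX> x U s \<otimes>\<^bsub>stalk \<XX> x\<^esub> rgerm \<XX> x U t = rgerm \<XX> x U (s \<otimes>\<^bsub>sections \<XX> U\<^esub> t)"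
  using germ_binop[OF set_presheaf_axioms set_presheaf_axioms set_presheaf_axioms,
      where f = "\<lambda>U s t. s \<otimes>\<^bsub>sections \<XX> U\<^esub> t" and U = U and x = x and s = s and t = t] assms
  by (simp add: stalk_def cring.cring_simprules cring_sections ring_hom_mult[OF restr_hom])

lemma stalk_one:
  assumes "is_open \<XX> U" "x \<in> U"
  shows "\<one>\<^bsub>stalk \<XX> x\<^esub> = rgerm \<XX> x U \<one>\<^bsub>sections \<XX> U\<^esub>"
proof -
  have U: "U \<subseteq> points \<XX>" using assms by (rule_tac openin_subset)
  have "restr \<XX> (points \<XX>) U \<one>\<^bsub>sections \<XX> (points \<XX>)\<^esub> = \<one>\<^bsub>sections \<XX> U\<^esub>"
    by (rule ring_hom_one[OF restr_hom]) (use assms U in auto)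
  moreover have "\<one>\<^bsub>sections \<XX> (points \<XX>)\<^esub> \<in> carrier (sections \<XX> (points \<XX>))"
    using cring_sections[of "points \<XX>"] by (simp add: cring.cring_simprules)
  ultimately show ?thesis
    using germ_restrict[of "points \<XX>" U x "\<one>\<^bsub>sections \<XX> (points \<XX>)\<^esub>"] assms U by (simp add: stalk_def)
qed

lemma stalk_zero:
  assumes "is_open \<XX> U" "x \<in> U"
  shows "\<zero>\<^bsub>stalk \<XX> x\<^esub> = rgerm \<XX> x U \<zero>\<^bsub>sections \<XX> U\<^esub>"
proof -
  have U: "U \<subseteq> points \<XX>" using assms by (rule_tac openin_subset)
  have "restr \<XX> (points \<XX>) U \<zero>\<^bsub>sections \<XX> (points \<XX>)\<^esub> = \<zero>\<^bsub>sections \<XX> U\<^esub>"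
    by (rule ring_hom_zero[OF restr_hom])
      (use assms U cring_sections in \<open>auto intro: cring.axioms\<close>)
  moreover have "\<zero>\<^bsub>sections \<XX> (points \<XX>)\<^esub> \<in> carrier (sections \<XX> (points \<XX>))"
    using cring_sections[of "points \<XX>"] by (simp add: cring.cring_simprules)
  ultimately show ?thesis
    using germ_restrict[of "points \<XX>" U x "\<zero>\<^bsub>sections \<XX> (points \<XX>)\<^esub>"] assms U by (simp add: stalk_def)
qed

lemma cring_stalk:
  assumes x: "x \<in> points \<XX>"
  shows "cring (stalk \<XX> x)"
proof -
  have p: "is_open \<XX> (points \<XX>)" by simp
  show ?thesis
  proof (intro cringI abelian_groupI comm_monoidI)
    fix c d e assume "c \<in> carrier (stalk \<XX> x)" "d \<in> carrier (stalk \<XX> x)" "e \<in> carrier (stalk \<XX> x)"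
    then obtain U s t u where U: "is_open \<XX> U" "x \<in> U"
      and s: "s \<in> carrier (sections \<XX> U)" "c = rgerm \<XX> x U s"
        "t \<in> carrier (sections \<XX> U)" "d = rgerm \<XX> x U t" "u \<in> carrier (sections \<XX> U)" "e = rgerm \<XX> x U u"
      by (rule stalk_common3)
    interpret cring "sections \<XX> U" using U by (rule_tac cring_sections)
    show "c \<oplus>\<^bsub>stalk \<XX> x\<^esub> d \<oplus>\<^bsub>stalk \<XX> x\<^esub> e = c \<oplus>\<^bsub>stalk \<XX> x\<^esub> (d \<oplus>\<^bsub>stalk \<XX> x\<^esub> e)"
      "c \<otimes>\<^bsub>stalk \<XX> x\<^esub> d \<otimes>\<^bsub>stalk \<XX> x\<^esub> e = c \<otimes>\<^bsub>stalk \<XX> x\<^esub> (d \<otimes>\<^bsub>stalk \<XX> x\<^esub> e)"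
      "(c \<oplus>\<^bsub>stalk \<XX> x\<^esub> d) \<otimes>\<^bsub>stalk \<XX> x\<^esub> e = c \<otimes>\<^bsub>stalk \<XX> x\<^esub> e \<oplus>\<^bsub>stalk \<XX> x\<^esub> d \<otimes>\<^bsub>stalk \<XX> x\<^esub> e"
      using U s by (simp_all add: stalk_add stalk_mult a_assoc m_assoc l_distr)
  next
    fix c d assume "c \<in> carrier (stalk \<XX> x)" "d \<in> carrier (stalk \<XX> x)"
    then obtain U s t where U: "is_open \<XX> U" "x \<in> U"
      and s: "s \<in> carrier (sections \<XX> U)" "c = rgerm \<XX> x U s"
        "t \<in> carrier (sections \<XX> U)" "d = rgerm \<XX> x U t"
      by (rule stalk_common2[OF _ _ p x])
    interpret cring "sections \<XX> U" using U by (rule_tac cring_sections)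
    show "c \<oplus>\<^bsub>stalk \<XX> x\<^esub> d \<in> carrier (stalk \<XX> x)" "c \<oplus>\<^bsub>stalk \<XX> x\<^esub> d = d \<oplus>\<^bsub>stalk \<XX> x\<^esub> c"
      "c \<otimes>\<^bsub>stalk \<XX> x\<^esub> d \<in> carrier (stalk \<XX> x)" "c \<otimes>\<^bsub>stalk \<XX> x\<^esub> d = d \<otimes>\<^bsub>stalk \<XX> x\<^esub> c"
      using U s by (simp_all add: stalk_add stalk_mult a_comm m_comm rgerm_closed)
  next
    show "\<zero>\<^bsub>stalk \<XX> x\<^esub> \<in> carrier (stalk \<XX> x)" "\<one>\<^bsub>stalk \<XX> x\<^esub> \<in> carrier (stalk \<XX> x)"
      using p x cring_sections[OF p] cring.cring_simprules
      by (auto simp: stalk_zero[OF p x] stalk_one[OF p x] intro!: rgerm_closed)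
  next
    fix c assume "c \<in> carrier (stalk \<XX> x)"
    then obtain U s where U: "is_open \<XX> U" "x \<in> U"
      and s: "s \<in> carrier (sections \<XX> U)" "c = rgerm \<XX> x U s"
      by (rule stalkE)
    interpret cring "sections \<XX> U" using U by (rule_tac cring_sections)
    show "\<zero>\<^bsub>stalk \<XX> x\<^esub> \<oplus>\<^bsub>stalk \<XX> x\<^esub> c = c" "\<one>\<^bsub>stalk \<XX> x\<^esub> \<otimes>\<^bsub>stalk \<XX> x\<^esub> c = c"
      using U s by (simp_all add: stalk_zero[OF U] stalk_one[OF U] stalk_add stalk_mult)
    show "\<exists>y\<in>carrier (stalk \<XX> x). y \<oplus>\<^bsub>stalk \<XX> x\<^esub> c = \<zero>\<^bsub>stalk \<XX> x\<^esub>"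
      by (rule bexI[of _ "rgerm \<XX> x U (\<ominus>\<^bsub>sections \<XX> U\<^esub> s)"])
        (use U s in \<open>simp_all add: stalk_zero[OF U] stalk_add rgerm_closed l_neg\<close>)
  qed
qed

end

lemma (in ringed_space) ring_presheaf: "ring_presheaf \<XX>"
  by (intro ring_presheaf.intro cring_sections restr_hom restr_id restr_trans)

locale module_presheaf = ring_presheaf \<XX>
  for \<XX> :: "('x, 'a) ringed_space" +
  fixes M :: "('x, 'a, 'm) module_sheaf"
  assumes module_sections: "is_open \<XX> U \<Longrightarrow> module (sections \<XX> U) (msections M U)"
    and mrestr_closed: "\<lbrakk>is_open \<XX> U; is_open \<XX> V; V \<subseteq> U; s \<in> carrier (msections M U)\<rbrakk>
        \<Longrightarrow> mrestr M U V s \<in> carrier (msections M V)"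
    and mrestr_add: "\<lbrakk>is_open \<XX> U; is_open \<XX> V; V \<subseteq> U;
        s \<in> carrier (msections M U); t \<in> carrier (msections M U)\<rbrakk>
        \<Longrightarrow> mrestr M U V (s \<oplus>\<^bsub>msections M U\<^esub> t) = mrestr M U V s \<oplus>\<^bsub>msections M V\<^esub> mrestr M U V t"
    and mrestr_smult: "\<lbrakk>is_open \<XX> U; is_open \<XX> V; V \<subseteq> U;
        a \<in> carrier (sections \<XX> U); s \<in> carrier (msections M U)\<rbrakk>
        \<Longrightarrow> mrestr M U V (a \<odot>\<^bsub>msections M U\<^esub> s) = restr \<XX> U V a \<odot>\<^bsub>msections M V\<^esub> mrestr M U V s"
    and mrestr_id: "\<lbrakk>is_open \<XX> U; s \<in> carrier (msections M U)\<rbrakk> \<Longrightarrow> mrestr M U U s = s"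
    and mrestr_trans: "\<lbrakk>is_open \<XX> U; is_open \<XX> V; is_open \<XX> W; V \<subseteq> U; W \<subseteq> V;
        s \<in> carrier (msections M U)\<rbrakk> \<Longrightarrow> mrestr M V W (mrestr M U V s) = mrestr M U W s"
begin

sublocale m: set_presheaf "top_space \<XX>" "msections M" "mrestr M"
  by unfold_locales (auto intro: mrestr_closed mrestr_id mrestr_trans)

lemma msections_closed:
  assumes "is_open \<XX> U"
  shows "\<lbrakk>s \<in> carrier (msections M U); t \<in> carrier (msections M U)\<rbrakk> \<Longrightarrow> s \<oplus>\<^bsub>msections M U\<^esub> t \<in> carrier (msections M U)"
    and "\<lbrakk>a \<in> carrier (sections \<XX> U); s \<in> carrier (msections M U)\<rbrakk> \<Longrightarrow> a \<odot>\<^bsub>msections M U\<^esub> s \<in> carrier (msections M U)"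
    and "\<zero>\<^bsub>msections M U\<^esub> \<in> carrier (msections M U)"
proof -
  interpret module "sections \<XX> U" "msections M U" by (rule module_sections[OF assms])
  show "\<lbrakk>s \<in> carrier (msections M U); t \<in> carrier (msections M U)\<rbrakk> \<Longrightarrow> s \<oplus>\<^bsub>msections M U\<^esub> t \<in> carrier (msections M U)"
    and "\<lbrakk>a \<in> carrier (sections \<XX> U); s \<in> carrier (msections M U)\<rbrakk> \<Longrightarrow> a \<odot>\<^bsub>msections M U\<^esub> s \<in> carrier (msections M U)"
    and "\<zero>\<^bsub>msections M U\<^esub> \<in> carrier (msections M U)"
    by simp_all
qed

lemma mrestr_zero:
  assumes "is_open \<XX> U" "is_open \<XX> V" "V \<subseteq> U"
  shows "mrestr M U V \<zero>\<^bsub>msections M U\<^esub> = \<zero>\<^bsub>msections M V\<^esub>"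
proof -
  interpret U: module "sections \<XX> U" "msections M U" by (rule module_sections[OF assms(1)])
  interpret V: module "sections \<XX> V" "msections M V" by (rule module_sections[OF assms(2)])
  have "mrestr M U V \<zero>\<^bsub>msections M U\<^esub> \<oplus>\<^bsub>msections M V\<^esub> mrestr M U V \<zero>\<^bsub>msections M U\<^esub> =
      mrestr M U V \<zero>\<^bsub>msections M U\<^esub>"
    using mrestr_add[OF assms, of "\<zero>\<^bsub>msections M U\<^esub>" "\<zero>\<^bsub>msections M U\<^esub>"] by simp
  then show ?thesis
    using mrestr_closed[OF assms, of "\<zero>\<^bsub>msections M U\<^esub>"] by simp
qed

lemma mstalk_carrier: "carrier (mstalk \<XX> M x) = germs (top_space \<XX>) (msections M) (mrestr M) x"
  by (simp add: mstalk_def)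

lemma mgerm_closed: "\<lbrakk>is_open \<XX> U; x \<in> U; s \<in> carrier (msections M U)\<rbrakk> \<Longrightarrow> mgerm \<XX> M x U s \<in> carrier (mstalk \<XX> M x)"
  by (simp add: mstalk_carrier m.germ_in_germs)

lemmas mstalkE = m.germsE[folded mstalk_carrier]
lemmas mstalk_common = m.germs_common[folded mstalk_carrier]
lemmas mstalk_common2 = m.germs_common2[folded mstalk_carrier]
lemmas mstalk_common3 = m.germs_common3[folded mstalk_carrier]

lemma mstalk_add:
  assumes "is_open \<XX> U" "x \<in> U" "s \<in> carrier (msections M U)" "t \<in> carrier (msections M U)"
  shows "mgerm \<XX> M x U s \<oplus>\<^bsub>mstalk \<XX> M x\<^esub> mgerm \<XX> M x U t = mgerm \<XX> M x U (s \<oplus>\<^bsub>msections M U\<^esub> t)"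
  using germ_binop[OF m.set_presheaf_axioms m.set_presheaf_axioms m.set_presheaf_axioms,
      where f = "\<lambda>U s t. s \<oplus>\<^bsub>msections M U\<^esub> t" and U = U and x = x and s = s and t = t] assms
  by (simp add: mstalk_def mrestr_add msections_closed)

lemma mstalk_smult:
  assumes "is_open \<XX> U" "x \<in> U" "a \<in> carrier (sections \<XX> U)" "t \<in> carrier (msections M U)"
  shows "rgerm \<XX> x U a \<odot>\<^bsub>mstalk \<XX> M x\<^esub> mgerm \<XX> M x U t = mgerm \<XX> M x U (a \<odot>\<^bsub>msections M U\<^esub> t)"
  using germ_binop[OF set_presheaf_axioms m.set_presheaf_axioms m.set_presheaf_axioms,
      where f = "\<lambda>U s t. s \<odot>\<^bsub>msections M U\<^esub> t" and U = U and x = x and s = a and t = t] assms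
  by (simp add: mstalk_def mrestr_smult msections_closed)

lemma mstalk_zero:
  assumes "is_open \<XX> U" "x \<in> U"
  shows "\<zero>\<^bsub>mstalk \<XX> M x\<^esub> = mgerm \<XX> M x U \<zero>\<^bsub>msections M U\<^esub>"
proof -
  have U: "U \<subseteq> points \<XX>" using assms by (rule_tac openin_subset)
  show ?thesis
    using m.germ_restrict[of "points \<XX>" U x "\<zero>\<^bsub>msections M (points \<XX>)\<^esub>"] mrestr_zero[of "points \<XX>" U]
      msections_closed(3)[of "points \<XX>"] assms U
    by (simp add: mstalk_def)
qed

lemma module_mstalk:
  assumes x: "x \<in> points \<XX>"
  shows "module (stalk \<XX> x) (mstalk \<XX> M x)"
proof -
  have p: "is_open \<XX> (points \<XX>)" by simp
  note closed = msections_closed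
  show ?thesis
  proof (intro moduleI abelian_groupI)
    show "cring (stalk \<XX> x)" by (rule cring_stalk[OF x])
  next
    fix c d e assume "c \<in> carrier (mstalk \<XX> M x)" "d \<in> carrier (mstalk \<XX> M x)" "e \<in> carrier (mstalk \<XX> M x)"
    then obtain U s t u where U: "is_open \<XX> U" "x \<in> U"
      and s: "s \<in> carrier (msections M U)" "c = mgerm \<XX> M x U s"
        "t \<in> carrier (msections M U)" "d = mgerm \<XX> M x U t" "u \<in> carrier (msections M U)" "e = mgerm \<XX> M x U u"
      by (rule mstalk_common3)
    interpret module "sections \<XX> U" "msections M U" using U by (rule_tac module_sections)
    show "c \<oplus>\<^bsub>mstalk \<XX> M x\<^esub> d \<oplus>\<^bsub>mstalk \<XX> M x\<^esub> e = c \<oplus>\<^bsub>mstalk \<XX> M x\<^esub> (d \<oplus>\<^bsub>mstalk \<XX> M x\<^esub> e)"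
      using U s by (simp add: mstalk_add M.a_assoc)
  next
    fix c d assume "c \<in> carrier (mstalk \<XX> M x)" "d \<in> carrier (mstalk \<XX> M x)"
    then obtain U s t where U: "is_open \<XX> U" "x \<in> U"
      and s: "s \<in> carrier (msections M U)" "c = mgerm \<XX> M x U s"
        "t \<in> carrier (msections M U)" "d = mgerm \<XX> M x U t"
      by (rule mstalk_common2[OF _ _ p x])
    interpret module "sections \<XX> U" "msections M U" using U by (rule_tac module_sections)
    show "c \<oplus>\<^bsub>mstalk \<XX> M x\<^esub> d \<in> carrier (mstalk \<XX> M x)"
      "c \<oplus>\<^bsub>mstalk \<XX> M x\<^esub> d = d \<oplus>\<^bsub>mstalk \<XX> M x\<^esub> c"
      using U s by (simp_all add: mstalk_add M.a_comm mgerm_closed)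
  next
    show "\<zero>\<^bsub>mstalk \<XX> M x\<^esub> \<in> carrier (mstalk \<XX> M x)"
      using p x closed(3)[OF p] by (simp add: mstalk_zero[OF p x] mgerm_closed)
  next
    fix c assume c: "c \<in> carrier (mstalk \<XX> M x)"
    then obtain U s where U: "is_open \<XX> U" "x \<in> U"
      and s: "s \<in> carrier (msections M U)" "c = mgerm \<XX> M x U s"
      by (rule mstalkE)
    interpret module "sections \<XX> U" "msections M U" using U by (rule_tac module_sections)
    show "\<zero>\<^bsub>mstalk \<XX> M x\<^esub> \<oplus>\<^bsub>mstalk \<XX> M x\<^esub> c = c" "\<one>\<^bsub>stalk \<XX> x\<^esub> \<odot>\<^bsub>mstalk \<XX> M x\<^esub> c = c"
      using U s by (simp_all add: mstalk_zero[OF U] stalk_one[OF U] mstalk_add mstalk_smult)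
    show "\<exists>y\<in>carrier (mstalk \<XX> M x). y \<oplus>\<^bsub>mstalk \<XX> M x\<^esub> c = \<zero>\<^bsub>mstalk \<XX> M x\<^esub>"
      by (rule bexI[of _ "mgerm \<XX> M x U (\<ominus>\<^bsub>msections M U\<^esub> s)"])
        (use U s in \<open>simp_all add: mstalk_zero[OF U] mstalk_add mgerm_closed M.l_neg\<close>)
  next
    fix a b c assume a: "a \<in> carrier (stalk \<XX> x)" "b \<in> carrier (stalk \<XX> x)" and c: "c \<in> carrier (mstalk \<XX> M x)"
    obtain U s where U: "is_open \<XX> U" "x \<in> U" and s: "s \<in> carrier (msections M U)" "c = mgerm \<XX> M x U s"
      using c by (rule mstalkE)
    obtain W t u where W: "is_open \<XX> W" "x \<in> W" "W \<subseteq> U" and t: "t \<in> carrier (sections \<XX> W)" "a = rgerm \<XX> x W t"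
      "u \<in> carrier (sections \<XX> W)" "b = rgerm \<XX> x W u"
      by (rule stalk_common2[OF a U])
    define s' where "s' = mrestr M U W s"
    have s': "s' \<in> carrier (msections M W)" "c = mgerm \<XX> M x W s'"
      using s U W by (simp_all add: s'_def m.germ_restrict mrestr_closed)
    interpret module "sections \<XX> W" "msections M W" using W by (rule_tac module_sections)
    show "(a \<oplus>\<^bsub>stalk \<XX> x\<^esub> b) \<odot>\<^bsub>mstalk \<XX> M x\<^esub> c = a \<odot>\<^bsub>mstalk \<XX> M x\<^esub> c \<oplus>\<^bsub>mstalk \<XX> M x\<^esub> b \<odot>\<^bsub>mstalk \<XX> M x\<^esub> c"
      "(a \<otimes>\<^bsub>stalk \<XX> x\<^esub> b) \<odot>\<^bsub>mstalk \<XX> M x\<^esub> c = a \<odot>\<^bsub>mstalk \<XX> M x\<^esub> (b \<odot>\<^bsub>mstalk \<XX> M x\<^esub> c)"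
      using W t s' by (simp_all add: mstalk_add mstalk_smult stalk_add stalk_mult smult_l_distr smult_assoc1)
  next
    fix a c d assume a: "a \<in> carrier (stalk \<XX> x)" and c: "c \<in> carrier (mstalk \<XX> M x)" "d \<in> carrier (mstalk \<XX> M x)"
    obtain U s where U: "is_open \<XX> U" "x \<in> U" and s: "s \<in> carrier (sections \<XX> U)" "a = rgerm \<XX> x U s"
      using a by (rule stalkE)
    obtain W t u where W: "is_open \<XX> W" "x \<in> W" "W \<subseteq> U" and t: "t \<in> carrier (msections M W)" "c = mgerm \<XX> M x W t"
      "u \<in> carrier (msections M W)" "d = mgerm \<XX> M x W u"
      by (rule mstalk_common2[OF c U])
    define s' where "s' = restr \<XX> U W s"
    have s': "s' \<in> carrier (sections \<XX> W)" "a = rgerm \<XX> x W s'"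
      using s U W by (simp_all add: s'_def germ_restrict rho_closed)
    interpret module "sections \<XX> W" "msections M W" using W by (rule_tac module_sections)
    show "a \<odot>\<^bsub>mstalk \<XX> M x\<^esub> (c \<oplus>\<^bsub>mstalk \<XX> M x\<^esub> d) = a \<odot>\<^bsub>mstalk \<XX> M x\<^esub> c \<oplus>\<^bsub>mstalk \<XX> M x\<^esub> a \<odot>\<^bsub>mstalk \<XX> M x\<^esub> d"
      using W t s' by (simp add: mstalk_add mstalk_smult smult_r_distr)
  next
    fix a c assume a: "a \<in> carrier (stalk \<XX> x)" and c: "c \<in> carrier (mstalk \<XX> M x)"
    obtain U s where U: "is_open \<XX> U" "x \<in> U" and s: "s \<in> carrier (sections \<XX> U)" "a = rgerm \<XX> x U s"
      using a by (rule stalkE)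
    obtain W t where W: "is_open \<XX> W" "x \<in> W" "W \<subseteq> U" and t: "t \<in> carrier (msections M W)" "c = mgerm \<XX> M x W t"
      by (rule mstalk_common[OF c U])
    define s' where "s' = restr \<XX> U W s"
    have s': "s' \<in> carrier (sections \<XX> W)" "a = rgerm \<XX> x W s'"
      using s U W by (simp_all add: s'_def germ_restrict rho_closed)
    show "a \<odot>\<^bsub>mstalk \<XX> M x\<^esub> c \<in> carrier (mstalk \<XX> M x)"
      using W t s' by (simp add: mstalk_smult mgerm_closed msections_closed)
  qed
qed

end

lemma (in module_sheaf) module_presheaf: "module_presheaf \<XX> M"
  by (intro module_presheaf.intro ring_presheaf module_presheaf_axioms.intro)
    (use mrestr_closed in \<open>auto intro: module_sections mrestr_add mrestr_smult mrestr_id mrestr_trans\<close>)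

text \<open>
  Independence of the representative holds because \<open>\<phi>\<close> commutes with restriction.
\<close>

lemma mstalk_map_germ:
  assumes "module_presheaf \<XX> M" and "module_presheaf \<XX> N" and hom: "sheaf_hom \<XX> M N \<phi>"
    and U: "is_open \<XX> U" "x \<in> U" "s \<in> carrier (msections M U)"
  shows "mstalk_map \<XX> N \<phi> x (mgerm \<XX> M x U s) = mgerm \<XX> N x U (\<phi> U s)"
proof -
  interpret M: module_presheaf \<XX> M by fact
  interpret N: module_presheaf \<XX> N by fact
  have nat: "mrestr N U V (\<phi> U s) = \<phi> V (mrestr M U V s)"
    if "is_open \<XX> U" "is_open \<XX> V" "V \<subseteq> U" "s \<in> carrier (msections M U)" for U V s
    using hom that by (auto simp: sheaf_hom_def)
  have closed: "\<phi> U s \<in> carrier (msections N U)" if "is_open \<XX> U" "s \<in> carrier (msections M U)" for U s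
    using hom that unfolding sheaf_hom_def module_hom_def by blast
  show ?thesis
    unfolding mstalk_map_def
  proof (rule M.m.UN_germ[OF U])
    fix V t assume V: "is_open \<XX> V" "x \<in> V" "t \<in> carrier (msections M V)" "mgerm \<XX> M x V t = mgerm \<XX> M x U s"
    obtain W where W: "is_open \<XX> W" "x \<in> W" "W \<subseteq> V" "W \<subseteq> U" "mrestr M V W t = mrestr M U W s"
      by (rule M.m.germ_eqD[OF V(4) U])
    show "mgerm \<XX> N x V (\<phi> V t) = mgerm \<XX> N x U (\<phi> U s)"
      by (rule N.m.germ_eqI[of V _ U _ W]) (use V W U in \<open>simp_all add: nat closed\<close>)
  qed
qed

lemma mstalk_map_iso:
  assumes "module_presheaf \<XX> M" and "module_presheaf \<XX> N" and iso: "sheaf_iso \<XX> M N \<phi>" and x: "x \<in> points \<XX>"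
  shows "module_hom (stalk \<XX> x) (mstalk \<XX> M x) (mstalk \<XX> N x) (mstalk_map \<XX> N \<phi> x)"
    and "bij_betw (mstalk_map \<XX> N \<phi> x) (carrier (mstalk \<XX> M x)) (carrier (mstalk \<XX> N x))"
proof -
  interpret M: module_presheaf \<XX> M by fact
  interpret N: module_presheaf \<XX> N by fact
  have hom: "module_hom (sections \<XX> U) (msections M U) (msections N U) (\<phi> U)"
    and bij: "bij_betw (\<phi> U) (carrier (msections M U)) (carrier (msections N U))" if "is_open \<XX> U" for U
    using iso that by (auto simp: sheaf_iso_def sheaf_hom_def)
  have nat: "mrestr N U V (\<phi> U s) = \<phi> V (mrestr M U V s)"
    if "is_open \<XX> U" "is_open \<XX> V" "V \<subseteq> U" "s \<in> carrier (msections M U)" for U V s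
    using iso that by (auto simp: sheaf_iso_def sheaf_hom_def)
  have closed: "\<phi> U s \<in> carrier (msections N U)" if "is_open \<XX> U" "s \<in> carrier (msections M U)" for U s
    using hom[OF that(1)] that(2) by (auto simp: module_hom_def)
  let ?f = "mstalk_map \<XX> N \<phi> x"
  have germ: "?f (mgerm \<XX> M x U s) = mgerm \<XX> N x U (\<phi> U s)"
    if "is_open \<XX> U" "x \<in> U" "s \<in> carrier (msections M U)" for U s
    using mstalk_map_germ[OF assms(1,2) _ that] iso by (simp add: sheaf_iso_def)
  have p: "is_open \<XX> (points \<XX>)" by simp
  show "module_hom (stalk \<XX> x) (mstalk \<XX> M x) (mstalk \<XX> N x) ?f"
    unfolding module_hom_def
  proof (intro conjI ballI funcsetI)
    fix c assume "c \<in> carrier (mstalk \<XX> M x)"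
    then obtain U s where "is_open \<XX> U" "x \<in> U" "s \<in> carrier (msections M U)" "c = mgerm \<XX> M x U s"
      by (rule M.mstalkE)
    then show "?f c \<in> carrier (mstalk \<XX> N x)" by (simp add: germ N.mgerm_closed closed)
  next
    fix c d assume "c \<in> carrier (mstalk \<XX> M x)" "d \<in> carrier (mstalk \<XX> M x)"
    then obtain U s t where U: "is_open \<XX> U" "x \<in> U" and s: "s \<in> carrier (msections M U)" "c = mgerm \<XX> M x U s"
        "t \<in> carrier (msections M U)" "d = mgerm \<XX> M x U t"
      by (rule M.mstalk_common2[OF _ _ p x])
    then show "?f (c \<oplus>\<^bsub>mstalk \<XX> M x\<^esub> d) = ?f c \<oplus>\<^bsub>mstalk \<XX> N x\<^esub> ?f d"
      using hom[OF U(1)] by (simp add: germ M.mstalk_add N.mstalk_add closed M.msections_closed module_hom_def)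
  next
    fix a c assume a: "a \<in> carrier (stalk \<XX> x)" and c: "c \<in> carrier (mstalk \<XX> M x)"
    obtain U s where U: "is_open \<XX> U" "x \<in> U" and s: "s \<in> carrier (sections \<XX> U)" "a = rgerm \<XX> x U s"
      using a by (rule M.stalkE)
    obtain W t where W: "is_open \<XX> W" "x \<in> W" "W \<subseteq> U" and t: "t \<in> carrier (msections M W)" "c = mgerm \<XX> M x W t"
      by (rule M.mstalk_common[OF c U])
    define s' where "s' = restr \<XX> U W s"
    have s': "s' \<in> carrier (sections \<XX> W)" "a = rgerm \<XX> x W s'"
      using s U W by (simp_all add: s'_def M.germ_restrict M.rho_closed)
    show "?f (a \<odot>\<^bsub>mstalk \<XX> M x\<^esub> c) = a \<odot>\<^bsub>mstalk \<XX> N x\<^esub> ?f c"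
      using hom[OF W(1)] W t s'
      by (simp add: germ M.mstalk_smult N.mstalk_smult closed M.msections_closed module_hom_def)
  qed
  show "bij_betw ?f (carrier (mstalk \<XX> M x)) (carrier (mstalk \<XX> N x))"
  proof (intro bij_betwI' ballI)
    fix c d assume "c \<in> carrier (mstalk \<XX> M x)" "d \<in> carrier (mstalk \<XX> M x)"
    then obtain U s t where U: "is_open \<XX> U" "x \<in> U" and s: "s \<in> carrier (msections M U)" "c = mgerm \<XX> M x U s"
        "t \<in> carrier (msections M U)" "d = mgerm \<XX> M x U t"
      by (rule_tac M.mstalk_common2[OF _ _ p x])
    have "c = d" if eq: "?f c = ?f d"
    proof -
      have "mgerm \<XX> N x U (\<phi> U s) = mgerm \<XX> N x U (\<phi> U t)" using eq s U by (simp add: germ)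
      then obtain W where W: "is_open \<XX> W" "x \<in> W" "W \<subseteq> U" "mrestr N U W (\<phi> U s) = mrestr N U W (\<phi> U t)"
        by (rule N.m.germ_eqD) (use U s closed in auto)
      then have "\<phi> W (mrestr M U W s) = \<phi> W (mrestr M U W t)" using U s by (simp add: nat)
      then have "mrestr M U W s = mrestr M U W t"
        using bij[OF W(1)] M.mrestr_closed[OF U(1) W(1,3)] s by (auto simp: bij_betw_def dest: inj_onD)
      then show "c = d" using M.m.germ_eqI[of U s U t W x] U W s by simp
    qed
    then show "(?f c = ?f d) = (c = d)" by blast
  next
    fix d assume "d \<in> carrier (mstalk \<XX> N x)"
    then obtain U t where U: "is_open \<XX> U" "x \<in> U" and t: "t \<in> carrier (msections N U)" "d = mgerm \<XX> N x U t"
      by (rule N.mstalkE)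
    obtain s where s: "s \<in> carrier (msections M U)" "t = \<phi> U s"
      using bij[OF U(1)] t(1) unfolding bij_betw_def by auto
    then have "d = ?f (mgerm \<XX> M x U s)" using U t by (simp add: germ)
    then show "\<exists>c\<in>carrier (mstalk \<XX> M x). d = ?f c" using M.mgerm_closed[OF U s(1)] by blast
  next
    fix c assume "c \<in> carrier (mstalk \<XX> M x)"
    then obtain U s where "is_open \<XX> U" "x \<in> U" "s \<in> carrier (msections M U)" "c = mgerm \<XX> M x U s"
      by (rule M.mstalkE)
    then show "?f c \<in> carrier (mstalk \<XX> N x)" by (simp add: germ N.mgerm_closed closed)
  qed
qed

locale rs_map = \<XX>: ring_presheaf \<XX> + Y: ring_presheaf Y
  for \<XX> :: "('x, 'a) ringed_space" and Y :: "('y, 'b) ringed_space" +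
  fixes f :: "('x, 'a, 'y, 'b) space_map"
  assumes morphism: "rs_morphism \<XX> Y f"
begin

lemma base_points: "x \<in> points \<XX> \<Longrightarrow> base f x \<in> points Y"
  using morphism continuous_map_funspace unfolding rs_morphism_def by (metis Pi_iff)

lemma preimage_open: "is_open Y V \<Longrightarrow> is_open \<XX> (preimage \<XX> f V)"
  using morphism unfolding rs_morphism_def by (auto simp: preimage_def intro: openin_continuous_map_preimage)

lemma mem_preimage: "x \<in> preimage \<XX> f V \<longleftrightarrow> x \<in> points \<XX> \<and> base f x \<in> V"
  by (simp add: preimage_def)

lemma sharp_hom: "is_open Y V \<Longrightarrow> sharp f V \<in> ring_hom (sections Y V) (sections \<XX> (preimage \<XX> f V))"
  using morphism by (simp add: rs_morphism_def)

lemma sharp_closed: "\<lbrakk>is_open Y V; b \<in> carrier (sections Y V)\<rbrakk> \<Longrightarrow> sharp f V b \<in> carrier (sections \<XX> (preimage \<XX> f V))"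
  by (rule ring_hom_closed[OF sharp_hom])

lemma sharp_natural:
  "\<lbrakk>is_open Y V; is_open Y W; W \<subseteq> V; b \<in> carrier (sections Y V)\<rbrakk> \<Longrightarrow>
    restr \<XX> (preimage \<XX> f V) (preimage \<XX> f W) (sharp f V b) = sharp f W (restr Y V W b)"
  using morphism by (auto simp: rs_morphism_def)

lemma stalk_map_germ:
  assumes x: "x \<in> points \<XX>" and V: "is_open Y V" "base f x \<in> V" "b \<in> carrier (sections Y V)"
  shows "stalk_map \<XX> Y f x (rgerm Y (base f x) V b) = rgerm \<XX> x (preimage \<XX> f V) (sharp f V b)"
  unfolding stalk_map_def
proof (rule Y.UN_germ[OF V])
  fix U t assume U: "is_open Y U" "base f x \<in> U" "t \<in> carrier (sections Y U)"
    "rgerm Y (base f x) U t = rgerm Y (base f x) V b"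
  obtain W where W: "is_open Y W" "base f x \<in> W" "W \<subseteq> U" "W \<subseteq> V" "restr Y U W t = restr Y V W b"
    by (rule Y.germ_eqD[OF U(4) V])
  show "rgerm \<XX> x (preimage \<XX> f U) (sharp f U t) = rgerm \<XX> x (preimage \<XX> f V) (sharp f V b)"
    by (rule \<XX>.germ_eqI[of _ _ _ _ "preimage \<XX> f W"])
      (use x U V W in \<open>simp_all add: preimage_open sharp_closed sharp_natural, auto simp: preimage_def\<close>)
qed

lemma stalk_map_hom:
  assumes x: "x \<in> points \<XX>"
  shows "stalk_map \<XX> Y f x \<in> ring_hom (stalk Y (base f x)) (stalk \<XX> x)"
proof (rule ring_hom_memI)
  have p: "is_open Y (points Y)" by simp
  fix c assume "c \<in> carrier (stalk Y (base f x))"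
  then obtain V b where V: "is_open Y V" "base f x \<in> V" "b \<in> carrier (sections Y V)" "c = rgerm Y (base f x) V b"
    by (rule Y.stalkE)
  then show "stalk_map \<XX> Y f x c \<in> carrier (stalk \<XX> x)"
    using x by (simp add: stalk_map_germ \<XX>.rgerm_closed preimage_open sharp_closed mem_preimage)
next
  fix c d assume "c \<in> carrier (stalk Y (base f x))" "d \<in> carrier (stalk Y (base f x))"
  then obtain V b e where V: "is_open Y V" "base f x \<in> V"
    and b: "b \<in> carrier (sections Y V)" "c = rgerm Y (base f x) V b"
     "e \<in> carrier (sections Y V)" "d = rgerm Y (base f x) V e"
    by (rule Y.stalk_common2) (use x base_points in auto)
  interpret cring "sections Y V" by (rule Y.cring_sections[OF V(1)])
  show "stalk_map \<XX> Y f x (c \<otimes>\<^bsub>stalk Y (base f x)\<^esub> d) = stalk_map \<XX> Y f x c \<otimes>\<^bsub>stalk \<XX> x\<^esub> stalk_map \<XX> Y f x d"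
    "stalk_map \<XX> Y f x (c \<oplus>\<^bsub>stalk Y (base f x)\<^esub> d) = stalk_map \<XX> Y f x c \<oplus>\<^bsub>stalk \<XX> x\<^esub> stalk_map \<XX> Y f x d"
    using x V b by (simp_all add: stalk_map_germ Y.stalk_mult Y.stalk_add \<XX>.stalk_mult \<XX>.stalk_add preimage_open
        sharp_closed mem_preimage ring_hom_mult[OF sharp_hom] ring_hom_add[OF sharp_hom])
next
  have p: "is_open Y (points Y)" "base f x \<in> points Y" using x base_points by auto
  interpret cring "sections Y (points Y)" by (rule Y.cring_sections[OF p(1)])
  show "stalk_map \<XX> Y f x \<one>\<^bsub>stalk Y (base f x)\<^esub> = \<one>\<^bsub>stalk \<XX> x\<^esub>"
    using p x \<XX>.stalk_one[of "preimage \<XX> f (points Y)" x]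
    by (simp add: Y.stalk_one[OF p] stalk_map_germ preimage_open mem_preimage ring_hom_one[OF sharp_hom])
qed

end

lemma rs_map_comp:
  assumes "rs_map \<XX> Y f" and "rs_map Y Z g"
  shows "rs_map \<XX> Z (comp_morphism Y g f)"
    and "\<And>x c. x \<in> points \<XX> \<Longrightarrow> c \<in> carrier (stalk Z (base g (base f x))) \<Longrightarrow>
      stalk_map \<XX> Y f x (stalk_map Y Z g (base f x) c) = stalk_map \<XX> Z (comp_morphism Y g f) x c"
proof -
  interpret f: rs_map \<XX> Y f by fact
  interpret g: rs_map Y Z g by fact
  let ?h = "comp_morphism Y g f"
  have pre: "preimage \<XX> ?h W = preimage \<XX> f (preimage Y g W)" for W
    using f.base_points by (auto simp: preimage_def comp_morphism_def)
  have cont: "continuous_map (top_space \<XX>) (top_space Z) (base ?h)"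
    using continuous_map_compose[of "top_space \<XX>" "top_space Y" "base f" "top_space Z" "base g"]
      f.morphism g.morphism by (simp add: rs_morphism_def comp_morphism_def o_def)
  have "rs_morphism \<XX> Z ?h"
    unfolding rs_morphism_def pre
  proof (intro conjI allI impI ballI cont)
    fix V assume V: "is_open Z V"
    then show "sharp ?h V \<in> ring_hom (sections Z V) (sections \<XX> (preimage \<XX> f (preimage Y g V)))"
      using ring_hom_trans[OF g.sharp_hom[OF V] f.sharp_hom[OF g.preimage_open[OF V]]]
      by (simp add: comp_morphism_def o_def)
  next
    fix V W b assume V: "is_open Z V \<and> is_open Z W \<and> W \<subseteq> V" "b \<in> carrier (sections Z V)"
    then have "preimage Y g W \<subseteq> preimage Y g V" by (auto simp: preimage_def)
    then show "restr \<XX> (preimage \<XX> f (preimage Y g V)) (preimage \<XX> f (preimage Y g W)) (sharp ?h V b) =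
        sharp ?h W (restr Z V W b)"
      using V by (simp add: comp_morphism_def f.sharp_natural g.preimage_open g.sharp_closed g.sharp_natural)
  qed
  then show h: "rs_map \<XX> Z ?h"
    by (intro rs_map.intro rs_map_axioms.intro f.\<XX>.ring_presheaf_axioms g.Y.ring_presheaf_axioms)
  fix x c assume x: "x \<in> points \<XX>" and c: "c \<in> carrier (stalk Z (base g (base f x)))"
  obtain V b where V: "is_open Z V" "base g (base f x) \<in> V" "b \<in> carrier (sections Z V)"
      "c = rgerm Z (base g (base f x)) V b"
    by (rule g.Y.stalkE[OF c])
  have "stalk_map \<XX> Z ?h x c = rgerm \<XX> x (preimage \<XX> ?h V) (sharp ?h V b)"
    using rs_map.stalk_map_germ[OF h x V(1) _ V(3)] V by (simp add: comp_morphism_def)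
  then show "stalk_map \<XX> Y f x (stalk_map Y Z g (base f x) c) = stalk_map \<XX> Z ?h x c"
    using V x f.base_points
    by (simp add: pre g.stalk_map_germ f.stalk_map_germ g.preimage_open g.sharp_closed g.mem_preimage)
      (simp add: comp_morphism_def)
qed

section \<open>Pullback of a sheaf of modules\<close>

locale module_pullback = rs_map \<XX> Y f + M: module_presheaf Y M
  for \<XX> :: "('x, 'a) ringed_space" and Y :: "('y, 'b) ringed_space"
    and f :: "('x, 'a, 'y, 'b) space_map" and M :: "('y, 'b, 'm) module_sheaf"
begin

abbreviation "P \<equiv> pullback \<XX> Y f M"
abbreviation "PS \<equiv> pullback_stalk \<XX> Y f M"
abbreviation "pten x \<equiv> pure_tensor (stalk Y (base f x)) (mstalk Y M (base f x)) (stalk \<XX> x) (stalk_map \<XX> Y f x)"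
abbreviation "unit \<equiv> pullback_unit \<XX> Y f M"

lemma extension:
  assumes "x \<in> points \<XX>"
  shows "scalar_extension (stalk Y (base f x)) (mstalk Y M (base f x)) (stalk \<XX> x) (stalk_map \<XX> Y f x)"
  by (intro scalar_extension.intro scalar_extension_axioms.intro M.module_mstalk \<XX>.cring_stalk
      stalk_map_hom base_points assms)

lemma module_PS: "x \<in> points \<XX> \<Longrightarrow> module (stalk \<XX> x) (PS x)"
  unfolding pullback_stalk_def by (rule scalar_extension.module_B[OF extension])

text \<open>
  The witnesses in the definition of \<^const>\<open>pullback_sections\<close>: near a point, a section of the pullback is a finite
  sum of tensors of a section over \<open>V\<close> and a section over \<open>W\<close>. Their values are given by \<open>value_at\<close> below.
\<close>

definition local_data :: "'x set \<Rightarrow> 'y set \<Rightarrow> ('m \<times> 'a) list \<Rightarrow> bool" where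
  "local_data W V ms \<longleftrightarrow> is_open \<XX> W \<and> is_open Y V \<and> base f ` W \<subseteq> V \<and>
     set ms \<subseteq> carrier (msections M V) \<times> carrier (sections \<XX> W)"

definition value_at :: "'x set \<Rightarrow> 'y set \<Rightarrow> ('m \<times> 'a) list \<Rightarrow> 'x \<Rightarrow> _" where
  "value_at W V ms y = pullback_class \<XX> Y f M y
     (\<Sum>(m, a)\<leftarrow>ms. frag_of (mgerm Y M (base f y) V m, rgerm \<XX> y W a))"

lemma pullback_sections_iff:
  "s \<in> carrier (msections P U) \<longleftrightarrow> s \<in> (\<Pi>\<^sub>E x\<in>U. carrier (PS x)) \<and>
     (\<forall>x\<in>U. \<exists>W V ms. local_data W V ms \<and> x \<in> W \<and> W \<subseteq> U \<and> (\<forall>y\<in>W. s y = value_at W V ms y))"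
proof -
  have "s \<in> carrier (msections P U) \<longleftrightarrow> s \<in> pullback_sections \<XX> Y f M U"
    by (simp add: pullback_def)
  also have "\<dots> \<longleftrightarrow> s \<in> (\<Pi>\<^sub>E x\<in>U. carrier (PS x)) \<and>
     (\<forall>x\<in>U. \<exists>W V ms. local_data W V ms \<and> x \<in> W \<and> W \<subseteq> U \<and> (\<forall>y\<in>W. s y = value_at W V ms y))"
    unfolding pullback_sections_def mem_Collect_eq local_data_def value_at_def
    by (rule conj_cong[OF refl], rule ball_cong[OF refl], intro ex_cong1) blast
  finally show ?thesis .
qed

lemma local_data_points: "local_data W V ms \<Longrightarrow> y \<in> W \<Longrightarrow> y \<in> points \<XX> \<and> base f y \<in> V"
  unfolding local_data_def using openin_subset[of "top_space \<XX>" W] by auto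

lemma value_at_Nil: "value_at W V [] y = \<zero>\<^bsub>PS y\<^esub>" if "y \<in> points \<XX>"
  unfolding value_at_def pullback_class_def pullback_stalk_def
  by (simp add: scalar_extension.zero_B[OF extension[OF that]])

lemma frags_closed:
  assumes "local_data W V ms" "y \<in> W"
  shows "Poly_Mapping.keys (\<Sum>(m, a)\<leftarrow>ms. frag_of (mgerm Y M (base f y) V m, rgerm \<XX> y W a))
    \<subseteq> carrier (mstalk Y M (base f y)) \<times> carrier (stalk \<XX> y)"
  using assms(1)
proof (induction ms)
  case (Cons p ms)
  obtain m a where p: "p = (m, a)" by (cases p)
  have "local_data W V ms" using Cons.prems by (simp add: local_data_def)
  note IH = Cons.IH[OF this]
  have y: "y \<in> points \<XX>" "base f y \<in> V" using local_data_points[OF Cons.prems assms(2)] by auto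
  have "mgerm Y M (base f y) V m \<in> carrier (mstalk Y M (base f y))" "rgerm \<XX> y W a \<in> carrier (stalk \<XX> y)"
    using Cons.prems y assms(2) p by (auto simp: local_data_def intro!: M.mgerm_closed \<XX>.rgerm_closed)
  then show ?case
    using IH keys_add[of "frag_of (mgerm Y M (base f y) V m, rgerm \<XX> y W a)"
      "\<Sum>(m, a)\<leftarrow>ms. frag_of (mgerm Y M (base f y) V m, rgerm \<XX> y W a)"] p by auto
qed simp

lemma value_at_Cons:
  assumes "local_data W V ((m, a) # ms)" "y \<in> W"
  shows "value_at W V ((m, a) # ms) y =
    pten y (mgerm Y M (base f y) V m) (rgerm \<XX> y W a) \<oplus>\<^bsub>PS y\<^esub> value_at W V ms y"
proof -
  have y: "y \<in> points \<XX>" "base f y \<in> V" using local_data_points[OF assms] by auto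
  have ms: "local_data W V ms" and ma: "local_data W V [(m, a)]"
    using assms(1) by (auto simp: local_data_def)
  show ?thesis
    using scalar_extension.add_B[OF extension[OF y(1)], OF CollectI CollectI,
        OF frags_closed[OF ma assms(2)] frags_closed[OF ms assms(2)]]
    by (simp add: value_at_def pullback_class_def pullback_stalk_def pure_tensor_def)
qed

lemma value_at_closed:
  assumes "local_data W V ms" "y \<in> W"
  shows "value_at W V ms y \<in> carrier (PS y)"
  using scalar_extension.cls_closed[OF extension, OF _ CollectI, OF _ frags_closed[OF assms]]
    local_data_points[OF assms]
  by (simp add: value_at_def pullback_class_def pullback_stalk_def)

lemma pten_closed:
  assumes "local_data W V [(m, a)]" "y \<in> W"
  shows "pten y (mgerm Y M (base f y) V m) (rgerm \<XX> y W a) \<in> carrier (PS y)"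
proof -
  have y: "y \<in> points \<XX>" "base f y \<in> V" using local_data_points[OF assms] by auto
  show ?thesis unfolding pullback_stalk_def
    by (rule scalar_extension.ten_closed[OF extension[OF y(1)]])
      (use assms y in \<open>auto simp: local_data_def intro!: M.mgerm_closed \<XX>.rgerm_closed\<close>)
qed

lemma value_at_append:
  assumes "local_data W V ms" "local_data W V ns" "y \<in> W"
  shows "value_at W V (ms @ ns) y = value_at W V ms y \<oplus>\<^bsub>PS y\<^esub> value_at W V ns y"
  using assms(1)
proof (induction ms)
  case Nil
  have y: "y \<in> points \<XX>" using local_data_points[OF assms(2,3)] by auto
  interpret module "stalk \<XX> y" "PS y" by (rule module_PS[OF y])
  show ?case using value_at_closed[OF assms(2,3)] by (simp add: value_at_Nil[OF y])
next
  case (Cons p ms)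
  obtain m a where p: "p = (m, a)" by (cases p)
  have y: "y \<in> points \<XX>" using local_data_points[OF assms(2,3)] by auto
  interpret module "stalk \<XX> y" "PS y" by (rule module_PS[OF y])
  have d: "local_data W V ms" "local_data W V [(m, a)]" "local_data W V ((m, a) # ms)"
    "local_data W V ((m, a) # ms @ ns)"
    using Cons.prems assms(2) p by (auto simp: local_data_def)
  show ?case
    using Cons.IH[OF d(1)] value_at_closed[OF assms(2,3)] value_at_closed[OF d(1) assms(3)]
      pten_closed[OF d(2) assms(3)]
    by (simp add: p value_at_Cons[OF d(3) assms(3)] value_at_Cons[OF d(4) assms(3)] M.a_assoc)
qed

lemma value_at_restrict:
  assumes "local_data W V ms" "is_open \<XX> W'" "is_open Y V'" "W' \<subseteq> W" "V' \<subseteq> V" "base f ` W' \<subseteq> V'"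
  defines "ns \<equiv> map (\<lambda>(m, a). (mrestr M V V' m, restr \<XX> W W' a)) ms"
  shows "local_data W' V' ns" and "y \<in> W' \<Longrightarrow> value_at W' V' ns y = value_at W V ms y"
proof -
  show "local_data W' V' ns"
    using assms by (auto simp: local_data_def intro!: M.mrestr_closed \<XX>.rho_closed)
  assume y: "y \<in> W'"
  have *: "mgerm Y M (base f y) V' (mrestr M V V' m) = mgerm Y M (base f y) V m"
    "rgerm \<XX> y W' (restr \<XX> W W' a) = rgerm \<XX> y W a" if "(m, a) \<in> set ms" for m a
  proof -
    have d: "is_open \<XX> W" "is_open Y V" "m \<in> carrier (msections M V)" "a \<in> carrier (sections \<XX> W)"
      "base f y \<in> V'"
      using assms(1,6) that y by (auto simp: local_data_def)
    show "mgerm Y M (base f y) V' (mrestr M V V' m) = mgerm Y M (base f y) V m"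
      by (rule M.m.germ_restrict[OF d(2) assms(3) d(5) assms(5) d(3)])
    show "rgerm \<XX> y W' (restr \<XX> W W' a) = rgerm \<XX> y W a"
      by (rule \<XX>.germ_restrict[OF d(1) assms(2) y assms(4) d(4)])
  qed
  have "(\<Sum>(m, a)\<leftarrow>ns. frag_of (mgerm Y M (base f y) V' m, rgerm \<XX> y W' a)) =
      (\<Sum>(m, a)\<leftarrow>ms. frag_of (mgerm Y M (base f y) V m, rgerm \<XX> y W a))"
    unfolding ns_def map_map
    by (intro arg_cong[where f = sum_list] map_cong refl) (auto simp: *)
  then show "value_at W' V' ns y = value_at W V ms y" unfolding value_at_def by simp
qed

lemma value_at_smult:
  assumes ms: "local_data W V ms" and b: "b \<in> carrier (sections \<XX> W)"
  defines "ns \<equiv> map (\<lambda>(m, a). (m, b \<otimes>\<^bsub>sections \<XX> W\<^esub> a)) ms"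
  shows "local_data W V ns" and "y \<in> W \<Longrightarrow> value_at W V ns y = rgerm \<XX> y W b \<odot>\<^bsub>PS y\<^esub> value_at W V ms y"
proof -
  have W: "is_open \<XX> W" using ms by (simp add: local_data_def)
  interpret W: cring "sections \<XX> W" by (rule \<XX>.cring_sections[OF W])
  have d: "local_data W V (map (\<lambda>(m, a). (m, b \<otimes>\<^bsub>sections \<XX> W\<^esub> a)) ms)" if "local_data W V ms" for ms
    using that b by (auto simp: local_data_def)
  then show "local_data W V ns" using ms by (simp add: ns_def)
  assume y: "y \<in> W"
  have y': "y \<in> points \<XX>" "base f y \<in> V" using local_data_points[OF ms y] by auto
  interpret module "stalk \<XX> y" "PS y" by (rule module_PS[OF y'(1)])
  have bc: "rgerm \<XX> y W b \<in> carrier (stalk \<XX> y)" by (rule \<XX>.rgerm_closed[OF W y b])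
  show "value_at W V ns y = rgerm \<XX> y W b \<odot>\<^bsub>PS y\<^esub> value_at W V ms y"
    using ms unfolding ns_def
  proof (induction ms)
    case Nil
    then show ?case using bc by (simp add: value_at_Nil[OF y'(1)])
  next
    case (Cons p ms)
    obtain m a where p: "p = (m, a)" by (cases p)
    have e: "local_data W V ms" "local_data W V [(m, a)]" "local_data W V ((m, a) # ms)"
      using Cons.prems p by (auto simp: local_data_def)
    note e' = d[OF e(3), simplified]
    have m: "m \<in> carrier (msections M V)" "a \<in> carrier (sections \<XX> W)" "is_open Y V"
      using e(2) by (auto simp: local_data_def)
    have "rgerm \<XX> y W b \<odot>\<^bsub>PS y\<^esub> pten y (mgerm Y M (base f y) V m) (rgerm \<XX> y W a) =
        pten y (mgerm Y M (base f y) V m) (rgerm \<XX> y W (b \<otimes>\<^bsub>sections \<XX> W\<^esub> a))"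
      using scalar_extension.smult_B(3)[OF extension[OF y'(1)] bc, of "mgerm Y M (base f y) V m" "rgerm \<XX> y W a"]
        m y' W y b
      by (simp add: pullback_stalk_def M.mgerm_closed \<XX>.rgerm_closed \<XX>.stalk_mult)
    then show ?case
      using Cons.IH[OF e(1)] bc pten_closed[OF e(2) y] value_at_closed[OF e(1) y]
      by (simp add: p value_at_Cons[OF e(3) y] value_at_Cons[OF e' y] smult_r_distr)
  qed
qed

lemma P_simps:
  "\<zero>\<^bsub>msections P U\<^esub> = (\<lambda>x\<in>U. \<zero>\<^bsub>PS x\<^esub>)"
  "s \<oplus>\<^bsub>msections P U\<^esub> t = (\<lambda>x\<in>U. s x \<oplus>\<^bsub>PS x\<^esub> t x)"
  "a \<odot>\<^bsub>msections P U\<^esub> s = (\<lambda>x\<in>U. rgerm \<XX> x U a \<odot>\<^bsub>PS x\<^esub> s x)"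
  "mrestr P U V s = restrict s V"
  by (simp_all add: pullback_def)

lemma P_closed_at: "s \<in> carrier (msections P U) \<Longrightarrow> x \<in> U \<Longrightarrow> s x \<in> carrier (PS x)"
  by (auto simp: pullback_sections_iff)

lemma P_local:
  assumes "s \<in> carrier (msections P U)" "x \<in> U"
  obtains W V ms where "local_data W V ms" "x \<in> W" "W \<subseteq> U" "\<And>y. y \<in> W \<Longrightarrow> s y = value_at W V ms y"
  using assms unfolding pullback_sections_iff by blast

lemma P_add_closed:
  assumes U: "is_open \<XX> U" and s: "s \<in> carrier (msections P U)" and t: "t \<in> carrier (msections P U)"
  shows "s \<oplus>\<^bsub>msections P U\<^esub> t \<in> carrier (msections P U)"
  unfolding pullback_sections_iff
proof (intro conjI ballI)
  have sub: "U \<subseteq> points \<XX>" by (rule openin_subset[OF U])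
  have "s x \<oplus>\<^bsub>PS x\<^esub> t x \<in> carrier (PS x)" if "x \<in> U" for x
  proof -
    interpret module "stalk \<XX> x" "PS x" by (rule module_PS) (use that sub in auto)
    show ?thesis using P_closed_at[OF s that] P_closed_at[OF t that] by simp
  qed
  then show "s \<oplus>\<^bsub>msections P U\<^esub> t \<in> (\<Pi>\<^sub>E x\<in>U. carrier (PS x))"
    by (auto simp: P_simps)
  fix x assume x: "x \<in> U"
  obtain W V ms where 1: "local_data W V ms" "x \<in> W" "W \<subseteq> U" "\<And>y. y \<in> W \<Longrightarrow> s y = value_at W V ms y"
    by (rule P_local[OF s x]) blast
  obtain W' V' ns where 2: "local_data W' V' ns" "x \<in> W'" "W' \<subseteq> U" "\<And>y. y \<in> W' \<Longrightarrow> t y = value_at W' V' ns y"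
    by (rule P_local[OF t x]) blast
  have o: "is_open \<XX> (W \<inter> W')" "is_open Y (V \<inter> V')" "base f ` (W \<inter> W') \<subseteq> V \<inter> V'"
    using 1(1) 2(1) by (auto simp: local_data_def)
  note r1 = value_at_restrict[OF 1(1) o(1,2) Int_lower1 Int_lower1 o(3)]
  note r2 = value_at_restrict[OF 2(1) o(1,2) Int_lower2 Int_lower2 o(3)]
  show "\<exists>W V ms. local_data W V ms \<and> x \<in> W \<and> W \<subseteq> U \<and>
      (\<forall>y\<in>W. (s \<oplus>\<^bsub>msections P U\<^esub> t) y = value_at W V ms y)"
  proof (intro exI conjI ballI)
    show "local_data (W \<inter> W') (V \<inter> V') (map (\<lambda>(m, a). (mrestr M V (V \<inter> V') m, restr \<XX> W (W \<inter> W') a)) ms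
        @ map (\<lambda>(m, a). (mrestr M V' (V \<inter> V') m, restr \<XX> W' (W \<inter> W') a)) ns)"
      using r1(1) r2(1) by (simp add: local_data_def)
    fix y assume y: "y \<in> W \<inter> W'"
    then show "(s \<oplus>\<^bsub>msections P U\<^esub> t) y = value_at (W \<inter> W') (V \<inter> V')
      (map (\<lambda>(m, a). (mrestr M V (V \<inter> V') m, restr \<XX> W (W \<inter> W') a)) ms
        @ map (\<lambda>(m, a). (mrestr M V' (V \<inter> V') m, restr \<XX> W' (W \<inter> W') a)) ns) y"
      using 1 2 by (subst value_at_append[OF r1(1) r2(1) y]) (auto simp: P_simps r1(2)[OF y] r2(2)[OF y])
  qed (use 1 2 in auto)
qed

lemma P_zero_closed:
  assumes U: "is_open \<XX> U"
  shows "\<zero>\<^bsub>msections P U\<^esub> \<in> carrier (msections P U)"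
  unfolding pullback_sections_iff
proof (intro conjI ballI)
  have sub: "U \<subseteq> points \<XX>" by (rule openin_subset[OF U])
  have "\<zero>\<^bsub>PS x\<^esub> \<in> carrier (PS x)" if "x \<in> U" for x
  proof -
    interpret module "stalk \<XX> x" "PS x" by (rule module_PS) (use that sub in auto)
    show ?thesis by simp
  qed
  then show "\<zero>\<^bsub>msections P U\<^esub> \<in> (\<Pi>\<^sub>E x\<in>U. carrier (PS x))"
    by (auto simp: P_simps)
  fix x assume x: "x \<in> U"
  show "\<exists>W V ms. local_data W V ms \<and> x \<in> W \<and> W \<subseteq> U \<and> (\<forall>y\<in>W. \<zero>\<^bsub>msections P U\<^esub> y = value_at W V ms y)"
    by (rule exI[of _ U], rule exI[of _ "points Y"], rule exI[of _ "[]"])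
      (use U x sub base_points in \<open>auto simp: local_data_def P_simps value_at_Nil\<close>)
qed

lemma P_smult_closed:
  assumes U: "is_open \<XX> U" and a: "a \<in> carrier (sections \<XX> U)" and s: "s \<in> carrier (msections P U)"
  shows "a \<odot>\<^bsub>msections P U\<^esub> s \<in> carrier (msections P U)"
  unfolding pullback_sections_iff
proof (intro conjI ballI)
  have sub: "U \<subseteq> points \<XX>" by (rule openin_subset[OF U])
  have "rgerm \<XX> x U a \<odot>\<^bsub>PS x\<^esub> s x \<in> carrier (PS x)" if "x \<in> U" for x
  proof -
    interpret module "stalk \<XX> x" "PS x" by (rule module_PS) (use that sub in auto)
    show ?thesis using P_closed_at[OF s that] \<XX>.rgerm_closed[OF U that a] by simp
  qed
  then show "a \<odot>\<^bsub>msections P U\<^esub> s \<in> (\<Pi>\<^sub>E x\<in>U. carrier (PS x))"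
    by (auto simp: P_simps)
  fix x assume x: "x \<in> U"
  obtain W V ms where 1: "local_data W V ms" "x \<in> W" "W \<subseteq> U" "\<And>y. y \<in> W \<Longrightarrow> s y = value_at W V ms y"
    by (rule P_local[OF s x]) blast
  have W: "is_open \<XX> W" using 1(1) by (simp add: local_data_def)
  have a': "restr \<XX> U W a \<in> carrier (sections \<XX> W)" by (rule \<XX>.rho_closed[OF U W 1(3) a])
  show "\<exists>W V ms. local_data W V ms \<and> x \<in> W \<and> W \<subseteq> U \<and>
      (\<forall>y\<in>W. (a \<odot>\<^bsub>msections P U\<^esub> s) y = value_at W V ms y)"
  proof (intro exI conjI ballI)
    show "local_data W V (map (\<lambda>(m, b). (m, restr \<XX> U W a \<otimes>\<^bsub>sections \<XX> W\<^esub> b)) ms)"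
      by (rule value_at_smult(1)[OF 1(1) a'])
    fix y assume y: "y \<in> W"
    show "(a \<odot>\<^bsub>msections P U\<^esub> s) y =
        value_at W V (map (\<lambda>(m, b). (m, restr \<XX> U W a \<otimes>\<^bsub>sections \<XX> W\<^esub> b)) ms) y"
      using value_at_smult(2)[OF 1(1) a' y] \<XX>.germ_restrict[OF U W y 1(3) a] y 1(3,4)
      by (auto simp: P_simps)
  qed (use 1 in auto)
qed

lemma P_restrict_closed:
  assumes U: "is_open \<XX> U" and U': "is_open \<XX> U'" "U' \<subseteq> U" and s: "s \<in> carrier (msections P U)"
  shows "restrict s U' \<in> carrier (msections P U')"
  unfolding pullback_sections_iff
proof (intro conjI ballI)
  show "restrict s U' \<in> (\<Pi>\<^sub>E x\<in>U'. carrier (PS x))" using P_closed_at[OF s] U' by auto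
  fix x assume x: "x \<in> U'"
  then have "x \<in> U" using U' by auto
  then obtain W V ms where 1: "local_data W V ms" "x \<in> W" "W \<subseteq> U" "\<And>y. y \<in> W \<Longrightarrow> s y = value_at W V ms y"
    by (rule P_local[OF s]) blast
  have V: "is_open \<XX> (W \<inter> U')" "is_open Y V" "base f ` (W \<inter> U') \<subseteq> V"
    using 1(1) U' by (auto simp: local_data_def)
  note r = value_at_restrict[OF 1(1) V(1,2) Int_lower1 order_refl V(3)]
  show "\<exists>W V ms. local_data W V ms \<and> x \<in> W \<and> W \<subseteq> U' \<and> (\<forall>y\<in>W. restrict s U' y = value_at W V ms y)"
    by (intro exI conjI ballI, rule r(1)) (use 1 x in \<open>auto simp: r(2)\<close>)
qed

text \<open>
  All axioms except closedness are checked pointwise in the stalks.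
\<close>

lemma module_P:
  assumes U: "is_open \<XX> U"
  shows "module (sections \<XX> U) (msections P U)"
proof -
  have sub: "U \<subseteq> points \<XX>" by (rule openin_subset[OF U])
  note closed = P_add_closed[OF U] P_zero_closed[OF U] P_smult_closed[OF U]
  interpret C: cring "sections \<XX> U" by (rule \<XX>.cring_sections[OF U])
  have mod: "module (stalk \<XX> x) (PS x)" if "x \<in> U" for x using module_PS sub that by auto
  have at: "s x \<in> carrier (PS x)" if "s \<in> carrier (msections P U)" "x \<in> U" for s x
    using that by (rule P_closed_at)
  have ext: "s \<in> extensional U" if "s \<in> carrier (msections P U)" for s
    using that by (auto simp: pullback_sections_iff PiE_def)
  have smult_one: "\<one>\<^bsub>sections \<XX> U\<^esub> \<odot>\<^bsub>msections P U\<^esub> s = s" if s: "s \<in> carrier (msections P U)" for s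
  proof (rule extensionalityI[of _ U])
    fix x assume x: "x \<in> U"
    interpret module "stalk \<XX> x" "PS x" by (rule mod[OF x])
    show "(\<one>\<^bsub>sections \<XX> U\<^esub> \<odot>\<^bsub>msections P U\<^esub> s) x = s x"
      using x at[OF s x] by (simp add: P_simps \<XX>.stalk_one[OF U x, symmetric])
  qed (use ext[OF s] in \<open>auto simp: P_simps\<close>)
  have l_distr: "(a \<oplus>\<^bsub>sections \<XX> U\<^esub> b) \<odot>\<^bsub>msections P U\<^esub> s =
      a \<odot>\<^bsub>msections P U\<^esub> s \<oplus>\<^bsub>msections P U\<^esub> b \<odot>\<^bsub>msections P U\<^esub> s"
    if ab: "a \<in> carrier (sections \<XX> U)" "b \<in> carrier (sections \<XX> U)" and s: "s \<in> carrier (msections P U)" for a b s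
  proof (rule extensionalityI[of _ U])
    fix x assume x: "x \<in> U"
    interpret module "stalk \<XX> x" "PS x" by (rule mod[OF x])
    show "((a \<oplus>\<^bsub>sections \<XX> U\<^esub> b) \<odot>\<^bsub>msections P U\<^esub> s) x =
      (a \<odot>\<^bsub>msections P U\<^esub> s \<oplus>\<^bsub>msections P U\<^esub> b \<odot>\<^bsub>msections P U\<^esub> s) x"
      using x at[OF s x] ab
      by (simp add: P_simps \<XX>.stalk_add[OF U x, symmetric] \<XX>.rgerm_closed[OF U x] smult_l_distr)
  qed (auto simp: P_simps)
  have neg: "\<exists>t\<in>carrier (msections P U). t \<oplus>\<^bsub>msections P U\<^esub> s = \<zero>\<^bsub>msections P U\<^esub>"
    if s: "s \<in> carrier (msections P U)" for s
  proof (rule bexI)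
    let ?t = "(\<ominus>\<^bsub>sections \<XX> U\<^esub> \<one>\<^bsub>sections \<XX> U\<^esub>) \<odot>\<^bsub>msections P U\<^esub> s"
    show "?t \<in> carrier (msections P U)" using closed(3) s by simp
    \<comment> \<open>The inverse of \<open>s\<close> is taken to be \<open>(- 1) s\<close>, since closedness under the scalar action is known.\<close>
    have "?t \<oplus>\<^bsub>msections P U\<^esub> s = ?t \<oplus>\<^bsub>msections P U\<^esub> \<one>\<^bsub>sections \<XX> U\<^esub> \<odot>\<^bsub>msections P U\<^esub> s"
      by (simp add: smult_one[OF s])
    also have "\<dots> = \<zero>\<^bsub>sections \<XX> U\<^esub> \<odot>\<^bsub>msections P U\<^esub> s"
      using l_distr[of "\<ominus>\<^bsub>sections \<XX> U\<^esub> \<one>\<^bsub>sections \<XX> U\<^esub>" "\<one>\<^bsub>sections \<XX> U\<^esub>" s] s by (simp add: C.l_neg)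
    also have "\<dots> = \<zero>\<^bsub>msections P U\<^esub>"
    proof (rule extensionalityI[of _ U])
      fix x assume x: "x \<in> U"
      interpret module "stalk \<XX> x" "PS x" by (rule mod[OF x])
      show "(\<zero>\<^bsub>sections \<XX> U\<^esub> \<odot>\<^bsub>msections P U\<^esub> s) x = \<zero>\<^bsub>msections P U\<^esub> x"
        using x at[OF s x] by (simp add: P_simps \<XX>.stalk_zero[OF U x, symmetric])
    qed (auto simp: P_simps)
    finally show "?t \<oplus>\<^bsub>msections P U\<^esub> s = \<zero>\<^bsub>msections P U\<^esub>" .
  qed
  show ?thesis
  proof (intro moduleI abelian_groupI C.is_cring)
    fix s t u assume s: "s \<in> carrier (msections P U)" "t \<in> carrier (msections P U)" "u \<in> carrier (msections P U)"
    show "s \<oplus>\<^bsub>msections P U\<^esub> t \<oplus>\<^bsub>msections P U\<^esub> u = s \<oplus>\<^bsub>msections P U\<^esub> (t \<oplus>\<^bsub>msections P U\<^esub> u)"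
    proof (rule extensionalityI[of _ U])
      fix x assume x: "x \<in> U"
      interpret module "stalk \<XX> x" "PS x" by (rule mod[OF x])
      show "(s \<oplus>\<^bsub>msections P U\<^esub> t \<oplus>\<^bsub>msections P U\<^esub> u) x = (s \<oplus>\<^bsub>msections P U\<^esub> (t \<oplus>\<^bsub>msections P U\<^esub> u)) x"
        using x at[OF s(1) x] at[OF s(2) x] at[OF s(3) x] by (simp add: P_simps M.a_assoc)
    qed (auto simp: P_simps)
  next
    fix s t assume s: "s \<in> carrier (msections P U)" "t \<in> carrier (msections P U)"
    show "s \<oplus>\<^bsub>msections P U\<^esub> t = t \<oplus>\<^bsub>msections P U\<^esub> s"
    proof (rule extensionalityI[of _ U])
      fix x assume x: "x \<in> U"
      interpret module "stalk \<XX> x" "PS x" by (rule mod[OF x])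
      show "(s \<oplus>\<^bsub>msections P U\<^esub> t) x = (t \<oplus>\<^bsub>msections P U\<^esub> s) x"
        using x at[OF s(1) x] at[OF s(2) x] by (simp add: P_simps M.a_comm)
    qed (auto simp: P_simps)
  next
    fix s assume s: "s \<in> carrier (msections P U)"
    show "\<zero>\<^bsub>msections P U\<^esub> \<oplus>\<^bsub>msections P U\<^esub> s = s"
    proof (rule extensionalityI[of _ U])
      fix x assume x: "x \<in> U"
      interpret module "stalk \<XX> x" "PS x" by (rule mod[OF x])
      show "(\<zero>\<^bsub>msections P U\<^esub> \<oplus>\<^bsub>msections P U\<^esub> s) x = s x"
        using x at[OF s x] by (simp add: P_simps)
    qed (use ext[OF s] in \<open>auto simp: P_simps\<close>)
  next
    fix a b s assume ab: "a \<in> carrier (sections \<XX> U)" "b \<in> carrier (sections \<XX> U)" and s: "s \<in> carrier (msections P U)"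
    show "(a \<otimes>\<^bsub>sections \<XX> U\<^esub> b) \<odot>\<^bsub>msections P U\<^esub> s = a \<odot>\<^bsub>msections P U\<^esub> (b \<odot>\<^bsub>msections P U\<^esub> s)"
    proof (rule extensionalityI[of _ U])
      fix x assume x: "x \<in> U"
      interpret module "stalk \<XX> x" "PS x" by (rule mod[OF x])
      show "((a \<otimes>\<^bsub>sections \<XX> U\<^esub> b) \<odot>\<^bsub>msections P U\<^esub> s) x = (a \<odot>\<^bsub>msections P U\<^esub> (b \<odot>\<^bsub>msections P U\<^esub> s)) x"
        using x at[OF s x] ab
        by (simp add: P_simps \<XX>.stalk_mult[OF U x, symmetric] \<XX>.rgerm_closed[OF U x] smult_assoc1)
    qed (auto simp: P_simps)
  next
    fix a s t assume a: "a \<in> carrier (sections \<XX> U)" and s: "s \<in> carrier (msections P U)" "t \<in> carrier (msections P U)"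
    show "a \<odot>\<^bsub>msections P U\<^esub> (s \<oplus>\<^bsub>msections P U\<^esub> t) = a \<odot>\<^bsub>msections P U\<^esub> s \<oplus>\<^bsub>msections P U\<^esub> a \<odot>\<^bsub>msections P U\<^esub> t"
    proof (rule extensionalityI[of _ U])
      fix x assume x: "x \<in> U"
      interpret module "stalk \<XX> x" "PS x" by (rule mod[OF x])
      show "(a \<odot>\<^bsub>msections P U\<^esub> (s \<oplus>\<^bsub>msections P U\<^esub> t)) x =
          (a \<odot>\<^bsub>msections P U\<^esub> s \<oplus>\<^bsub>msections P U\<^esub> a \<odot>\<^bsub>msections P U\<^esub> t) x"
        using x at[OF s(1) x] at[OF s(2) x] a by (simp add: P_simps \<XX>.rgerm_closed[OF U x] smult_r_distr)
    qed (auto simp: P_simps)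
  qed (use closed smult_one l_distr neg in auto)
qed

lemma module_presheaf_P: "module_presheaf \<XX> P"
proof (intro module_presheaf.intro module_presheaf_axioms.intro \<XX>.ring_presheaf_axioms)
  fix U V s assume "is_open \<XX> U" "is_open \<XX> V" "V \<subseteq> U" "s \<in> carrier (msections P U)"
  then show "mrestr P U V s \<in> carrier (msections P V)" by (simp add: P_simps P_restrict_closed)
next
  fix U V a s assume *: "is_open \<XX> U" "is_open \<XX> V" "V \<subseteq> U" "a \<in> carrier (sections \<XX> U)"
  show "mrestr P U V (a \<odot>\<^bsub>msections P U\<^esub> s) = restr \<XX> U V a \<odot>\<^bsub>msections P V\<^esub> mrestr P U V s"
    using * by (auto simp: P_simps \<XX>.germ_restrict restrict_def fun_eq_iff)
next
  fix U s assume "is_open \<XX> U" "s \<in> carrier (msections P U)"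
  then show "mrestr P U U s = s" by (auto simp: P_simps pullback_sections_iff PiE_def extensional_restrict)
qed (auto simp: module_P P_simps Int_absorb1 intro!: restrict_ext)

sublocale P: module_presheaf \<XX> P by (rule module_presheaf_P)

text \<open>
  The value of a germ at the point. The elements of \<open>PS x\<close> are themselves sets, so the union over all
  representatives picks out their common value.
\<close>

definition evaluation :: "'x \<Rightarrow> ('x set \<times> ('x, 'a, 'y, 'm) pullback_section) set \<Rightarrow> _" where
  "evaluation x C = (\<Union>(U, s)\<in>C. s x)"

lemma evaluation_germ:
  assumes "is_open \<XX> U" "x \<in> U" "s \<in> carrier (msections P U)"
  shows "evaluation x (mgerm \<XX> P x U s) = s x"
  unfolding evaluation_def
proof (rule P.m.UN_germ[OF assms])
  fix V t assume V: "mgerm \<XX> P x V t = mgerm \<XX> P x U s"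
  obtain W where W: "x \<in> W" "mrestr P V W t = mrestr P U W s"
    by (rule P.m.germ_eqD[OF V assms])
  show "t x = s x" using fun_cong[OF W(2), of x] W(1) by (simp add: P_simps)
qed

lemma evaluation_hom:
  assumes x: "x \<in> points \<XX>"
  shows "module_hom (stalk \<XX> x) (mstalk \<XX> P x) (PS x) (evaluation x)"
proof -
  have p: "is_open \<XX> (points \<XX>)" by simp
  show ?thesis
    unfolding module_hom_def
  proof (intro conjI ballI funcsetI)
    fix c assume "c \<in> carrier (mstalk \<XX> P x)"
    then obtain U s where "is_open \<XX> U" "x \<in> U" "s \<in> carrier (msections P U)" "c = mgerm \<XX> P x U s"
      by (rule P.mstalkE)
    then show "evaluation x c \<in> carrier (PS x)" by (simp add: evaluation_germ P_closed_at)
  next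
    fix c d assume "c \<in> carrier (mstalk \<XX> P x)" "d \<in> carrier (mstalk \<XX> P x)"
    then obtain U s t where U: "is_open \<XX> U" "x \<in> U" and s: "s \<in> carrier (msections P U)" "c = mgerm \<XX> P x U s"
        "t \<in> carrier (msections P U)" "d = mgerm \<XX> P x U t"
      by (rule P.mstalk_common2[OF _ _ p x])
    then have "evaluation x (c \<oplus>\<^bsub>mstalk \<XX> P x\<^esub> d) = (s \<oplus>\<^bsub>msections P U\<^esub> t) x"
      by (simp add: P.mstalk_add evaluation_germ P.msections_closed)
    then show "evaluation x (c \<oplus>\<^bsub>mstalk \<XX> P x\<^esub> d) = evaluation x c \<oplus>\<^bsub>PS x\<^esub> evaluation x d"
      using U s by (simp add: evaluation_germ P_simps)
  next
    fix a c assume a: "a \<in> carrier (stalk \<XX> x)" and c: "c \<in> carrier (mstalk \<XX> P x)"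
    obtain U s where U: "is_open \<XX> U" "x \<in> U" and s: "s \<in> carrier (sections \<XX> U)" "a = rgerm \<XX> x U s"
      using a by (rule \<XX>.stalkE)
    obtain W t where W: "is_open \<XX> W" "x \<in> W" "W \<subseteq> U" and t: "t \<in> carrier (msections P W)" "c = mgerm \<XX> P x W t"
      by (rule P.mstalk_common[OF c U])
    define s' where "s' = restr \<XX> U W s"
    have s': "s' \<in> carrier (sections \<XX> W)" "a = rgerm \<XX> x W s'"
      using s U W by (simp_all add: s'_def \<XX>.germ_restrict \<XX>.rho_closed)
    have "evaluation x (a \<odot>\<^bsub>mstalk \<XX> P x\<^esub> c) = (s' \<odot>\<^bsub>msections P W\<^esub> t) x"
      using W t s' by (simp add: P.mstalk_smult evaluation_germ P.msections_closed)
    then show "evaluation x (a \<odot>\<^bsub>mstalk \<XX> P x\<^esub> c) = a \<odot>\<^bsub>PS x\<^esub> evaluation x c"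
      using W t s' by (simp add: evaluation_germ P_simps)
  qed
qed

lemma unit_at:
  assumes "x \<in> preimage \<XX> f V"
  shows "unit V m x = pten x (mgerm Y M (base f x) V m) \<one>\<^bsub>stalk \<XX> x\<^esub>"
  using assms by (simp add: pullback_unit_def pullback_class_def pure_tensor_def)

lemma unit_data:
  assumes "is_open Y V" "m \<in> carrier (msections M V)"
  shows "local_data (preimage \<XX> f V) V [(m, \<one>\<^bsub>sections \<XX> (preimage \<XX> f V)\<^esub>)]"
proof -
  interpret cring "sections \<XX> (preimage \<XX> f V)" by (rule \<XX>.cring_sections[OF preimage_open[OF assms(1)]])
  show ?thesis using assms preimage_open by (auto simp: local_data_def mem_preimage)
qed

lemma unit_closed:
  assumes V: "is_open Y V" and m: "m \<in> carrier (msections M V)"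
  shows "unit V m \<in> carrier (msections P (preimage \<XX> f V))"
proof -
  note d = unit_data[OF assms]
  let ?U = "preimage \<XX> f V"
  have one: "\<one>\<^bsub>stalk \<XX> x\<^esub> = rgerm \<XX> x ?U \<one>\<^bsub>sections \<XX> ?U\<^esub>" if "x \<in> ?U" for x
    by (rule \<XX>.stalk_one[OF preimage_open[OF V] that])
  have val: "unit V m x = value_at ?U V [(m, \<one>\<^bsub>sections \<XX> ?U\<^esub>)] x" if x: "x \<in> ?U" for x
  proof -
    have x': "x \<in> points \<XX>" using x by (simp add: mem_preimage)
    interpret module "stalk \<XX> x" "PS x" by (rule module_PS[OF x'])
    show ?thesis
      using pten_closed[OF d x] by (simp add: unit_at[OF x] value_at_Cons[OF d x] value_at_Nil[OF x'] one[OF x])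
  qed
  have "unit V m \<in> (\<Pi>\<^sub>E x\<in>?U. carrier (PS x))"
    using value_at_closed[OF d] val by (auto simp: pullback_unit_def)
  then show ?thesis
    unfolding pullback_sections_iff using d val by blast
qed

text \<open>
  The map \<open>M\<^bsub>f(x)\<^esub> \<rightarrow> (f\<^sup>*M)\<^sub>x\<close> on germs that is induced by the unit, written as in \<^const>\<open>pullback_comp\<close>.
\<close>

definition germ_unit :: "'x \<Rightarrow> ('y set \<times> 'm) set \<Rightarrow> ('x set \<times> ('x, 'a, 'y, 'm) pullback_section) set" where
  "germ_unit x = (\<lambda>C. \<Union>(V, m)\<in>C. mgerm \<XX> P x (preimage \<XX> f V) (unit V m))"

lemma germ_unit_germ:
  assumes x: "x \<in> points \<XX>" and V: "is_open Y V" "base f x \<in> V" "m \<in> carrier (msections M V)"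
  shows "germ_unit x (mgerm Y M (base f x) V m) = mgerm \<XX> P x (preimage \<XX> f V) (unit V m)"
  unfolding germ_unit_def
proof (rule M.m.UN_germ[OF V])
  fix U n assume U: "is_open Y U" "base f x \<in> U" "n \<in> carrier (msections M U)"
    "mgerm Y M (base f x) U n = mgerm Y M (base f x) V m"
  obtain W where W: "is_open Y W" "base f x \<in> W" "W \<subseteq> U" "W \<subseteq> V" "mrestr M U W n = mrestr M V W m"
    by (rule M.m.germ_eqD[OF U(4) V])
  have sub: "preimage \<XX> f W \<subseteq> preimage \<XX> f U" "preimage \<XX> f W \<subseteq> preimage \<XX> f V"
    using W by (auto simp: mem_preimage)
  have "unit U n y = unit V m y" if y: "y \<in> preimage \<XX> f W" for y
  proof -
    have "mgerm Y M (base f y) U n = mgerm Y M (base f y) V m"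
      by (rule M.m.germ_eqI[of U n V m W]) (use U V W y in \<open>auto simp: mem_preimage\<close>)
    then show ?thesis using y sub by (simp add: unit_at subset_iff)
  qed
  then have "mrestr P (preimage \<XX> f U) (preimage \<XX> f W) (unit U n) = mrestr P (preimage \<XX> f V) (preimage \<XX> f W) (unit V m)"
    unfolding P_simps by (rule restrict_ext)
  then show "mgerm \<XX> P x (preimage \<XX> f U) (unit U n) = mgerm \<XX> P x (preimage \<XX> f V) (unit V m)"
    by (intro P.m.germ_eqI[where W = "preimage \<XX> f W"])
      (use x U V W sub in \<open>auto simp: preimage_open unit_closed mem_preimage\<close>)
qed

lemma evaluation_germ_unit:
  assumes x: "x \<in> points \<XX>" and c: "c \<in> carrier (mstalk Y M (base f x))"
  shows "evaluation x (germ_unit x c) = pten x c \<one>\<^bsub>stalk \<XX> x\<^esub>"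
proof -
  obtain V m where "is_open Y V" "base f x \<in> V" "m \<in> carrier (msections M V)" "c = mgerm Y M (base f x) V m"
    by (rule M.mstalkE[OF c])
  then show ?thesis
    using x by (simp add: germ_unit_germ evaluation_germ preimage_open unit_closed mem_preimage unit_at)
qed

lemma unit_add:
  assumes V: "is_open Y V" and m: "m \<in> carrier (msections M V)" "n \<in> carrier (msections M V)"
  shows "unit V (m \<oplus>\<^bsub>msections M V\<^esub> n) = unit V m \<oplus>\<^bsub>msections P (preimage \<XX> f V)\<^esub> unit V n"
proof (rule extensionalityI[of _ "preimage \<XX> f V"])
  fix x assume x: "x \<in> preimage \<XX> f V"
  then have x': "x \<in> points \<XX>" "base f x \<in> V" by (auto simp: mem_preimage)
  interpret E: scalar_extension "stalk Y (base f x)" "mstalk Y M (base f x)" "stalk \<XX> x" "stalk_map \<XX> Y f x"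
    by (rule extension[OF x'(1)])
  show "unit V (m \<oplus>\<^bsub>msections M V\<^esub> n) x = (unit V m \<oplus>\<^bsub>msections P (preimage \<XX> f V)\<^esub> unit V n) x"
    using x m V x'
    by (simp add: P_simps unit_at M.mstalk_add[symmetric] E.ten_add_left M.mgerm_closed pullback_stalk_def)
qed (auto simp: P_simps pullback_unit_def)

lemma unit_smult:
  assumes V: "is_open Y V" and b: "b \<in> carrier (sections Y V)" and m: "m \<in> carrier (msections M V)"
  shows "unit V (b \<odot>\<^bsub>msections M V\<^esub> m) = sharp f V b \<odot>\<^bsub>msections P (preimage \<XX> f V)\<^esub> unit V m"
proof (rule extensionalityI[of _ "preimage \<XX> f V"])
  fix x assume x: "x \<in> preimage \<XX> f V"
  then have x': "x \<in> points \<XX>" "base f x \<in> V" by (auto simp: mem_preimage)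
  interpret E: scalar_extension "stalk Y (base f x)" "mstalk Y M (base f x)" "stalk \<XX> x" "stalk_map \<XX> Y f x"
    by (rule extension[OF x'(1)])
  have g: "rgerm \<XX> x (preimage \<XX> f V) (sharp f V b) \<in> carrier (stalk \<XX> x)"
    using x V b by (simp add: \<XX>.rgerm_closed preimage_open sharp_closed)
  show "unit V (b \<odot>\<^bsub>msections M V\<^esub> m) x = (sharp f V b \<odot>\<^bsub>msections P (preimage \<XX> f V)\<^esub> unit V m) x"
    using x m V x' b g
    by (simp add: P_simps unit_at M.mstalk_smult[symmetric] E.ten_balanced E.smult_B M.mgerm_closed Y.rgerm_closed
        pullback_stalk_def stalk_map_germ)
qed (auto simp: P_simps pullback_unit_def)

lemma germ_unit_closed:
  assumes x: "x \<in> points \<XX>" and c: "c \<in> carrier (mstalk Y M (base f x))"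
  shows "germ_unit x c \<in> carrier (mstalk \<XX> P x)"
proof -
  obtain V m where "is_open Y V" "base f x \<in> V" "m \<in> carrier (msections M V)" "c = mgerm Y M (base f x) V m"
    by (rule M.mstalkE[OF c])
  then show ?thesis
    using x by (simp add: germ_unit_germ preimage_open unit_closed mem_preimage P.mgerm_closed)
qed

lemma germ_unit_add:
  assumes x: "x \<in> points \<XX>" and c: "c \<in> carrier (mstalk Y M (base f x))" "d \<in> carrier (mstalk Y M (base f x))"
  shows "germ_unit x (c \<oplus>\<^bsub>mstalk Y M (base f x)\<^esub> d) = germ_unit x c \<oplus>\<^bsub>mstalk \<XX> P x\<^esub> germ_unit x d"
proof -
  obtain V m n where "is_open Y V" "base f x \<in> V" "m \<in> carrier (msections M V)" "c = mgerm Y M (base f x) V m"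
    "n \<in> carrier (msections M V)" "d = mgerm Y M (base f x) V n"
    by (rule M.mstalk_common2[OF c, of "points Y"]) (use x base_points in auto)
  then show ?thesis
    using x by (simp add: germ_unit_germ preimage_open unit_closed mem_preimage P.mstalk_add M.mstalk_add
        M.msections_closed unit_add)
qed

lemma germ_unit_smult:
  assumes x: "x \<in> points \<XX>" and b: "b \<in> carrier (stalk Y (base f x))" and c: "c \<in> carrier (mstalk Y M (base f x))"
  shows "germ_unit x (b \<odot>\<^bsub>mstalk Y M (base f x)\<^esub> c) = stalk_map \<XX> Y f x b \<odot>\<^bsub>mstalk \<XX> P x\<^esub> germ_unit x c"
proof -
  obtain U e where U: "is_open Y U" "base f x \<in> U" "e \<in> carrier (sections Y U)" "b = rgerm Y (base f x) U e"
    by (rule Y.stalkE[OF b])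
  obtain V m where V: "is_open Y V" "base f x \<in> V" "V \<subseteq> U" "m \<in> carrier (msections M V)" "c = mgerm Y M (base f x) V m"
    by (rule M.mstalk_common[OF c U(1,2)])
  define e' where "e' = restr Y U V e"
  have e': "e' \<in> carrier (sections Y V)" "b = rgerm Y (base f x) V e'"
    using U V by (simp_all add: e'_def Y.germ_restrict Y.rho_closed)
  show ?thesis
    using x V e' by (simp add: germ_unit_germ preimage_open unit_closed mem_preimage P.mstalk_smult M.mstalk_smult
        M.msections_closed unit_smult stalk_map_germ sharp_closed)
qed

text \<open>
  Near \<open>x\<close> a section is a sum of terms \<open>a (m \<otimes> 1)\<close>, restricted from the unit, by its local data.
\<close>

lemma mstalk_P_generated:
  assumes x: "x \<in> points \<XX>" and n: "n \<in> carrier (mstalk \<XX> P x)"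
    and unit: "\<And>b c. b \<in> carrier (stalk \<XX> x) \<Longrightarrow> c \<in> carrier (mstalk Y M (base f x)) \<Longrightarrow>
        b \<odot>\<^bsub>mstalk \<XX> P x\<^esub> germ_unit x c \<in> A"
    and add: "\<And>c d. c \<in> carrier (mstalk \<XX> P x) \<Longrightarrow> d \<in> carrier (mstalk \<XX> P x) \<Longrightarrow> c \<in> A \<Longrightarrow> d \<in> A \<Longrightarrow>
        c \<oplus>\<^bsub>mstalk \<XX> P x\<^esub> d \<in> A"
  shows "n \<in> A"
proof -
  interpret S: module "stalk \<XX> x" "mstalk \<XX> P x" by (rule P.module_mstalk[OF x])
  interpret N: module "stalk Y (base f x)" "mstalk Y M (base f x)" by (rule M.module_mstalk[OF base_points[OF x]])
  obtain U s where U: "is_open \<XX> U" "x \<in> U" "s \<in> carrier (msections P U)" "n = mgerm \<XX> P x U s"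
    by (rule P.mstalkE[OF n])
  obtain W V ms where 1: "local_data W V ms" "x \<in> W" "W \<subseteq> U" "\<And>y. y \<in> W \<Longrightarrow> s y = value_at W V ms y"
    by (rule P_local[OF U(3,2)]) blast
  have W: "is_open \<XX> W" "is_open Y V" "base f ` W \<subseteq> V" using 1(1) by (auto simp: local_data_def)
  have sub: "W \<subseteq> preimage \<XX> f V" using local_data_points[OF 1(1)] by (auto simp: mem_preimage)
  have sec: "restrict (value_at W V ms) W \<in> carrier (msections P W) \<and>
      mgerm \<XX> P x W (restrict (value_at W V ms) W) \<in> A" if "local_data W V ms" for ms
    using that
  proof (induction ms)
    case Nil
    have "restrict (value_at W V []) W = \<zero>\<^bsub>msections P W\<^esub>"
      unfolding P_simps by (rule restrict_ext) (use local_data_points[OF 1(1)] in \<open>simp add: value_at_Nil\<close>)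
    moreover have "\<zero>\<^bsub>mstalk \<XX> P x\<^esub> \<in> A"
      using unit[of "\<zero>\<^bsub>stalk \<XX> x\<^esub>" "\<zero>\<^bsub>mstalk Y M (base f x)\<^esub>"] germ_unit_closed[OF x, of "\<zero>\<^bsub>mstalk Y M (base f x)\<^esub>"]
      by simp
    ultimately show ?case using P.mstalk_zero[OF W(1) 1(2)] P_zero_closed[OF W(1)] by simp
  next
    case (Cons p ms)
    obtain m a where p: "p = (m, a)" by (cases p)
    have e: "local_data W V ms" "local_data W V [(m, a)]" "local_data W V ((m, a) # ms)"
      using Cons.prems p by (auto simp: local_data_def)
    have m: "m \<in> carrier (msections M V)" "a \<in> carrier (sections \<XX> W)"
      using e(2) by (auto simp: local_data_def)
    note IH = Cons.IH[OF e(1)]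
    let ?u = "restrict (unit V m) W"
    have u: "?u \<in> carrier (msections P W)"
      using P_restrict_closed[OF preimage_open[OF W(2)] W(1) sub unit_closed[OF W(2) m(1)]] .
    let ?au = "a \<odot>\<^bsub>msections P W\<^esub> ?u"
    have au: "?au \<in> carrier (msections P W)" by (rule P_smult_closed[OF W(1) m(2) u])
    have eq: "restrict (value_at W V ((m, a) # ms)) W = ?au \<oplus>\<^bsub>msections P W\<^esub> restrict (value_at W V ms) W"
      unfolding P_simps
    proof (rule restrict_ext)
      fix y assume y: "y \<in> W"
      have y': "y \<in> points \<XX>" "base f y \<in> V" using local_data_points[OF 1(1) y] by auto
      interpret E: scalar_extension "stalk Y (base f y)" "mstalk Y M (base f y)" "stalk \<XX> y" "stalk_map \<XX> Y f y"
        by (rule extension[OF y'(1)])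
      have "rgerm \<XX> y W a \<odot>\<^bsub>PS y\<^esub> unit V m y = pten y (mgerm Y M (base f y) V m) (rgerm \<XX> y W a)"
        using y y' W m sub
        by (simp add: unit_at subset_iff pullback_stalk_def E.smult_B \<XX>.rgerm_closed M.mgerm_closed)
      then show "value_at W V ((m, a) # ms) y = (\<lambda>x\<in>W. rgerm \<XX> x W a \<odot>\<^bsub>PS x\<^esub> ?u x) y \<oplus>\<^bsub>PS y\<^esub>
          restrict (value_at W V ms) W y"
        using y by (simp add: value_at_Cons[OF e(3) y])
    qed
    have "mgerm \<XX> P x W ?u = germ_unit x (mgerm Y M (base f x) V m)"
      using P.m.germ_restrict[OF preimage_open[OF W(2)] W(1) 1(2) sub unit_closed[OF W(2) m(1)]] x W 1(2) m
      by (subst germ_unit_germ) (auto simp: P_simps)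
    then have "mgerm \<XX> P x W ?au \<in> A"
      using unit[of "rgerm \<XX> x W a" "mgerm Y M (base f x) V m"] P.mstalk_smult[OF W(1) 1(2) m(2) u]
        \<XX>.rgerm_closed[OF W(1) 1(2) m(2)] M.mgerm_closed[of V "base f x" m] W m 1(2)
      by auto
    then have "mgerm \<XX> P x W ?au \<oplus>\<^bsub>mstalk \<XX> P x\<^esub> mgerm \<XX> P x W (restrict (value_at W V ms) W) \<in> A"
      by (intro add P.mgerm_closed W 1(2) au conjunct1[OF IH] conjunct2[OF IH])
    then have "mgerm \<XX> P x W (?au \<oplus>\<^bsub>msections P W\<^esub> restrict (value_at W V ms) W) \<in> A"
      by (simp only: P.mstalk_add[OF W(1) 1(2) au conjunct1[OF IH]])
    then show ?case
      using P_add_closed[OF W(1) au conjunct1[OF IH]] by (simp only: p eq)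
  qed
  have "n = mgerm \<XX> P x W (restrict s W)"
    using P.m.germ_restrict[OF U(1) W(1) 1(2,3) U(3)] U(4) by (simp add: P_simps)
  also have "restrict s W = restrict (value_at W V ms) W"
    by (rule restrict_ext) (rule 1(4))
  finally show ?thesis using conjunct2[OF sec[OF 1(1)]] by (simp only:)
qed

end

text \<open>
  The stalk of \<open>g\<^sup>*M\<close> satisfies the hypotheses of \<open>base_change_map_transitive\<close>.
\<close>

lemma pullback_comp_stalk:
  assumes "rs_map \<XX> Y f" and "rs_map Y Z g" and "module_presheaf Z M" and x: "x \<in> points \<XX>"
  defines "H \<equiv> base_change_map (stalk Y (base f x)) (mstalk Y (pullback Y Z g M) (base f x)) (stalk \<XX> x)
      (stalk_map \<XX> Y f x)
      (\<lambda>C. \<Union>(V, m)\<in>C. mgerm Y (pullback Y Z g M) (base f x) (preimage Y g V) (pullback_unit Y Z g M V m))"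
  shows "module_hom (stalk \<XX> x) (pullback_stalk \<XX> Z (comp_morphism Y g f) M x)
      (pullback_stalk \<XX> Y f (pullback Y Z g M) x) H"
    and "bij_betw H (carrier (pullback_stalk \<XX> Z (comp_morphism Y g f) M x))
      (carrier (pullback_stalk \<XX> Y f (pullback Y Z g M) x))"
proof -
  interpret f: rs_map \<XX> Y f by fact
  interpret g: rs_map Y Z g by fact
  interpret M: module_presheaf Z M by fact
  interpret gM: module_pullback Y Z g M ..
  interpret fgM: module_pullback \<XX> Y f "pullback Y Z g M" ..
  interpret h: rs_map \<XX> Z "comp_morphism Y g f" by (rule rs_map_comp) fact+
  interpret hM: module_pullback \<XX> Z "comp_morphism Y g f" M ..
  have b: "base (comp_morphism Y g f) x = base g (base f x)" by (simp add: comp_morphism_def)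
  note y = f.base_points[OF x]
  have H: "H = base_change_map (stalk Y (base f x)) (mstalk Y gM.P (base f x)) (stalk \<XX> x) (stalk_map \<XX> Y f x)
      (gM.germ_unit (base f x))"
    unfolding H_def gM.germ_unit_def ..
  note ext = hM.extension[OF x, unfolded b] gM.extension[OF y] fgM.extension[OF x]
  note ev = gM.evaluation_hom[OF y, unfolded pullback_stalk_def]
  note T = base_change_map_transitive[OF ext rs_map_comp(2)[OF assms(1,2) x] _ gM.germ_unit_add[OF y]
      gM.germ_unit_smult[OF y] ev gM.evaluation_germ_unit[OF y] gM.mstalk_P_generated[OF y]]
  show "module_hom (stalk \<XX> x) (pullback_stalk \<XX> Z (comp_morphism Y g f) M x)
      (pullback_stalk \<XX> Y f (pullback Y Z g M) x) H"
    unfolding H pullback_stalk_def b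
    by (rule T(1)) (auto intro: gM.germ_unit_closed[OF y])
  show "bij_betw H (carrier (pullback_stalk \<XX> Z (comp_morphism Y g f) M x))
      (carrier (pullback_stalk \<XX> Y f (pullback Y Z g M) x))"
    unfolding H pullback_stalk_def b
    by (rule T(2)) (auto intro: gM.germ_unit_closed[OF y])
qed

section \<open>Isomorphisms of sheaves of modules\<close>

lemma normalize_map_apply:
  "is_open \<XX> U \<Longrightarrow> s \<in> carrier (msections M U) \<Longrightarrow> normalize_map \<XX> M \<phi> U s = \<phi> U s"
  by (simp add: normalize_map_def)

lemma normalize_map_cong:
  assumes "\<And>U s. is_open \<XX> U \<Longrightarrow> s \<in> carrier (msections M U) \<Longrightarrow> \<phi> U s = \<psi> U s"
  shows "normalize_map \<XX> M \<phi> = normalize_map \<XX> M \<psi>"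
  unfolding normalize_map_def by (auto intro!: restrict_ext simp: assms)

lemma normalize_map_idem: "normalize_map \<XX> M (normalize_map \<XX> M \<phi>) = normalize_map \<XX> M \<phi>"
  by (rule normalize_map_cong) (simp add: normalize_map_apply)

lemma sheaf_isoD:
  assumes "sheaf_iso \<XX> M N \<phi>"
  shows "sheaf_hom \<XX> M N \<phi>" and "normalize_map \<XX> M \<phi> = \<phi>"
    and "is_open \<XX> U \<Longrightarrow> module_hom (sections \<XX> U) (msections M U) (msections N U) (\<phi> U)"
    and "is_open \<XX> U \<Longrightarrow> bij_betw (\<phi> U) (carrier (msections M U)) (carrier (msections N U))"
    and "is_open \<XX> U \<Longrightarrow> s \<in> carrier (msections M U) \<Longrightarrow> \<phi> U s \<in> carrier (msections N U)"
    and "\<lbrakk>is_open \<XX> U; is_open \<XX> V; V \<subseteq> U; s \<in> carrier (msections M U)\<rbrakk> \<Longrightarrow> mrestr N U V (\<phi> U s) = \<phi> V (mrestr M U V s)"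
  using assms unfolding sheaf_iso_def sheaf_hom_def by (auto intro: bij_betw_apply)

lemma sheaf_map_eqI:
  assumes "normalize_map \<XX> M \<phi> = \<phi>" and "normalize_map \<XX> M \<psi> = \<psi>"
    and "\<And>U s. is_open \<XX> U \<Longrightarrow> s \<in> carrier (msections M U) \<Longrightarrow> \<phi> U s = \<psi> U s"
  shows "\<phi> = \<psi>"
proof -
  have "normalize_map \<XX> M \<phi> = normalize_map \<XX> M \<psi>"
    by (rule normalize_map_cong) (rule assms(3))
  then show ?thesis by (simp only: assms(1,2))
qed

lemma sheaf_comp_apply:
  "is_open \<XX> U \<Longrightarrow> s \<in> carrier (msections M U) \<Longrightarrow> sheaf_comp \<XX> M \<psi> \<phi> U s = \<psi> U (\<phi> U s)"
  by (simp add: sheaf_comp_def normalize_map_apply)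

lemma sheaf_iso_comp:
  assumes \<phi>: "sheaf_iso \<XX> M N \<phi>" and \<psi>: "sheaf_iso \<XX> N L \<psi>"
    and M: "module_presheaf \<XX> M"
  shows "sheaf_iso \<XX> M L (sheaf_comp \<XX> M \<psi> \<phi>)"
proof -
  interpret M: module_presheaf \<XX> M by fact
  note a = sheaf_isoD[OF \<phi>] and b = sheaf_isoD[OF \<psi>]
  have bij: "bij_betw (sheaf_comp \<XX> M \<psi> \<phi> U) (carrier (msections M U)) (carrier (msections L U))"
    if U: "is_open \<XX> U" for U
  proof -
    have "bij_betw (\<psi> U \<circ> \<phi> U) (carrier (msections M U)) (carrier (msections L U))"
      by (rule bij_betw_trans[OF a(4)[OF U] b(4)[OF U]])
    then show ?thesis
      by (rule bij_betw_cong[THEN iffD1, rotated]) (simp add: sheaf_comp_apply U)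
  qed
  moreover have "module_hom (sections \<XX> U) (msections M U) (msections L U) (sheaf_comp \<XX> M \<psi> \<phi> U)"
    if U: "is_open \<XX> U" for U
    using a(3)[OF U] b(3)[OF U] M.msections_closed[OF U]
    by (simp add: module_hom_def sheaf_comp_apply U Pi_iff)
  moreover have "mrestr L U V (sheaf_comp \<XX> M \<psi> \<phi> U s) = sheaf_comp \<XX> M \<psi> \<phi> V (mrestr M U V s)"
    if "is_open \<XX> U" "is_open \<XX> V" "V \<subseteq> U" "s \<in> carrier (msections M U)" for U V s
    using that by (simp add: sheaf_comp_apply M.mrestr_closed b(6)[OF that(1-3)] a(5) a(6)[OF that])
  ultimately show ?thesis
    unfolding sheaf_iso_def sheaf_hom_def by (auto simp: sheaf_comp_def normalize_map_idem)
qed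

lemma sheaf_inv_apply:
  assumes \<phi>: "sheaf_iso \<XX> M N \<phi>" and U: "is_open \<XX> U"
  shows "t \<in> carrier (msections N U) \<Longrightarrow> sheaf_inv \<XX> M N \<phi> U t \<in> carrier (msections M U)"
    and "t \<in> carrier (msections N U) \<Longrightarrow> \<phi> U (sheaf_inv \<XX> M N \<phi> U t) = t"
    and "s \<in> carrier (msections M U) \<Longrightarrow> sheaf_inv \<XX> M N \<phi> U (\<phi> U s) = s"
proof -
  note b = sheaf_isoD(4)[OF \<phi> U]
  have inv: "sheaf_inv \<XX> M N \<phi> U t = inv_into (carrier (msections M U)) (\<phi> U) t"
    if "t \<in> carrier (msections N U)" for t
    using that U by (simp add: sheaf_inv_def normalize_map_apply)
  show "t \<in> carrier (msections N U) \<Longrightarrow> sheaf_inv \<XX> M N \<phi> U t \<in> carrier (msections M U)"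
    using b by (simp add: inv bij_betw_def inv_into_into)
  show "t \<in> carrier (msections N U) \<Longrightarrow> \<phi> U (sheaf_inv \<XX> M N \<phi> U t) = t"
    using b by (simp add: inv bij_betw_def f_inv_into_f)
  show "s \<in> carrier (msections M U) \<Longrightarrow> sheaf_inv \<XX> M N \<phi> U (\<phi> U s) = s"
    using b sheaf_isoD(5)[OF \<phi> U] by (simp add: inv bij_betw_def inv_into_f_f)
qed

lemma sheaf_iso_inv:
  assumes \<phi>: "sheaf_iso \<XX> M N \<phi>" and M: "module_presheaf \<XX> M" and N: "module_presheaf \<XX> N"
  shows "sheaf_iso \<XX> N M (sheaf_inv \<XX> M N \<phi>)"
proof -
  interpret M: module_presheaf \<XX> M by fact
  interpret N: module_presheaf \<XX> N by fact
  note a = sheaf_isoD[OF \<phi>] and i = sheaf_inv_apply[OF \<phi>]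
  let ?\<psi> = "sheaf_inv \<XX> M N \<phi>"
  have "bij_betw (?\<psi> U) (carrier (msections N U)) (carrier (msections M U))" if U: "is_open \<XX> U" for U
    by (rule bij_betw_byWitness[where f' = "\<phi> U"]) (use i[OF U] a(5)[OF U] in auto)
  moreover have "module_hom (sections \<XX> U) (msections N U) (msections M U) (?\<psi> U)" if U: "is_open \<XX> U" for U
    unfolding module_hom_def
  proof (intro conjI ballI funcsetI)
    fix s t assume st: "s \<in> carrier (msections N U)" "t \<in> carrier (msections N U)"
    let ?w = "?\<psi> U s \<oplus>\<^bsub>msections M U\<^esub> ?\<psi> U t"
    have "\<phi> U ?w = s \<oplus>\<^bsub>msections N U\<^esub> t" using a(3)[OF U] i[OF U] st by (simp add: module_hom_def)
    then show "?\<psi> U (s \<oplus>\<^bsub>msections N U\<^esub> t) = ?w"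
      using i(3)[OF U, of ?w] i(1)[OF U] st M.msections_closed[OF U] by simp
  next
    fix b s assume b: "b \<in> carrier (sections \<XX> U)" and s: "s \<in> carrier (msections N U)"
    let ?w = "b \<odot>\<^bsub>msections M U\<^esub> ?\<psi> U s"
    have "\<phi> U ?w = b \<odot>\<^bsub>msections N U\<^esub> s" using a(3)[OF U] i[OF U] b s by (simp add: module_hom_def)
    then show "?\<psi> U (b \<odot>\<^bsub>msections N U\<^esub> s) = ?w"
      using i(3)[OF U, of ?w] i(1)[OF U] b s M.msections_closed[OF U] by simp
  qed (rule i(1)[OF U])
  moreover have "mrestr M U V (?\<psi> U s) = ?\<psi> V (mrestr N U V s)"
    if UV: "is_open \<XX> U" "is_open \<XX> V" "V \<subseteq> U" and s: "s \<in> carrier (msections N U)" for U V s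
  proof -
    let ?w = "mrestr M U V (?\<psi> U s)"
    have "\<phi> V ?w = mrestr N U V s" using a(6)[OF UV i(1)[OF UV(1) s]] i(2)[OF UV(1) s] by simp
    then show ?thesis using i(3)[OF UV(2), of ?w] i(1)[OF UV(1) s] M.mrestr_closed[OF UV] by simp
  qed
  ultimately show ?thesis
    unfolding sheaf_iso_def sheaf_hom_def by (auto simp: sheaf_inv_def normalize_map_idem)
qed

lemma tensor_relations_mono:
  assumes "\<And>a. a \<in> carrier R \<Longrightarrow> \<phi> a = \<psi> a"
  shows "tensor_relations R M S \<phi> \<subseteq> tensor_relations R M S \<psi>"
  unfolding tensor_relations_def
proof (rule Un_mono[OF order_refl], clarify)
  fix a x s assume "a \<in> carrier R" "x \<in> carrier M" "s \<in> carrier S"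
  then show "\<exists>a' x' s'. frag_of (a \<odot>\<^bsub>M\<^esub> x, s) - frag_of (x, \<phi> a \<otimes>\<^bsub>S\<^esub> s) =
      frag_of (a' \<odot>\<^bsub>M\<^esub> x', s') - frag_of (x', \<psi> a' \<otimes>\<^bsub>S\<^esub> s') \<and>
      a' \<in> carrier R \<and> x' \<in> carrier M \<and> s' \<in> carrier S"
    using assms by (intro exI[of _ a] exI[of _ x] exI[of _ s]) simp
qed

text \<open>
  The pullback depends on the comorphism only through its values on sections over open sets, because the relations
  of a base change only involve scalars from the carrier.
\<close>

lemma pullback_cong:
  assumes base: "base f = base g"
    and sharp: "\<And>V b. is_open Y V \<Longrightarrow> b \<in> carrier (sections Y V) \<Longrightarrow> sharp f V b = sharp g V b"
  shows "pullback \<XX> Y f M = pullback \<XX> Y g M"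
proof -
  have pre: "preimage \<XX> f = preimage \<XX> g" by (simp add: preimage_def base fun_eq_iff)
  have st: "stalk_map \<XX> Y f x C = stalk_map \<XX> Y g x C" if "C \<in> carrier (stalk Y (base g x))" for x C
    unfolding stalk_map_def pre
  proof (rule SUP_cong[OF refl], clarify)
    fix V b assume "(V, b) \<in> C"
    then have "is_open Y V" "b \<in> carrier (sections Y V)"
      using that by (auto simp: stalk_def germs_def germ_def)
    then show "rgerm \<XX> x (preimage \<XX> g V) (sharp f V b) = rgerm \<XX> x (preimage \<XX> g V) (sharp g V b)"
      by (simp add: sharp)
  qed
  have rel: "tensor_relations (stalk Y (base g x)) (mstalk Y M (base g x)) (stalk \<XX> x) (stalk_map \<XX> Y f x) =
      tensor_relations (stalk Y (base g x)) (mstalk Y M (base g x)) (stalk \<XX> x) (stalk_map \<XX> Y g x)" for x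
    by (intro equalityI tensor_relations_mono) (simp_all add: st)
  have "pullback_stalk \<XX> Y f M = pullback_stalk \<XX> Y g M" "pullback_class \<XX> Y f M = pullback_class \<XX> Y g M"
    by (simp_all add: fun_eq_iff pullback_stalk_def pullback_class_def base_change_def tensor_class_def
        tensor_kernel_def base rel)
  then show ?thesis unfolding pullback_def pullback_sections_def by (simp only: base)
qed

text \<open>
  \<open>Spec k\<close> seen as an abstract one-point space; the last axiom expresses gluing over the empty cover.
\<close>

locale one_point = ring_presheaf \<XX>
  for \<XX> :: "('x, 'a) ringed_space" +
  fixes pt :: 'x
  assumes points_eq: "points \<XX> = {pt}"
    and sections_empty: "\<exists>z. carrier (sections \<XX> {}) = {z}"
begin

lemma open_cases: "is_open \<XX> U \<longleftrightarrow> U = {} \<or> U = {pt}"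
  using openin_subset[of "top_space \<XX>" U] openin_topspace[of "top_space \<XX>"] points_eq by auto

lemma open_pt: "is_open \<XX> {pt}"
  by (simp add: open_cases)

end

lemma (in set_presheaf) germ_bij:
  assumes U: "openin T U" "x \<in> U" and minimal: "\<And>V. openin T V \<Longrightarrow> x \<in> V \<Longrightarrow> U \<subseteq> V"
  shows "bij_betw (germ T F \<rho> x U) (carrier (F U)) (germs T F \<rho> x)"
proof (rule bij_betwI')
  fix s t assume s: "s \<in> carrier (F U)" and t: "t \<in> carrier (F U)"
  have "s = t" if eq: "germ T F \<rho> x U s = germ T F \<rho> x U t"
  proof -
    obtain W where W: "openin T W" "x \<in> W" "W \<subseteq> U" "\<rho> U W s = \<rho> U W t"
      by (rule germ_eqD[OF eq U t])
    then have "W = U" using minimal by auto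
    then show ?thesis using W s t U by (simp add: rho_id)
  qed
  then show "(germ T F \<rho> x U s = germ T F \<rho> x U t) = (s = t)" by auto
next
  fix C assume "C \<in> germs T F \<rho> x"
  then obtain V s where V: "openin T V" "x \<in> V" "s \<in> carrier (F V)" "C = germ T F \<rho> x V s"
    by (rule germsE)
  have "U \<subseteq> V" by (rule minimal[OF V(1,2)])
  then show "\<exists>t\<in>carrier (F U). C = germ T F \<rho> x U t"
    using V U germ_restrict[of V U x s] rho_closed[of V U s] by (intro bexI[of _ "\<rho> V U s"]) auto
qed (rule germ_in_germs[OF U])

text \<open>
  The open sets are the empty set and the whole space, so a map into a sheaf with one section over the empty set
  commutes with restriction.
\<close>

lemma (in one_point) sheaf_isoI:
  assumes "module_presheaf \<XX> M" and "module_presheaf \<XX> N" and N: "carrier (msections N {}) = {z}"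
    and hom: "\<And>U. is_open \<XX> U \<Longrightarrow> module_hom (sections \<XX> U) (msections M U) (msections N U) (\<phi> U)"
    and bij: "\<And>U. is_open \<XX> U \<Longrightarrow> bij_betw (\<phi> U) (carrier (msections M U)) (carrier (msections N U))"
  shows "sheaf_iso \<XX> M N (normalize_map \<XX> M \<phi>)"
proof -
  interpret M: module_presheaf \<XX> M by fact
  interpret N: module_presheaf \<XX> N by fact
  let ?\<phi> = "normalize_map \<XX> M \<phi>"
  have "bij_betw (?\<phi> U) (carrier (msections M U)) (carrier (msections N U))" if U: "is_open \<XX> U" for U
    using bij[OF U] by (rule bij_betw_cong[THEN iffD1, rotated]) (simp add: normalize_map_apply U)
  moreover have "module_hom (sections \<XX> U) (msections M U) (msections N U) (?\<phi> U)" if U: "is_open \<XX> U" for U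
    using hom[OF U] M.msections_closed[OF U] by (simp add: module_hom_def normalize_map_apply U Pi_iff)
  moreover have "mrestr N U V (?\<phi> U s) = ?\<phi> V (mrestr M U V s)"
    if UV: "is_open \<XX> U" "is_open \<XX> V" "V \<subseteq> U" and s: "s \<in> carrier (msections M U)" for U V s
  proof -
    have cl: "\<phi> U s \<in> carrier (msections N U)" if "is_open \<XX> U" "s \<in> carrier (msections M U)" for U s
      using hom that unfolding module_hom_def by blast
    show ?thesis
    proof (cases "V = U")
      case True
      then show ?thesis using UV s cl by (simp add: normalize_map_apply M.mrestr_id N.mrestr_id)
    next
      case False
      then have "V = {}" using UV open_cases by auto
      moreover have "mrestr N U V (?\<phi> U s) \<in> carrier (msections N V)" "?\<phi> V (mrestr M U V s) \<in> carrier (msections N V)"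
        using UV s cl M.mrestr_closed[OF UV s] by (simp_all add: normalize_map_apply N.mrestr_closed)
      ultimately show ?thesis using N by simp
    qed
  qed
  ultimately show ?thesis
    unfolding sheaf_iso_def sheaf_hom_def by (auto simp: normalize_map_idem)
qed

section \<open>Free sheaves\<close>

lemma free_sheaf_mem:
  "v \<in> carrier (msections (free_sheaf \<XX> r) U) \<longleftrightarrow>
    v \<in> extensional {..<r} \<and> (\<forall>i<r. v i \<in> carrier (sections \<XX> U))"
  by (auto simp: free_sheaf_def PiE_def Pi_iff)

lemma free_sheaf_simps:
  "\<zero>\<^bsub>msections (free_sheaf \<XX> r) U\<^esub> = (\<lambda>i\<in>{..<r}. \<zero>\<^bsub>sections \<XX> U\<^esub>)"
  "v \<oplus>\<^bsub>msections (free_sheaf \<XX> r) U\<^esub> w = (\<lambda>i\<in>{..<r}. v i \<oplus>\<^bsub>sections \<XX> U\<^esub> w i)"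
  "a \<odot>\<^bsub>msections (free_sheaf \<XX> r) U\<^esub> v = (\<lambda>i\<in>{..<r}. a \<otimes>\<^bsub>sections \<XX> U\<^esub> v i)"
  "mrestr (free_sheaf \<XX> r) U V v = (\<lambda>i\<in>{..<r}. restr \<XX> U V (v i))"
  by (simp_all add: free_sheaf_def)

lemma (in ring_presheaf) free_sheaf_presheaf: "module_presheaf \<XX> (free_sheaf \<XX> r)"
proof (intro module_presheaf.intro module_presheaf_axioms.intro ring_presheaf_axioms)
  fix U assume U: "is_open \<XX> U"
  interpret C: cring "sections \<XX> U" by (rule cring_sections[OF U])
  show "module (sections \<XX> U) (msections (free_sheaf \<XX> r) U)"
  proof (intro moduleI abelian_groupI C.is_cring)
    fix v assume v: "v \<in> carrier (msections (free_sheaf \<XX> r) U)"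
    show "\<exists>w\<in>carrier (msections (free_sheaf \<XX> r) U). w \<oplus>\<^bsub>msections (free_sheaf \<XX> r) U\<^esub> v = \<zero>\<^bsub>msections (free_sheaf \<XX> r) U\<^esub>"
      by (rule bexI[of _ "\<lambda>i\<in>{..<r}. \<ominus>\<^bsub>sections \<XX> U\<^esub> v i"])
        (use v in \<open>auto simp: free_sheaf_mem free_sheaf_simps C.l_neg intro!: restrict_ext\<close>)
    show "\<zero>\<^bsub>msections (free_sheaf \<XX> r) U\<^esub> \<oplus>\<^bsub>msections (free_sheaf \<XX> r) U\<^esub> v = v"
      by (rule extensionalityI[of _ "{..<r}"]) (use v in \<open>simp_all add: free_sheaf_mem free_sheaf_simps\<close>)
    show "\<one>\<^bsub>sections \<XX> U\<^esub> \<odot>\<^bsub>msections (free_sheaf \<XX> r) U\<^esub> v = v"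
      by (rule extensionalityI[of _ "{..<r}"]) (use v in \<open>simp_all add: free_sheaf_mem free_sheaf_simps\<close>)
  qed (auto simp: free_sheaf_mem free_sheaf_simps C.add.m_ac C.l_distr C.r_distr C.m_assoc intro!: restrict_ext)
next
  fix U v assume "is_open \<XX> U" "v \<in> carrier (msections (free_sheaf \<XX> r) U)"
  then show "mrestr (free_sheaf \<XX> r) U U v = v"
    by (intro extensionalityI[of _ "{..<r}"]) (simp_all add: free_sheaf_mem free_sheaf_simps restr_id)
qed (auto simp: free_sheaf_mem free_sheaf_simps ring_hom_add[OF restr_hom] ring_hom_mult[OF restr_hom] restr_trans
    intro!: restrict_ext rho_closed)

lemma (in one_point) free_sheaf_empty: "\<exists>z. carrier (msections (free_sheaf \<XX> r) {}) = {z}"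
proof -
  obtain z where z: "carrier (sections \<XX> {}) = {z}" using sections_empty by auto
  have "(\<Pi>\<^sub>E i\<in>{..<r}. {z}) = {\<lambda>i\<in>{..<r}. z}"
    by (auto simp: PiE_iff extensional_def fun_eq_iff restrict_def)
  then show ?thesis using z by (auto simp: free_sheaf_def)
qed

section \<open>Pullback to a one-point space\<close>

locale one_point_pullback = one_point \<XX> pt + module_pullback \<XX> Y f M
  for \<XX> :: "('x, 'a) ringed_space" and pt :: 'x and Y :: "('y, 'b) ringed_space"
    and f :: "('x, 'a, 'y, 'b) space_map" and M :: "('y, 'b, 'm) module_sheaf"
begin

text \<open>
  The point is open, so a sum of tensors of germs is represented by sections over the whole space.
\<close>

lemma PS_value:
  assumes C: "C \<in> carrier (PS pt)"
  shows "\<exists>V ms. local_data {pt} V ms \<and> C = value_at {pt} V ms pt"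
proof -
  have pt: "pt \<in> points \<XX>" by (simp add: points_eq)
  interpret E: scalar_extension "stalk Y (base f pt)" "mstalk Y M (base f pt)" "stalk \<XX> pt" "stalk_map \<XX> Y f pt"
    by (rule extension[OF pt])
  interpret PS: module "stalk \<XX> pt" "PS pt" by (rule module_PS[OF pt])
  from C show ?thesis unfolding pullback_stalk_def
  proof (induction rule: E.B_induct)
    case (ten c d)
    obtain V m where V: "is_open Y V" "base f pt \<in> V" "m \<in> carrier (msections M V)" "c = mgerm Y M (base f pt) V m"
      by (rule M.mstalkE[OF ten(1)])
    obtain U s where U: "is_open \<XX> U" "pt \<in> U" "s \<in> carrier (sections \<XX> U)" "d = rgerm \<XX> pt U s"
      by (rule stalkE[OF ten(2)])
    then have U': "U = {pt}" using open_cases by auto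
    have d: "local_data {pt} V [(m, s)]"
      using U V U' by (simp add: local_data_def)
    have "value_at {pt} V [(m, s)] pt = E.ten c d"
      using pten_closed[OF d] U V U' by (simp add: value_at_Cons[OF d] value_at_Nil[OF pt])
    then show ?case using d by metis
  next
    case (add C D)
    then obtain V ms V' ns where 1: "local_data {pt} V ms" "C = value_at {pt} V ms pt"
      and 2: "local_data {pt} V' ns" "D = value_at {pt} V' ns pt" by auto
    have o: "is_open \<XX> {pt}" "is_open Y (V \<inter> V')" "base f ` {pt} \<subseteq> V \<inter> V'"
      using 1(1) 2(1) by (auto simp: local_data_def)
    note r1 = value_at_restrict[OF 1(1) o(1,2) order_refl Int_lower1 o(3)]
    note r2 = value_at_restrict[OF 2(1) o(1,2) order_refl Int_lower2 o(3)]
    have "local_data {pt} (V \<inter> V') (map (\<lambda>(m, a). (mrestr M V (V \<inter> V') m, restr \<XX> {pt} {pt} a)) ms @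
        map (\<lambda>(m, a). (mrestr M V' (V \<inter> V') m, restr \<XX> {pt} {pt} a)) ns)"
      using r1(1) r2(1) by (simp add: local_data_def)
    moreover have "C \<oplus>\<^bsub>E.B\<^esub> D = value_at {pt} (V \<inter> V') (map (\<lambda>(m, a). (mrestr M V (V \<inter> V') m, restr \<XX> {pt} {pt} a)) ms @
        map (\<lambda>(m, a). (mrestr M V' (V \<inter> V') m, restr \<XX> {pt} {pt} a)) ns) pt"
      using value_at_append[OF r1(1) r2(1), of pt] r1(2)[of pt] r2(2)[of pt] 1(2) 2(2)
      by (simp add: pullback_stalk_def)
    ultimately show ?case by blast
  qed
qed

lemma P_sections:
  assumes U: "is_open \<XX> U"
  shows "carrier (msections P U) = (\<Pi>\<^sub>E x\<in>U. carrier (PS x))"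
proof (intro equalityI subsetI)
  fix s assume "s \<in> carrier (msections P U)"
  then show "s \<in> (\<Pi>\<^sub>E x\<in>U. carrier (PS x))" by (simp add: pullback_sections_iff)
next
  fix s assume s: "s \<in> (\<Pi>\<^sub>E x\<in>U. carrier (PS x))"
  show "s \<in> carrier (msections P U)"
    unfolding pullback_sections_iff
  proof (intro conjI ballI s)
    fix x assume x: "x \<in> U"
    then have U': "U = {pt}" "x = pt" using U open_cases by auto
    obtain V ms where "local_data {pt} V ms" "s pt = value_at {pt} V ms pt"
      using PS_value[of "s pt"] s U' by auto
    then show "\<exists>W V ms. local_data W V ms \<and> x \<in> W \<and> W \<subseteq> U \<and> (\<forall>y\<in>W. s y = value_at W V ms y)"
      using U' by (intro exI[of _ "{pt}"] exI[of _ V] exI[of _ ms]) auto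
  qed
qed

lemma P_empty: "carrier (msections P {}) = {\<lambda>x. undefined}"
  using P_sections[of "{}"] by simp

end

text \<open>
  By \<open>P_sections\<close> the sections are all functions into the stalks, so the inverse can be taken pointwise.
\<close>

lemma one_point_pullback_iso:
  assumes "one_point_pullback \<XX> pt Y f M" and "one_point_pullback \<XX> pt Z g N"
    and hom: "module_hom (stalk \<XX> pt) (pullback_stalk \<XX> Y f M pt) (pullback_stalk \<XX> Z g N pt) (H pt)"
    and bij: "bij_betw (H pt) (carrier (pullback_stalk \<XX> Y f M pt)) (carrier (pullback_stalk \<XX> Z g N pt))"
  shows "sheaf_iso \<XX> (pullback \<XX> Y f M) (pullback \<XX> Z g N)
    (normalize_map \<XX> (pullback \<XX> Y f M) (\<lambda>U s. \<lambda>x\<in>U. H x (s x)))"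
proof -
  interpret A: one_point_pullback \<XX> pt Y f M by fact
  interpret B: one_point_pullback \<XX> pt Z g N by fact
  show ?thesis
  proof (rule A.sheaf_isoI[OF A.module_presheaf_P B.module_presheaf_P B.P_empty])
    fix U assume U: "is_open \<XX> U"
    have x: "x = pt" if "x \<in> U" for x using that U A.open_cases by auto
    show "module_hom (sections \<XX> U) (msections A.P U) (msections B.P U) (\<lambda>s. \<lambda>x\<in>U. H x (s x))"
      unfolding module_hom_def
    proof (intro conjI ballI funcsetI)
      fix s assume "s \<in> carrier (msections A.P U)"
      then show "(\<lambda>x\<in>U. H x (s x)) \<in> carrier (msections B.P U)"
        using hom x by (auto simp: A.P_sections[OF U] B.P_sections[OF U] module_hom_def)
    next
      fix s t assume st: "s \<in> carrier (msections A.P U)" "t \<in> carrier (msections A.P U)"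
      show "(\<lambda>x\<in>U. H x ((s \<oplus>\<^bsub>msections A.P U\<^esub> t) x)) =
        (\<lambda>x\<in>U. H x (s x)) \<oplus>\<^bsub>msections B.P U\<^esub> (\<lambda>x\<in>U. H x (t x))"
        unfolding A.P_simps B.P_simps
      proof (rule restrict_ext)
        fix y assume y: "y \<in> U"
        then have "s pt \<in> carrier (A.PS pt)" "t pt \<in> carrier (A.PS pt)"
          using st A.P_closed_at x by blast+
        then show "H y ((\<lambda>x\<in>U. s x \<oplus>\<^bsub>A.PS x\<^esub> t x) y) = restrict (\<lambda>x. H x (s x)) U y \<oplus>\<^bsub>B.PS y\<^esub> restrict (\<lambda>x. H x (t x)) U y"
          using hom y x[OF y] by (simp add: module_hom_def)
      qed
    next
      fix a s assume as: "a \<in> carrier (sections \<XX> U)" "s \<in> carrier (msections A.P U)"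
      show "(\<lambda>x\<in>U. H x ((a \<odot>\<^bsub>msections A.P U\<^esub> s) x)) =
        a \<odot>\<^bsub>msections B.P U\<^esub> (\<lambda>x\<in>U. H x (s x))"
        unfolding A.P_simps B.P_simps
      proof (rule restrict_ext)
        fix y assume y: "y \<in> U"
        then have "s pt \<in> carrier (A.PS pt)" "rgerm \<XX> pt U a \<in> carrier (stalk \<XX> pt)"
          using as A.P_closed_at A.rgerm_closed[OF U] x by blast+
        then show "H y ((\<lambda>x\<in>U. rgerm \<XX> x U a \<odot>\<^bsub>A.PS x\<^esub> s x) y) = rgerm \<XX> y U a \<odot>\<^bsub>B.PS y\<^esub> restrict (\<lambda>x. H x (s x)) U y"
          using hom y x[OF y] by (simp add: module_hom_def)
      qed
    qed
    have k: "inv_into (carrier (A.PS x)) (H x) (H x c) = c" if "x \<in> U" "c \<in> carrier (A.PS x)" for x c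
      using bij x[OF that(1)] that(2) by (simp add: bij_betw_def inv_into_f_f)
    have k': "H x (inv_into (carrier (A.PS x)) (H x) c) = c" "inv_into (carrier (A.PS x)) (H x) c \<in> carrier (A.PS x)"
      if "x \<in> U" "c \<in> carrier (B.PS x)" for x c
      using bij x[OF that(1)] that(2) by (simp_all add: bij_betw_def f_inv_into_f inv_into_into)
    have k'': "H x c \<in> carrier (B.PS x)" if "x \<in> U" "c \<in> carrier (A.PS x)" for x c
      using bij x[OF that(1)] that(2) by (auto simp: bij_betw_def)
    show "bij_betw (\<lambda>s. \<lambda>x\<in>U. H x (s x)) (carrier (msections A.P U)) (carrier (msections B.P U))"
    proof (rule bij_betw_byWitness[where f' = "\<lambda>t. \<lambda>x\<in>U. inv_into (carrier (A.PS x)) (H x) (t x)"])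
      show "\<forall>s\<in>carrier (msections A.P U). (\<lambda>x\<in>U. inv_into (carrier (A.PS x)) (H x) ((\<lambda>x\<in>U. H x (s x)) x)) = s"
      proof
        fix s assume s: "s \<in> carrier (msections A.P U)"
        show "(\<lambda>x\<in>U. inv_into (carrier (A.PS x)) (H x) ((\<lambda>x\<in>U. H x (s x)) x)) = s"
          by (rule extensionalityI[of _ U])
            (use s in \<open>simp_all add: A.P_sections[OF U] PiE_mem PiE_def k Pi_iff\<close>)
      qed
      show "\<forall>t\<in>carrier (msections B.P U). (\<lambda>x\<in>U. H x ((\<lambda>x\<in>U. inv_into (carrier (A.PS x)) (H x) (t x)) x)) = t"
      proof
        fix s assume s: "s \<in> carrier (msections B.P U)"
        show "(\<lambda>x\<in>U. H x ((\<lambda>x\<in>U. inv_into (carrier (A.PS x)) (H x) (s x)) x)) = s"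
          by (rule extensionalityI[of _ U])
            (use s in \<open>simp_all add: B.P_sections[OF U] PiE_mem PiE_def k' Pi_iff\<close>)
      qed
    qed (auto simp: A.P_sections[OF U] B.P_sections[OF U] intro!: k' k'' dest: PiE_mem)
  qed
qed

lemma pullback_comp_iso:
  assumes "one_point \<XX> pt" and f: "rs_map \<XX> Y f" and g: "rs_map Y Z g" and M: "module_presheaf Z M"
  shows "sheaf_iso \<XX> (pullback \<XX> Z (comp_morphism Y g f) M) (pullback \<XX> Y f (pullback Y Z g M))
    (pullback_comp \<XX> Y Z f g M)"
proof -
  interpret one_point \<XX> pt by fact
  interpret f: rs_map \<XX> Y f by fact
  interpret g: rs_map Y Z g by fact
  interpret M: module_presheaf Z M by fact
  interpret gM: module_pullback Y Z g M ..
  interpret fgM: one_point_pullback \<XX> pt Y f "pullback Y Z g M" ..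
  interpret h: rs_map \<XX> Z "comp_morphism Y g f" by (rule rs_map_comp) fact+
  interpret hM: one_point_pullback \<XX> pt Z "comp_morphism Y g f" M ..
  have pt: "pt \<in> points \<XX>" by (simp add: points_eq)
  show ?thesis
    unfolding pullback_comp_def
    by (rule one_point_pullback_iso[OF hM.one_point_pullback_axioms fgM.one_point_pullback_axioms,
          where H = "\<lambda>x. base_change_map (stalk Y (base f x)) (mstalk Y gM.P (base f x)) (stalk \<XX> x)
            (stalk_map \<XX> Y f x) (\<lambda>C. \<Union>(V, m)\<in>C. mgerm Y gM.P (base f x) (preimage Y g V) (gM.unit V m))"])
      (rule pullback_comp_stalk[OF f g M pt])+
qed

lemma pullback_map_iso:
  assumes "one_point \<XX> pt" and f: "rs_map \<XX> Y f" and M: "module_presheaf Y M" and N: "module_presheaf Y N"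
    and \<phi>: "sheaf_iso Y M N \<phi>"
  shows "sheaf_iso \<XX> (pullback \<XX> Y f M) (pullback \<XX> Y f N) (pullback_map \<XX> Y f M N \<phi>)"
proof -
  interpret one_point \<XX> pt by fact
  interpret f: rs_map \<XX> Y f by fact
  interpret M: module_presheaf Y M by fact
  interpret N: module_presheaf Y N by fact
  interpret fM: one_point_pullback \<XX> pt Y f M ..
  interpret fN: one_point_pullback \<XX> pt Y f N ..
  have pt: "pt \<in> points \<XX>" by (simp add: points_eq)
  note m = mstalk_map_iso[OF M N \<phi> f.base_points[OF pt]]
  note H = base_change_map_bij[OF fM.extension[OF pt] fN.extension[OF pt] m]
  show ?thesis
    unfolding pullback_map_def
    by (rule one_point_pullback_iso[OF fM.one_point_pullback_axioms fN.one_point_pullback_axioms,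
          where H = "\<lambda>x. base_change_map (stalk Y (base f x)) (mstalk Y N (base f x)) (stalk \<XX> x)
            (stalk_map \<XX> Y f x) (mstalk_map Y N \<phi> (base f x))"])
      (rule H[folded pullback_stalk_def])+
qed

section \<open>Descent along a twist of a one-point space\<close>

text \<open>
  An automorphism of the ringed space which fixes the point, modelled on the Frobenius of \<open>Spec k\<close>.
\<close>

locale one_point_twist = one_point \<XX> pt + rs_map \<XX> \<XX> F
  for \<XX> :: "('x, 'a) ringed_space" and pt :: 'x and F :: "('x, 'a, 'x, 'a) space_map" +
  assumes base_F: "base F = (\<lambda>x. x)"
    and sharp_bij: "is_open \<XX> U \<Longrightarrow> bij_betw (sharp F U) (carrier (sections \<XX> U)) (carrier (sections \<XX> U))"
begin

lemma preimage_F: "is_open \<XX> U \<Longrightarrow> preimage \<XX> F U = U"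
  using openin_subset[of "top_space \<XX>" U] by (auto simp: preimage_def base_F)

lemma stalk_map_bij: "bij_betw (stalk_map \<XX> \<XX> F pt) (carrier (stalk \<XX> pt)) (carrier (stalk \<XX> pt))"
proof -
  have pt: "pt \<in> points \<XX>" by (simp add: points_eq)
  have g: "bij_betw (rgerm \<XX> pt {pt}) (carrier (sections \<XX> {pt})) (carrier (stalk \<XX> pt))"
    unfolding stalk_carrier by (rule germ_bij[OF open_pt]) auto
  have "bij_betw (rgerm \<XX> pt {pt} \<circ> sharp F {pt} \<circ> inv_into (carrier (sections \<XX> {pt})) (rgerm \<XX> pt {pt}))
      (carrier (stalk \<XX> pt)) (carrier (stalk \<XX> pt))"
    by (rule bij_betw_trans[OF bij_betw_inv_into[OF g] bij_betw_trans[OF sharp_bij[OF open_pt] g]])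
  moreover have "(rgerm \<XX> pt {pt} \<circ> sharp F {pt} \<circ> inv_into (carrier (sections \<XX> {pt})) (rgerm \<XX> pt {pt})) c =
      stalk_map \<XX> \<XX> F pt c" if c: "c \<in> carrier (stalk \<XX> pt)" for c
  proof -
    obtain s where s: "s \<in> carrier (sections \<XX> {pt})" "c = rgerm \<XX> pt {pt} s"
      using g c unfolding bij_betw_def by auto
    have "stalk_map \<XX> \<XX> F pt c = rgerm \<XX> pt {pt} (sharp F {pt} s)"
      using stalk_map_germ[OF pt open_pt _ s(1)] s by (simp add: base_F preimage_F open_pt)
    moreover have "inv_into (carrier (sections \<XX> {pt})) (rgerm \<XX> pt {pt}) c = s"
      using g s by (simp add: bij_betw_def inv_into_f_f)
    ultimately show ?thesis by simp
  qed
  ultimately show ?thesis by (rule bij_betw_cong[THEN iffD1, rotated])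
qed

text \<open>
  Over the point the unit is the composite of \<open>m \<mapsto> m\<^bsub>pt\<^esub>\<close>, \<open>c \<mapsto> c \<otimes> 1\<close> and the identification of an element of
  the stalk with a section; all three are bijective.
\<close>

lemma unit_bij:
  assumes N: "module_presheaf \<XX> N" and empty: "carrier (msections N {}) = {z}" and U: "is_open \<XX> U"
  shows "bij_betw (pullback_unit \<XX> \<XX> F N U) (carrier (msections N U)) (carrier (msections (pullback \<XX> \<XX> F N) U))"
proof -
  interpret N: module_presheaf \<XX> N by fact
  interpret P: one_point_pullback \<XX> pt \<XX> F N ..
  have pt: "pt \<in> points \<XX>" by (simp add: points_eq)
  consider "U = {}" | "U = {pt}" using U open_cases by auto
  then show ?thesis
  proof cases
    case 1
    then show ?thesis
      using P.unit_closed[OF U, of z] empty preimage_F[OF U] by (simp add: P.P_empty bij_betw_def)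
  next
    case 2
    note ext = P.extension[OF pt, unfolded base_F]
    have "bij_betw (mgerm \<XX> N pt {pt}) (carrier (msections N {pt})) (carrier (mstalk \<XX> N pt))"
      unfolding N.mstalk_carrier by (rule N.m.germ_bij[OF open_pt]) auto
    moreover have "bij_betw (\<lambda>m. P.pten pt m \<one>\<^bsub>stalk \<XX> pt\<^esub>) (carrier (mstalk \<XX> N pt)) (carrier (P.PS pt))"
      using scalar_extension.bij_betw_unit[OF ext stalk_map_bij] by (simp add: pullback_stalk_def base_F)
    moreover have "bij_betw (\<lambda>c. \<lambda>x\<in>{pt}. c) (carrier (P.PS pt)) (carrier (msections P.P {pt}))"
      by (rule bij_betw_byWitness[where f' = "\<lambda>s. s pt"])
        (auto simp: P.P_sections[OF open_pt] PiE_def extensional_def fun_eq_iff)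
    ultimately have "bij_betw ((\<lambda>c. \<lambda>x\<in>{pt}. c) \<circ> ((\<lambda>m. P.pten pt m \<one>\<^bsub>stalk \<XX> pt\<^esub>) \<circ> mgerm \<XX> N pt {pt}))
        (carrier (msections N {pt})) (carrier (msections P.P {pt}))"
      by (blast intro: bij_betw_trans)
    moreover have "(\<lambda>c. \<lambda>x\<in>{pt}. c) \<circ> ((\<lambda>m. P.pten pt m \<one>\<^bsub>stalk \<XX> pt\<^esub>) \<circ> mgerm \<XX> N pt {pt}) = pullback_unit \<XX> \<XX> F N {pt}"
      by (auto simp: fun_eq_iff pullback_unit_def preimage_F open_pt pullback_class_def pure_tensor_def base_F)
    ultimately show ?thesis using 2 by simp
  qed
qed

text \<open>
  Naturality of the unit. As the unit is bijective, this determines \<open>F\<^sup>*\<psi>\<close> completely.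
\<close>

lemma pullback_map_unit:
  assumes M: "module_presheaf \<XX> M" and N: "module_presheaf \<XX> N" and \<psi>: "sheaf_iso \<XX> M N \<psi>"
    and U: "is_open \<XX> U" and m: "m \<in> carrier (msections M U)"
  shows "pullback_map \<XX> \<XX> F M N \<psi> U (pullback_unit \<XX> \<XX> F M U m) = pullback_unit \<XX> \<XX> F N U (\<psi> U m)"
proof -
  interpret M: module_presheaf \<XX> M by fact
  interpret N: module_presheaf \<XX> N by fact
  interpret P: one_point_pullback \<XX> pt \<XX> F M ..
  interpret Q: one_point_pullback \<XX> pt \<XX> F N ..
  have u: "pullback_unit \<XX> \<XX> F M U m \<in> carrier (msections P.P U)"
    using P.unit_closed[OF U m] by (simp add: preimage_F U)
  have "pullback_map \<XX> \<XX> F M N \<psi> U (pullback_unit \<XX> \<XX> F M U m) = (\<lambda>x\<in>U.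
       base_change_map (stalk \<XX> (base F x)) (mstalk \<XX> N (base F x)) (stalk \<XX> x)
         (stalk_map \<XX> \<XX> F x) (mstalk_map \<XX> N \<psi> (base F x)) (pullback_unit \<XX> \<XX> F M U m x))"
    by (simp add: pullback_map_def normalize_map_apply[OF U u])
  also have "\<dots> = (\<lambda>x\<in>U. pullback_unit \<XX> \<XX> F N U (\<psi> U m) x)"
  proof (rule restrict_ext)
    fix x assume x: "x \<in> U"
    have x': "x \<in> points \<XX>" using x openin_subset[OF U] by auto
    note i = mstalk_map_iso(1)[OF M N \<psi> base_points[OF x']]
    have "base_change_map (stalk \<XX> (base F x)) (mstalk \<XX> N (base F x)) (stalk \<XX> x)
         (stalk_map \<XX> \<XX> F x) (mstalk_map \<XX> N \<psi> (base F x))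
         (P.pten x (mgerm \<XX> M (base F x) U m) \<one>\<^bsub>stalk \<XX> x\<^esub>) =
       Q.pten x (mstalk_map \<XX> N \<psi> (base F x) (mgerm \<XX> M (base F x) U m)) \<one>\<^bsub>stalk \<XX> x\<^esub>"
      by (rule base_change_map_semilinear(2)[OF P.extension[OF x'] Q.extension[OF x'], of _ "\<lambda>a. a"])
        (use i x U m cring_stalk[OF x'] in \<open>auto simp: module_hom_def base_F M.mgerm_closed cring.cring_simprules\<close>)
    also have "mstalk_map \<XX> N \<psi> (base F x) (mgerm \<XX> M (base F x) U m) = mgerm \<XX> N (base F x) U (\<psi> U m)"
      by (rule mstalk_map_germ[OF M N sheaf_isoD(1)[OF \<psi>] U _ m]) (simp add: base_F x)
    finally show "base_change_map (stalk \<XX> (base F x)) (mstalk \<XX> N (base F x)) (stalk \<XX> x)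
         (stalk_map \<XX> \<XX> F x) (mstalk_map \<XX> N \<psi> (base F x)) (pullback_unit \<XX> \<XX> F M U m x) =
       pullback_unit \<XX> \<XX> F N U (\<psi> U m) x"
      using x U by (simp add: P.unit_at Q.unit_at preimage_F)
  qed
  also have "\<dots> = pullback_unit \<XX> \<XX> F N U (\<psi> U m)"
    by (auto simp: pullback_unit_def preimage_F[OF U] intro!: restrict_ext)
  finally show ?thesis .
qed

text \<open>
  The map \<open>u\<^sup>-\<^sup>1 \<circ> \<gamma> \<circ> u\<close> is linear because
  \<open>\<gamma> (u (a m)) = \<gamma> (F\<^sup>#(a) u m) = F\<^sup>#(a) \<gamma> (u m)\<close>.
\<close>

theorem pullback_descent:
  assumes M: "module_presheaf \<XX> M" and N: "module_presheaf \<XX> N"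
    and M0: "carrier (msections M {}) = {z}" and N0: "carrier (msections N {}) = {w}"
    and \<gamma>: "sheaf_iso \<XX> (pullback \<XX> \<XX> F M) (pullback \<XX> \<XX> F N) \<gamma>"
  shows "\<exists>!\<psi>. sheaf_iso \<XX> M N \<psi> \<and> pullback_map \<XX> \<XX> F M N \<psi> = \<gamma>"
proof -
  interpret M: module_presheaf \<XX> M by fact
  interpret N: module_presheaf \<XX> N by fact
  interpret P: one_point_pullback \<XX> pt \<XX> F M ..
  interpret Q: one_point_pullback \<XX> pt \<XX> F N ..
  note u = unit_bij[OF M M0] and v = unit_bij[OF N N0]
  have u_closed: "P.unit U m \<in> carrier (msections P.P U)" if "is_open \<XX> U" "m \<in> carrier (msections M U)" for U m
    using u that by (auto intro: bij_betw_apply)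
  have v_closed: "Q.unit U m \<in> carrier (msections Q.P U)" if "is_open \<XX> U" "m \<in> carrier (msections N U)" for U m
    using v that by (auto intro: bij_betw_apply)
  define v' where "v' U = inv_into (carrier (msections N U)) (Q.unit U)" for U
  have v': "v' U s \<in> carrier (msections N U)" "Q.unit U (v' U s) = s" if "is_open \<XX> U" "s \<in> carrier (msections Q.P U)" for U s
    using v[OF that(1)] that(2) unfolding v'_def bij_betw_def by (auto simp: inv_into_into f_inv_into_f)
  have v'_unit: "v' U (Q.unit U n) = n" if "is_open \<XX> U" "n \<in> carrier (msections N U)" for U n
    using v[OF that(1)] that(2) unfolding v'_def bij_betw_def by (simp add: inv_into_f_f)
  have v'_bij: "bij_betw (v' U) (carrier (msections Q.P U)) (carrier (msections N U))" if "is_open \<XX> U" for U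
    unfolding v'_def by (rule bij_betw_inv_into[OF v[OF that]])
  note g = sheaf_isoD[OF \<gamma>]
  \<comment> \<open>The only candidate, \<open>u\<^sup>-\<^sup>1 \<circ> \<gamma> \<circ> u\<close>.\<close>
  define \<psi>0 where "\<psi>0 U m = v' U (\<gamma> U (P.unit U m))" for U m
  have \<psi>0: "\<psi>0 U m \<in> carrier (msections N U)" "Q.unit U (\<psi>0 U m) = \<gamma> U (P.unit U m)"
    if "is_open \<XX> U" "m \<in> carrier (msections M U)" for U m
    using that by (simp_all add: \<psi>0_def v' u_closed g(5))
  have iso: "sheaf_iso \<XX> M N (normalize_map \<XX> M \<psi>0)"
  proof (rule sheaf_isoI[OF M N N0])
    fix U assume U: "is_open \<XX> U"
    have "bij_betw (v' U \<circ> (\<gamma> U \<circ> P.unit U)) (carrier (msections M U)) (carrier (msections N U))"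
      using u[OF U] g(4)[OF U] v'_bij[OF U] by (blast intro: bij_betw_trans)
    then show "bij_betw (\<psi>0 U) (carrier (msections M U)) (carrier (msections N U))"
      by (simp add: \<psi>0_def[abs_def] o_def)
    show "module_hom (sections \<XX> U) (msections M U) (msections N U) (\<psi>0 U)"
      unfolding module_hom_def
    proof (intro conjI ballI funcsetI \<psi>0(1)[OF U])
      fix m n assume mn: "m \<in> carrier (msections M U)" "n \<in> carrier (msections M U)"
      have "\<gamma> U (P.unit U (m \<oplus>\<^bsub>msections M U\<^esub> n)) = \<gamma> U (P.unit U m) \<oplus>\<^bsub>msections Q.P U\<^esub> \<gamma> U (P.unit U n)"
        using P.unit_add[OF U mn] g(3)[OF U] u_closed[OF U] mn by (simp add: preimage_F U module_hom_def)
      also have "\<dots> = Q.unit U (\<psi>0 U m \<oplus>\<^bsub>msections N U\<^esub> \<psi>0 U n)"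
        using Q.unit_add[OF U \<psi>0(1)[OF U mn(1)] \<psi>0(1)[OF U mn(2)]] \<psi>0(2)[OF U] mn by (simp add: preimage_F U)
      finally show "\<psi>0 U (m \<oplus>\<^bsub>msections M U\<^esub> n) = \<psi>0 U m \<oplus>\<^bsub>msections N U\<^esub> \<psi>0 U n"
        using v'_unit[OF U, of "\<psi>0 U m \<oplus>\<^bsub>msections N U\<^esub> \<psi>0 U n"] \<psi>0(1)[OF U] mn N.msections_closed[OF U]
        by (simp add: \<psi>0_def[of U "m \<oplus>\<^bsub>msections M U\<^esub> n"])
    next
      fix a m assume am: "a \<in> carrier (sections \<XX> U)" "m \<in> carrier (msections M U)"
      have sa: "sharp F U a \<in> carrier (sections \<XX> U)" using sharp_closed[OF U am(1)] by (simp add: preimage_F U)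
      have "\<gamma> U (P.unit U (a \<odot>\<^bsub>msections M U\<^esub> m)) = sharp F U a \<odot>\<^bsub>msections Q.P U\<^esub> \<gamma> U (P.unit U m)"
        using P.unit_smult[OF U am] g(3)[OF U] u_closed[OF U am(2)] sa by (simp add: preimage_F U module_hom_def)
      also have "\<dots> = Q.unit U (a \<odot>\<^bsub>msections N U\<^esub> \<psi>0 U m)"
        using Q.unit_smult[OF U am(1) \<psi>0(1)[OF U am(2)]] \<psi>0(2)[OF U am(2)] by (simp add: preimage_F U)
      finally show "\<psi>0 U (a \<odot>\<^bsub>msections M U\<^esub> m) = a \<odot>\<^bsub>msections N U\<^esub> \<psi>0 U m"
        using v'_unit[OF U, of "a \<odot>\<^bsub>msections N U\<^esub> \<psi>0 U m"] \<psi>0(1)[OF U am(2)] am N.msections_closed[OF U]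
        by (simp add: \<psi>0_def[of U "a \<odot>\<^bsub>msections M U\<^esub> m"])
    qed
  qed
  have norm: "normalize_map \<XX> P.P (pullback_map \<XX> \<XX> F M N \<psi>) = pullback_map \<XX> \<XX> F M N \<psi>" for \<psi>
    by (simp add: pullback_map_def normalize_map_idem)
  have "pullback_map \<XX> \<XX> F M N (normalize_map \<XX> M \<psi>0) = \<gamma>"
  proof (rule sheaf_map_eqI[OF norm g(2)])
    fix U s assume U: "is_open \<XX> U" and "s \<in> carrier (msections P.P U)"
    then obtain m where m: "m \<in> carrier (msections M U)" "s = P.unit U m"
      using u[OF U] unfolding bij_betw_def by auto
    then show "pullback_map \<XX> \<XX> F M N (normalize_map \<XX> M \<psi>0) U s = \<gamma> U s"
      by (simp add: pullback_map_unit[OF M N iso U] normalize_map_apply U \<psi>0)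
  qed
  moreover have "\<psi> = \<psi>'" if \<psi>: "sheaf_iso \<XX> M N \<psi>" and \<psi>': "sheaf_iso \<XX> M N \<psi>'"
    and eq: "pullback_map \<XX> \<XX> F M N \<psi> = \<gamma>" "pullback_map \<XX> \<XX> F M N \<psi>' = \<gamma>" for \<psi> \<psi>'
  proof (rule sheaf_map_eqI[OF sheaf_isoD(2)[OF \<psi>] sheaf_isoD(2)[OF \<psi>']])
    fix U m assume U: "is_open \<XX> U" and m: "m \<in> carrier (msections M U)"
    have "Q.unit U (\<psi> U m) = Q.unit U (\<psi>' U m)"
      using pullback_map_unit[OF M N \<psi> U m] pullback_map_unit[OF M N \<psi>' U m] eq by simp
    then show "\<psi> U m = \<psi>' U m"
      using v'_unit[OF U] sheaf_isoD(5)[OF \<psi> U m] sheaf_isoD(5)[OF \<psi>' U m] by metis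
  qed
  ultimately show ?thesis using iso by blast
qed

text \<open>
  Writing \<open>b = \<Sum>\<^sub>i b\<^sub>i e\<^sub>i\<close>, the unit sends \<open>b\<close> to \<open>\<Sum>\<^sub>i F\<^sup>#(b\<^sub>i) (e\<^sub>i \<otimes> 1)\<close>, which is the value of
  \<^const>\<open>pullback_free\<close> at \<open>(F\<^sup>#(b\<^sub>i))\<^sub>i\<close>. The partial sums correspond to the truncations \<open>t n\<close> of \<open>b\<close>.
\<close>

lemma pullback_free_unit:
  assumes U: "is_open \<XX> U" and b: "b \<in> carrier (msections (free_sheaf \<XX> r) U)"
  shows "pullback_free \<XX> \<XX> F r U (\<lambda>i\<in>{..<r}. sharp F U (b i)) = pullback_unit \<XX> \<XX> F (free_sheaf \<XX> r) U b"
proof -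
  let ?E = "free_sheaf \<XX> r"
  interpret E: module_presheaf \<XX> ?E by (rule free_sheaf_presheaf)
  interpret P: one_point_pullback \<XX> pt \<XX> F ?E ..
  interpret C: cring "sections \<XX> U" by (rule cring_sections[OF U])
  interpret PU: module "sections \<XX> U" "msections P.P U" by (rule P.module_P[OF U])
  have sub: "U \<subseteq> points \<XX>" by (rule openin_subset[OF U])
  have p: "is_open \<XX> (points \<XX>)" by simp
  let ?one = "\<one>\<^bsub>sections \<XX> (points \<XX>)\<^esub>" and ?zero = "\<zero>\<^bsub>sections \<XX> (points \<XX>)\<^esub>"
  define e where "e i = (\<lambda>j\<in>{..<r}. if j = i then ?one else ?zero)" for i
  have e: "e i \<in> carrier (msections ?E (points \<XX>))" for i
    using cring_sections[OF p] by (auto simp: e_def free_sheaf_def cring.cring_simprules)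
  define eU where "eU i = mrestr ?E (points \<XX>) U (e i)" for i
  have eU: "eU i \<in> carrier (msections ?E U)" for i
    unfolding eU_def by (rule E.mrestr_closed[OF p U sub e])
  have eU_apply: "eU i j = (if j = i then \<one>\<^bsub>sections \<XX> U\<^esub> else \<zero>\<^bsub>sections \<XX> U\<^esub>)" if "j < r" for i j
  proof -
    have "restr \<XX> (points \<XX>) U ?one = \<one>\<^bsub>sections \<XX> U\<^esub>" by (rule ring_hom_one[OF restr_hom[OF p U sub]])
    moreover have "restr \<XX> (points \<XX>) U ?zero = \<zero>\<^bsub>sections \<XX> U\<^esub>"
      by (rule ring_hom_zero[OF restr_hom[OF p U sub]])
        (use cring_sections[OF p] C.is_cring in \<open>auto intro: cring.axioms\<close>)
    ultimately show ?thesis using that by (simp add: eU_def e_def free_sheaf_def)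
  qed
  have unit_e: "mrestr P.P (points \<XX>) U (P.unit (points \<XX>) (e i)) = P.unit U (eU i)" for i
  proof -
    have "P.unit (points \<XX>) (e i) x = P.unit U (eU i) x" if x: "x \<in> U" for x
      using x sub U p E.m.germ_restrict[OF p U _ sub e, of x i]
      by (subst P.unit_at, (simp add: preimage_F subset_iff)?)+ (auto simp: base_F eU_def)
    then show ?thesis
      using sub by (auto simp: P.P_simps fun_eq_iff pullback_unit_def preimage_F U p subset_iff)
  qed
  have bi: "b i \<in> carrier (sections \<XX> U)" if "i < r" for i using b that by (auto simp: free_sheaf_def)
  have sb: "sharp F U (b i) \<in> carrier (sections \<XX> U)" if "i < r" for i
    using sharp_closed[OF U bi[OF that]] by (simp add: preimage_F U)
  have ue: "P.unit U (eU i) \<in> carrier (msections P.P U)" for i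
    using P.unit_closed[OF U eU] by (simp add: preimage_F U)
  define t where "t n = (\<lambda>j\<in>{..<r}. if j < n then b j else \<zero>\<^bsub>sections \<XX> U\<^esub>)" for n
  have t: "t n \<in> carrier (msections ?E U)" for n
    using bi by (auto simp: t_def free_sheaf_def)
  have "(\<Oplus>\<^bsub>msections P.P U\<^esub>i\<in>{..<n}. sharp F U (b i) \<odot>\<^bsub>msections P.P U\<^esub> P.unit U (eU i)) = P.unit U (t n)"
    if "n \<le> r" for n
    using that
  proof (induction n)
    case 0
    interpret EU: module "sections \<XX> U" "msections ?E U" by (rule E.module_sections[OF U])
    have "t 0 = \<zero>\<^bsub>msections ?E U\<^esub>" by (simp add: t_def free_sheaf_def)
    moreover have "P.unit U \<zero>\<^bsub>msections ?E U\<^esub> = \<zero>\<^bsub>msections P.P U\<^esub>"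
    proof -
      have c: "P.unit U \<zero>\<^bsub>msections ?E U\<^esub> \<in> carrier (msections P.P U)"
        using P.unit_closed[OF U, of "\<zero>\<^bsub>msections ?E U\<^esub>"] by (simp add: preimage_F U)
      have "P.unit U \<zero>\<^bsub>msections ?E U\<^esub> \<oplus>\<^bsub>msections P.P U\<^esub> P.unit U \<zero>\<^bsub>msections ?E U\<^esub> = P.unit U \<zero>\<^bsub>msections ?E U\<^esub>"
        using P.unit_add[OF U, of "\<zero>\<^bsub>msections ?E U\<^esub>" "\<zero>\<^bsub>msections ?E U\<^esub>"] by (simp add: preimage_F U)
      then show ?thesis using c by (simp only: PU.M.add.l_cancel_one)
    qed
    ultimately show ?case by simp
  next
    case (Suc n)
    then have n: "n < r" by simp
    have "t (Suc n) = b n \<odot>\<^bsub>msections ?E U\<^esub> eU n \<oplus>\<^bsub>msections ?E U\<^esub> t n"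
      using n bi by (auto simp: t_def free_sheaf_def fun_eq_iff less_Suc_eq eU_apply)
    then have "P.unit U (t (Suc n)) = sharp F U (b n) \<odot>\<^bsub>msections P.P U\<^esub> P.unit U (eU n) \<oplus>\<^bsub>msections P.P U\<^esub> P.unit U (t n)"
      using P.unit_add[OF U _ t, of "b n \<odot>\<^bsub>msections ?E U\<^esub> eU n" n] P.unit_smult[OF U bi[OF n] eU[of n]]
        E.msections_closed(2)[OF U bi[OF n] eU[of n]] by (simp add: preimage_F U)
    moreover have "(\<Oplus>\<^bsub>msections P.P U\<^esub>i\<in>{..<Suc n}. sharp F U (b i) \<odot>\<^bsub>msections P.P U\<^esub> P.unit U (eU i)) =
      sharp F U (b n) \<odot>\<^bsub>msections P.P U\<^esub> P.unit U (eU n) \<oplus>\<^bsub>msections P.P U\<^esub>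
      (\<Oplus>\<^bsub>msections P.P U\<^esub>i\<in>{..<n}. sharp F U (b i) \<odot>\<^bsub>msections P.P U\<^esub> P.unit U (eU i))"
      unfolding lessThan_Suc
      by (rule PU.finsum_insert) (use n sb ue in \<open>auto intro!: PU.smult_closed\<close>)
    ultimately show ?case using Suc by simp
  qed
  from this[of r] have sum: "(\<Oplus>\<^bsub>msections P.P U\<^esub>i\<in>{..<r}. sharp F U (b i) \<odot>\<^bsub>msections P.P U\<^esub> P.unit U (eU i)) = P.unit U (t r)"
    by simp
  have tr: "t r = b" using b by (auto simp: t_def free_sheaf_def fun_eq_iff PiE_def extensional_def)
  have sbc: "(\<lambda>i\<in>{..<r}. sharp F U (b i)) \<in> carrier (msections ?E U)" using sb by (simp add: free_sheaf_def)
  have "pullback_free \<XX> \<XX> F r U (\<lambda>i\<in>{..<r}. sharp F U (b i)) =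
      (\<Oplus>\<^bsub>msections P.P U\<^esub>i\<in>{..<r}. (\<lambda>i\<in>{..<r}. sharp F U (b i)) i \<odot>\<^bsub>msections P.P U\<^esub> P.unit U (eU i))"
    unfolding pullback_free_def Let_def
    by (subst normalize_map_apply[OF U sbc]) (simp only: e_def[symmetric] unit_e)
  also have "\<dots> = (\<Oplus>\<^bsub>msections P.P U\<^esub>i\<in>{..<r}. sharp F U (b i) \<odot>\<^bsub>msections P.P U\<^esub> P.unit U (eU i))"
    by (rule PU.finsum_cong') (use sb ue in \<open>auto intro!: PU.smult_closed\<close>)
  finally show ?thesis by (simp only: sum tr)
qed

text \<open>
  By \<open>pullback_free_unit\<close> the map is the unit after coordinatewise \<open>(F\<^sup>#)\<^sup>-\<^sup>1\<close>; both are bijective, and their twists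
  of the scalar action cancel.
\<close>

lemma pullback_free_iso: "sheaf_iso \<XX> (free_sheaf \<XX> r) (pullback \<XX> \<XX> F (free_sheaf \<XX> r)) (pullback_free \<XX> \<XX> F r)"
proof -
  let ?E = "free_sheaf \<XX> r"
  have E': "module_presheaf \<XX> ?E" by (rule free_sheaf_presheaf)
  interpret E: module_presheaf \<XX> ?E by (rule E')
  interpret P: one_point_pullback \<XX> pt \<XX> F ?E ..
  obtain z where z: "carrier (msections ?E {}) = {z}" using free_sheaf_empty by blast
  define root where "root U = inv_into (carrier (sections \<XX> U)) (sharp F U)" for U
  have root: "root U a \<in> carrier (sections \<XX> U)" "sharp F U (root U a) = a"
    if "is_open \<XX> U" "a \<in> carrier (sections \<XX> U)" for U a
    using sharp_bij[OF that(1)] that(2) unfolding root_def bij_betw_def by (auto simp: inv_into_into f_inv_into_f)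
  have root_sharp: "root U (sharp F U a) = a" if "is_open \<XX> U" "a \<in> carrier (sections \<XX> U)" for U a
    using sharp_bij[OF that(1)] that(2) unfolding root_def bij_betw_def by (simp add: inv_into_f_f)
  define R where "R U a = (\<lambda>i\<in>{..<r}. root U (a i))" for U a
  have R: "R U a \<in> carrier (msections ?E U)" if "is_open \<XX> U" "a \<in> carrier (msections ?E U)" for U a
  proof -
    have "a i \<in> carrier (sections \<XX> U)" if "i < r" for i
      using \<open>a \<in> carrier (msections ?E U)\<close> that by (auto simp: free_sheaf_def)
    then show ?thesis using root(1)[OF \<open>is_open \<XX> U\<close>] by (simp add: R_def free_sheaf_def)
  qed
  have free: "pullback_free \<XX> \<XX> F r U a = P.unit U (R U a)" if U: "is_open \<XX> U" and a: "a \<in> carrier (msections ?E U)" for U a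
  proof -
    have "(\<lambda>i\<in>{..<r}. sharp F U (R U a i)) = a"
      by (rule extensionalityI[of _ "{..<r}"]) (use a in \<open>simp_all add: R_def free_sheaf_mem root[OF U]\<close>)
    then show ?thesis using pullback_free_unit[OF U R[OF U a]] by simp
  qed
  have "sheaf_iso \<XX> ?E P.P (normalize_map \<XX> ?E (\<lambda>U a. P.unit U (R U a)))"
  proof (rule sheaf_isoI[OF E' P.module_presheaf_P P.P_empty])
    fix U assume U: "is_open \<XX> U"
    have sc: "sharp F U a \<in> carrier (sections \<XX> U)" if "a \<in> carrier (sections \<XX> U)" for a
      using sharp_closed[OF U that] by (simp add: preimage_F U)
    have "bij_betw (R U) (carrier (msections ?E U)) (carrier (msections ?E U))"
    proof (rule bij_betw_byWitness[where f' = "\<lambda>b. \<lambda>i\<in>{..<r}. sharp F U (b i)"])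
      show "\<forall>a\<in>carrier (msections ?E U). (\<lambda>i\<in>{..<r}. sharp F U (R U a i)) = a"
        by (intro ballI extensionalityI[of _ "{..<r}"]) (simp_all add: R_def free_sheaf_mem root[OF U])
      show "\<forall>b\<in>carrier (msections ?E U). R U (\<lambda>i\<in>{..<r}. sharp F U (b i)) = b"
        by (intro ballI extensionalityI[of _ "{..<r}"]) (simp_all add: R_def free_sheaf_mem root_sharp[OF U])
      show "R U ` carrier (msections ?E U) \<subseteq> carrier (msections ?E U)" using R[OF U] by auto
      show "(\<lambda>b. \<lambda>i\<in>{..<r}. sharp F U (b i)) ` carrier (msections ?E U) \<subseteq> carrier (msections ?E U)"
        using sc by (auto simp: free_sheaf_mem)
    qed
    then have "bij_betw (P.unit U \<circ> R U) (carrier (msections ?E U)) (carrier (msections P.P U))"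
      by (rule bij_betw_trans[OF _ unit_bij[OF E' z U]])
    then show "bij_betw (\<lambda>a. P.unit U (R U a)) (carrier (msections ?E U)) (carrier (msections P.P U))"
      by (simp add: o_def)
    have h: "sharp F U \<in> ring_hom (sections \<XX> U) (sections \<XX> U)" using sharp_hom[OF U] by (simp add: preimage_F U)
    interpret C: cring "sections \<XX> U" by (rule cring_sections[OF U])
    have root_add: "root U (a \<oplus>\<^bsub>sections \<XX> U\<^esub> b) = root U a \<oplus>\<^bsub>sections \<XX> U\<^esub> root U b"
      if "a \<in> carrier (sections \<XX> U)" "b \<in> carrier (sections \<XX> U)" for a b
      using root_sharp[OF U, of "root U a \<oplus>\<^bsub>sections \<XX> U\<^esub> root U b"] ring_hom_add[OF h, of "root U a" "root U b"]
        root[OF U] that by simp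
    have root_mult: "root U (a \<otimes>\<^bsub>sections \<XX> U\<^esub> b) = root U a \<otimes>\<^bsub>sections \<XX> U\<^esub> root U b"
      if "a \<in> carrier (sections \<XX> U)" "b \<in> carrier (sections \<XX> U)" for a b
      using root_sharp[OF U, of "root U a \<otimes>\<^bsub>sections \<XX> U\<^esub> root U b"] ring_hom_mult[OF h, of "root U a" "root U b"]
        root[OF U] that by simp
    show "module_hom (sections \<XX> U) (msections ?E U) (msections P.P U) (\<lambda>a. P.unit U (R U a))"
      unfolding module_hom_def
    proof (intro conjI ballI funcsetI)
      fix a assume "a \<in> carrier (msections ?E U)"
      then show "P.unit U (R U a) \<in> carrier (msections P.P U)"
        using P.unit_closed[OF U R[OF U]] by (simp add: preimage_F U)
    next
      fix a b assume ab: "a \<in> carrier (msections ?E U)" "b \<in> carrier (msections ?E U)"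
      have "R U (a \<oplus>\<^bsub>msections ?E U\<^esub> b) = R U a \<oplus>\<^bsub>msections ?E U\<^esub> R U b"
        unfolding R_def free_sheaf_simps by (rule restrict_ext) (use ab in \<open>simp add: free_sheaf_mem root_add\<close>)
      then show "P.unit U (R U (a \<oplus>\<^bsub>msections ?E U\<^esub> b)) = P.unit U (R U a) \<oplus>\<^bsub>msections P.P U\<^esub> P.unit U (R U b)"
        using P.unit_add[OF U R[OF U ab(1)] R[OF U ab(2)]] by (simp add: preimage_F U)
    next
      fix c a assume ca: "c \<in> carrier (sections \<XX> U)" "a \<in> carrier (msections ?E U)"
      have "R U (c \<odot>\<^bsub>msections ?E U\<^esub> a) = root U c \<odot>\<^bsub>msections ?E U\<^esub> R U a"
        unfolding R_def free_sheaf_simps by (rule restrict_ext) (use ca in \<open>simp add: free_sheaf_mem root_mult\<close>)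
      then show "P.unit U (R U (c \<odot>\<^bsub>msections ?E U\<^esub> a)) = c \<odot>\<^bsub>msections P.P U\<^esub> P.unit U (R U a)"
        using P.unit_smult[OF U root(1)[OF U ca(1)] R[OF U ca(2)]] root(2)[OF U ca(1)] by (simp add: preimage_F U)
    qed
  qed
  moreover have "normalize_map \<XX> ?E (\<lambda>U a. P.unit U (R U a)) = normalize_map \<XX> ?E (pullback_free \<XX> \<XX> F r)"
    by (rule normalize_map_cong) (simp add: free)
  moreover have "normalize_map \<XX> ?E (pullback_free \<XX> \<XX> F r) = pullback_free \<XX> \<XX> F r"
    by (simp add: pullback_free_def Let_def normalize_map_idem)
  ultimately show ?thesis by simp
qed

end

section \<open>The Frobenius map\<close>

lemma (in cring) binomial_ring:
  assumes a: "a \<in> carrier R" and b: "b \<in> carrier R"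
  shows "(a \<oplus> b) [^] (n::nat) = (\<Oplus>i\<in>{..n}. [(n choose i)] \<cdot>\<^bsub>R\<^esub> (a [^] i \<otimes> b [^] (n - i)))"
proof (induction n)
  case 0
  show ?case using a b by simp
next
  case (Suc n)
  define f where "f i = [(n choose i)] \<cdot>\<^bsub>R\<^esub> (a [^] i \<otimes> b [^] (n - i))" for i
  define u where "u i = [(n choose i)] \<cdot>\<^bsub>R\<^esub> (a [^] Suc i \<otimes> b [^] (n - i))" for i
  define v where "v i = [(n choose i)] \<cdot>\<^bsub>R\<^esub> (a [^] i \<otimes> b [^] (Suc n - i))" for i
  define t where "t i = [(Suc n choose i)] \<cdot>\<^bsub>R\<^esub> (a [^] i \<otimes> b [^] (Suc n - i))" for i
  have c [simp]: "f i \<in> carrier R" "u i \<in> carrier R" "v i \<in> carrier R" "t i \<in> carrier R" for i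
    using a b by (simp_all add: f_def u_def v_def t_def)
  have "(a \<oplus> b) [^] Suc n = finsum R f {..n} \<otimes> a \<oplus> finsum R f {..n} \<otimes> b"
    using a b Suc by (simp add: f_def[abs_def] r_distr)
  also have "finsum R f {..n} \<otimes> a = finsum R u {..n}"
    using a b by (subst finsum_ldistr)
      (auto intro!: finsum_cong' simp: f_def u_def add_pow_ldistr add_pow_rdistr m_ac)
  also have "finsum R f {..n} \<otimes> b = finsum R v {..n}"
    using a b by (subst finsum_ldistr)
      (auto intro!: finsum_cong' simp: f_def v_def add_pow_ldistr m_assoc Suc_diff_le)
  also have "finsum R v {..n} = finsum R (\<lambda>i. v (Suc i)) {..n} \<oplus> v 0"
  proof -
    have "v (Suc n) = \<zero>" using a b by (simp add: v_def binomial_eq_0)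
    then have "finsum R v {..Suc n} = finsum R v {..n}" by (subst finsum_Suc) auto
    then show ?thesis using finsum_Suc2[of v n] by simp
  qed
  also have "finsum R u {..n} \<oplus> (finsum R (\<lambda>i. v (Suc i)) {..n} \<oplus> v 0) =
      finsum R (\<lambda>i. u i \<oplus> v (Suc i)) {..n} \<oplus> v 0"
    by (subst finsum_addf) (auto simp: a_assoc)
  also have "finsum R (\<lambda>i. u i \<oplus> v (Suc i)) {..n} = finsum R (\<lambda>i. t (Suc i)) {..n}"
    using a b by (intro finsum_cong') (auto simp: u_def v_def t_def add.nat_pow_mult)
  also have "v 0 = t 0" by (simp add: v_def t_def)
  also have "finsum R (\<lambda>i. t (Suc i)) {..n} \<oplus> t 0 = finsum R t {..Suc n}"
    by (rule finsum_Suc2[symmetric]) auto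
  finally show ?case by (simp only: t_def[abs_def])
qed

text \<open>
  The inner binomial coefficients are divisible by \<open>p\<close>.
\<close>

lemma (in cring) frobenius_add:
  assumes p: "Factorial_Ring.prime p" and char: "[p] \<cdot>\<^bsub>R\<^esub> \<one> = \<zero>" and a: "a \<in> carrier R" and b: "b \<in> carrier R"
  shows "(a \<oplus> b) [^] (p::nat) = a [^] p \<oplus> b [^] p"
proof -
  have kill: "[m] \<cdot>\<^bsub>R\<^esub> c = \<zero>" if d: "p dvd m" and c: "c \<in> carrier R" for m c
  proof -
    obtain q where m: "m = p * q" using d by (rule dvdE)
    have "[p] \<cdot>\<^bsub>R\<^esub> c = ([p] \<cdot>\<^bsub>R\<^esub> \<one>) \<otimes> c" using c by (simp add: add_pow_ldistr)
    then have "[p] \<cdot>\<^bsub>R\<^esub> c = \<zero>" using char c by simp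
    then have "[q] \<cdot>\<^bsub>R\<^esub> ([p] \<cdot>\<^bsub>R\<^esub> c) = \<zero>" by simp
    then show ?thesis using c add.nat_pow_pow[of c q p] by (simp add: m)
  qed
  obtain n where n: "p = Suc n" using prime_gt_0_nat[OF p] by (metis gr0_implies_Suc)
  define t where "t i = [(p choose i)] \<cdot>\<^bsub>R\<^esub> (a [^] i \<otimes> b [^] (p - i))" for i
  have c: "t i \<in> carrier R" for i using a b by (simp add: t_def)
  have z: "t (Suc i) = \<zero>" if "Suc i \<le> n" for i
    unfolding t_def
  proof (rule kill)
    show "p dvd p choose Suc i"
      by (rule dvd_choose_prime) (use that n p in auto)
  qed (use a b in simp)
  have "finsum R t {..n} = t 0"
    using z
  proof (induction n)
    case (Suc k)
    then show ?case using c by (subst finsum_Suc) auto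
  qed (use c in auto)
  then have "finsum R t {..p} = a [^] p \<oplus> b [^] p"
    using c a b unfolding n by (subst finsum_Suc) (auto simp: t_def n)
  then show ?thesis using binomial_ring[OF a b, of p] by (simp add: t_def[abs_def])
qed

lemma (in cring) frobenius_hom:
  assumes "Factorial_Ring.prime p" and "[p] \<cdot>\<^bsub>R\<^esub> \<one> = \<zero>"
  shows "(\<lambda>a. a [^] (p::nat)) \<in> ring_hom R R"
  by (rule ring_hom_memI) (simp_all add: frobenius_add[OF assms] nat_pow_distrib)

lemma (in domain) frobenius_inj:
  assumes "Factorial_Ring.prime p" and "[p] \<cdot>\<^bsub>R\<^esub> \<one> = \<zero>"
  shows "inj_on (\<lambda>a. a [^] (p::nat)) (carrier R)"
proof (rule inj_onI)
  fix a b assume ab: "a \<in> carrier R" "b \<in> carrier R" "a [^] p = b [^] p"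
  have pow: "c = \<zero>" if "c \<in> carrier R" "c [^] n = \<zero>" for c and n :: nat
    using that(2) by (induction n) (use that(1) integral in auto)
  have e: "a = (a \<ominus> b) \<oplus> b" using ab by (simp add: minus_eq a_assoc l_neg)
  then have "a [^] p = (a \<ominus> b) [^] p \<oplus> b [^] p"
    using frobenius_add[OF assms, of "a \<ominus> b" b] ab by simp
  then have "(a \<ominus> b) [^] p = \<zero>" using ab by simp
  then have "a \<ominus> b = \<zero>" using pow[of "a \<ominus> b" p] ab by simp
  then show "a = b" using e ab by simp
qed

text \<open>
  A factorisation of \<open>p\<close> gives \<open>(d \<cdot> 1) (e \<cdot> 1) = 0\<close>, and the minimality of \<open>p\<close> excludes zero factors.
\<close>

lemma (in field) prime_char:
  assumes "ring_char R > 0"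
  shows "Factorial_Ring.prime (ring_char R)" and "[(ring_char R)] \<cdot>\<^bsub>R\<^esub> \<one> = \<zero>"
proof -
  let ?p = "ring_char R"
  let ?Q = "\<lambda>n::nat. n > 0 \<and> [n] \<cdot>\<^bsub>R\<^esub> \<one> = \<zero>"
  have ex: "\<exists>n. ?Q n" using assms unfolding ring_char_def by (auto split: if_splits)
  then have p: "?p = (LEAST n. ?Q n)" unfolding ring_char_def by simp
  show z: "[?p] \<cdot>\<^bsub>R\<^esub> \<one> = \<zero>" using LeastI_ex[OF ex] p by simp
  have least: "\<not> ?Q m" if "m < ?p" for m using not_less_Least[of m ?Q] that p by simp
  show "Factorial_Ring.prime ?p"
    unfolding prime_nat_iff
  proof (intro conjI allI impI)
    show "1 < ?p"
    proof (rule ccontr)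
      assume "\<not> 1 < ?p"
      then have "?p = 1" using assms by simp
      then show False using z by simp
    qed
    fix d assume d0: "d dvd ?p"
    show "d = 1 \<or> d = ?p"
    proof (rule ccontr)
      assume "\<not> (d = 1 \<or> d = ?p)"
      then have d: "d \<noteq> 1" "d \<noteq> ?p" by auto
      obtain e where e: "?p = d * e" using d0 by (rule dvdE)
      have pos: "d > 0" "e > 0" using e assms by (auto intro: Nat.gr0I)
      have "d > 1" "e > 1" using d e pos by (auto simp: less_Suc_eq_le intro: Nat.gr0I)
      then have lt: "d < ?p" "e < ?p" using e by auto
      have "([d] \<cdot>\<^bsub>R\<^esub> \<one>) \<otimes> ([e] \<cdot>\<^bsub>R\<^esub> \<one>) = [d] \<cdot>\<^bsub>R\<^esub> ([e] \<cdot>\<^bsub>R\<^esub> \<one>)" by (simp add: add_pow_ldistr)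
      also have "\<dots> = \<zero>" using z e add.nat_pow_pow[of \<one> d e] by (simp add: mult.commute)
      finally have "[d] \<cdot>\<^bsub>R\<^esub> \<one> = \<zero> \<or> [e] \<cdot>\<^bsub>R\<^esub> \<one> = \<zero>" by (intro integral) auto
      then show False using least lt pos by auto
    qed
  qed
qed

lemma ring_hom_pow:
  assumes h: "h \<in> ring_hom R S" and R: "cring R" and S: "cring S" and a: "a \<in> carrier R"
  shows "h (a [^]\<^bsub>R\<^esub> (n::nat)) = h a [^]\<^bsub>S\<^esub> n"
proof -
  interpret R: cring R by fact
  interpret S: cring S by fact
  show ?thesis
    by (induction n) (use a in \<open>simp_all add: ring_hom_one[OF h] ring_hom_mult[OF h]\<close>)
qed

lemma ring_hom_char:
  assumes h: "h \<in> ring_hom R S" and R: "cring R" and S: "cring S" and z: "[n] \<cdot>\<^bsub>R\<^esub> \<one>\<^bsub>R\<^esub> = \<zero>\<^bsub>R\<^esub>"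
  shows "[(n::nat)] \<cdot>\<^bsub>S\<^esub> \<one>\<^bsub>S\<^esub> = \<zero>\<^bsub>S\<^esub>"
proof -
  interpret R: cring R by fact
  interpret S: cring S by fact
  have z0: "h \<zero>\<^bsub>R\<^esub> = \<zero>\<^bsub>S\<^esub>" by (rule ring_hom_zero[OF h R.ring_axioms S.ring_axioms])
  have "h ([m] \<cdot>\<^bsub>R\<^esub> \<one>\<^bsub>R\<^esub>) = [m] \<cdot>\<^bsub>S\<^esub> \<one>\<^bsub>S\<^esub>" for m :: nat
    by (induction m) (simp_all add: z0 ring_hom_add[OF h] ring_hom_one[OF h])
  then show ?thesis using z z0 by metis
qed

lemma surj_hom_cring:
  assumes R: "cring R" and h: "h \<in> ring_hom R S" and surj: "h ` carrier R = carrier S"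
    and zero: "h \<zero>\<^bsub>R\<^esub> = \<zero>\<^bsub>S\<^esub>"
  shows "cring S"
proof -
  interpret R: cring R by fact
  have "ring (S\<lparr>carrier := h ` carrier R, ring.zero := h \<zero>\<^bsub>R\<^esub>\<rparr>)" by (rule R.ring_hom_imp_img_ring[OF h])
  then interpret S: ring S by (simp add: surj zero)
  show ?thesis
  proof (rule cring.intro[OF S.ring_axioms], unfold_locales)
    fix x y assume "x \<in> carrier S" "y \<in> carrier S"
    then obtain a b where "a \<in> carrier R" "b \<in> carrier R" "x = h a" "y = h b"
      unfolding surj[symmetric] by auto
    then show "x \<otimes>\<^bsub>S\<^esub> y = y \<otimes>\<^bsub>S\<^esub> x"
      by (simp add: ring_hom_mult[OF h, symmetric] R.m_comm)
  qed
qed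

lemma (in ring_presheaf) rs_map_frobenius:
  assumes p: "Factorial_Ring.prime p" and char: "\<And>U. is_open \<XX> U \<Longrightarrow> [p] \<cdot>\<^bsub>sections \<XX> U\<^esub> \<one>\<^bsub>sections \<XX> U\<^esub> = \<zero>\<^bsub>sections \<XX> U\<^esub>"
  shows "rs_map \<XX> \<XX> (frobenius p \<XX>)"
proof (intro rs_map.intro rs_map_axioms.intro ring_presheaf_axioms)
  have pre: "preimage \<XX> (frobenius p \<XX>) V = V" if "is_open \<XX> V" for V
    using openin_subset[OF that] by (auto simp: preimage_def frobenius_def)
  show "rs_morphism \<XX> \<XX> (frobenius p \<XX>)"
    unfolding rs_morphism_def
  proof (intro conjI allI impI ballI)
    show "continuous_map (top_space \<XX>) (top_space \<XX>) (base (frobenius p \<XX>))"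
      by (simp add: frobenius_def)
    fix V assume V: "is_open \<XX> V"
    show "sharp (frobenius p \<XX>) V \<in> ring_hom (sections \<XX> V) (sections \<XX> (preimage \<XX> (frobenius p \<XX>) V))"
      using cring.frobenius_hom[OF cring_sections[OF V] p char[OF V]] by (simp add: pre V) (simp add: frobenius_def)
  next
    fix V W b assume VW: "is_open \<XX> V \<and> is_open \<XX> W \<and> W \<subseteq> V" and b: "b \<in> carrier (sections \<XX> V)"
    then show "restr \<XX> (preimage \<XX> (frobenius p \<XX>) V) (preimage \<XX> (frobenius p \<XX>) W) (sharp (frobenius p \<XX>) V b) =
      sharp (frobenius p \<XX>) W (restr \<XX> V W b)"
      using ring_hom_pow[OF restr_hom cring_sections cring_sections b, of W p] by (simp add: pre) (simp add: frobenius_def)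
  qed
qed

section \<open>The spectrum of a field\<close>

context field
begin

text \<open>
  The local ring of \<open>Spec R\<close> at its point \<open>{\<zero>}\<close> is the localisation at the nonzero elements. Every fraction is
  equal to one of the form \<open>c / 1\<close>, so this ring is a copy of \<open>R\<close>.
\<close>

abbreviation "S0 \<equiv> carrier R - {\<zero>}"
abbreviation "cfrac c \<equiv> fraction R S0 c \<one>"

lemma mem_frac: "c \<in> carrier R \<Longrightarrow> x \<in> cfrac c \<longleftrightarrow> (\<exists>s\<in>S0. x = (c \<otimes> s, s))"
proof -
  assume c: "c \<in> carrier R"
  have "(b, t) \<in> cfrac c \<longleftrightarrow> t \<in> S0 \<and> b = c \<otimes> t" for b t
  proof -
    have "(b, t) \<in> cfrac c \<longleftrightarrow> b \<in> carrier R \<and> t \<in> S0 \<and> (\<exists>u\<in>S0. u \<otimes> (c \<otimes> t) = u \<otimes> (b \<otimes> \<one>))"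
      by (simp add: fraction_def)
    also have "\<dots> \<longleftrightarrow> b \<in> carrier R \<and> t \<in> S0 \<and> (\<exists>u\<in>S0. c \<otimes> t = b)"
      using c by (intro conj_cong bex_cong refl) (auto simp: m_lcancel)
    also have "\<dots> \<longleftrightarrow> t \<in> S0 \<and> b = c \<otimes> t"
      using c one_closed zero_not_one by auto
    finally show ?thesis .
  qed
  then show ?thesis by (cases x) auto
qed

lemma fraction_eq_frac:
  assumes c: "c \<in> carrier R" and s: "s \<in> S0"
  shows "fraction R S0 (c \<otimes> s) s = cfrac c"
proof -
  have "(b, t) \<in> fraction R S0 (c \<otimes> s) s \<longleftrightarrow> (b, t) \<in> cfrac c" for b t
  proof -
    have "u \<otimes> (c \<otimes> s \<otimes> t) = u \<otimes> (b \<otimes> s) \<longleftrightarrow> u \<otimes> (c \<otimes> t) = u \<otimes> (b \<otimes> \<one>)"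
      if "b \<in> carrier R" "t \<in> S0" "u \<in> S0" for u
    proof -
      have "c \<otimes> s \<otimes> t = s \<otimes> (c \<otimes> t)" "b \<otimes> s = s \<otimes> b" using c s that by (simp_all add: m_ac)
      then show ?thesis using c s that by (simp add: m_lcancel)
    qed
    then show ?thesis unfolding fraction_def by auto
  qed
  then show ?thesis by auto
qed

lemma fraction_frac:
  assumes a: "a \<in> carrier R" and s: "s \<in> S0"
  shows "fraction R S0 a s = cfrac (a \<otimes> inv s)"
proof -
  have i: "inv s \<in> carrier R" "inv s \<otimes> s = \<one>" using s field_Units by auto
  then have "a \<otimes> inv s \<otimes> s = a" using a s by (simp add: m_assoc)
  then show ?thesis using fraction_eq_frac[of "a \<otimes> inv s" s] a s i by simp
qed

lemma frac_inj: "c \<in> carrier R \<Longrightarrow> d \<in> carrier R \<Longrightarrow> cfrac c = cfrac d \<Longrightarrow> c = d"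
  using mem_frac[of c "(c, \<one>)"] mem_frac[of d "(c, \<one>)"] by auto

lemma frac_ops:
  assumes c: "c \<in> carrier R" and d: "d \<in> carrier R"
  shows "cfrac c \<otimes>\<^bsub>localization R S0\<^esub> cfrac d = cfrac (c \<otimes> d)"
    and "cfrac c \<oplus>\<^bsub>localization R S0\<^esub> cfrac d = cfrac (c \<oplus> d)"
proof -
  have UN: "(\<Union>(a, s)\<in>cfrac c. \<Union>(b, t)\<in>cfrac d. G a s b t) = D"
    if "\<And>s t. s \<in> S0 \<Longrightarrow> t \<in> S0 \<Longrightarrow> G (c \<otimes> s) s (d \<otimes> t) t = D" for G :: "_ \<Rightarrow> _ \<Rightarrow> _ \<Rightarrow> _ \<Rightarrow> ('a \<times> 'a) set" and D
  proof (intro equalityI subsetI)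
    fix x assume "x \<in> (\<Union>(a, s)\<in>cfrac c. \<Union>(b, t)\<in>cfrac d. G a s b t)"
    then show "x \<in> D" using that by (auto simp: mem_frac c d)
  next
    fix x assume x: "x \<in> D"
    have "(c, \<one>) \<in> cfrac c" "(d, \<one>) \<in> cfrac d" using c d by (auto simp: mem_frac)
    moreover have "G c \<one> d \<one> = D" using that[of \<one> \<one>] c d by simp
    ultimately show "x \<in> (\<Union>(a, s)\<in>cfrac c. \<Union>(b, t)\<in>cfrac d. G a s b t)" using x by blast
  qed
  show "cfrac c \<otimes>\<^bsub>localization R S0\<^esub> cfrac d = cfrac (c \<otimes> d)"
    unfolding localization_def monoid.simps
  proof (rule UN)
    fix s t assume st: "s \<in> S0" "t \<in> S0"
    then have "c \<otimes> s \<otimes> (d \<otimes> t) = c \<otimes> d \<otimes> (s \<otimes> t)" "s \<otimes> t \<in> S0"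
      using c d by (auto simp: m_ac integral_iff)
    then show "fraction R S0 (c \<otimes> s \<otimes> (d \<otimes> t)) (s \<otimes> t) = cfrac (c \<otimes> d)"
      using fraction_eq_frac[of "c \<otimes> d" "s \<otimes> t"] c d by simp
  qed
  show "cfrac c \<oplus>\<^bsub>localization R S0\<^esub> cfrac d = cfrac (c \<oplus> d)"
    unfolding localization_def ring.simps
  proof (rule UN)
    fix s t assume st: "s \<in> S0" "t \<in> S0"
    then have "c \<otimes> s \<otimes> t = c \<otimes> (s \<otimes> t)" "d \<otimes> t \<otimes> s = d \<otimes> (s \<otimes> t)" and st': "s \<otimes> t \<in> S0"
      using c d by (auto simp: m_ac integral_iff)
    then have "c \<otimes> s \<otimes> t \<oplus> d \<otimes> t \<otimes> s = (c \<oplus> d) \<otimes> (s \<otimes> t)"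
      using c d by (simp add: l_distr)
    then show "fraction R S0 (c \<otimes> s \<otimes> t \<oplus> d \<otimes> t \<otimes> s) (s \<otimes> t) = cfrac (c \<oplus> d)"
      using fraction_eq_frac[of "c \<oplus> d" "s \<otimes> t"] c d st' by simp
  qed
qed

lemma localization_carrier: "carrier (localization R S0) = cfrac ` carrier R"
proof (intro equalityI subsetI)
  fix x assume "x \<in> carrier (localization R S0)"
  then obtain a s where as: "a \<in> carrier R" "s \<in> S0" "x = fraction R S0 a s"
    by (auto simp: localization_def)
  then have "a \<otimes> inv s \<in> carrier R" using field_Units by auto
  then show "x \<in> cfrac ` carrier R" using as fraction_frac[OF as(1,2)] by auto
next
  fix x assume "x \<in> cfrac ` carrier R"
  then obtain c where "c \<in> carrier R" "x = cfrac c" by auto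
  moreover have "\<one> \<in> S0" by simp
  ultimately show "x \<in> carrier (localization R S0)" unfolding localization_def partial_object.simps by blast
qed

lemma prime_ideals: "primeideal P R \<longleftrightarrow> P = {\<zero>}"
proof
  assume "primeideal P R"
  then interpret primeideal P R .
  have "P \<in> {I. ideal I R}" using ideal_axioms by simp
  then show "P = {\<zero>}" using all_ideals I_notcarr by auto
qed (simp add: zeroprimeideal)

lemma Spec_points: "points (Spec R) = {{\<zero>}}"
proof -
  have "\<Union>{{P. primeideal P R \<and> a \<notin> P} |a. a \<in> carrier R} = {{\<zero>}}"
  proof (intro equalityI subsetI)
    fix P assume "P \<in> {{\<zero>}}"
    then have "P \<in> {P. primeideal P R \<and> \<one> \<notin> P}" using one_not_zero by (simp add: prime_ideals)
    then show "P \<in> \<Union>{{P. primeideal P R \<and> a \<notin> P} |a. a \<in> carrier R}" using one_closed by blast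
  qed (auto simp: prime_ideals)
  then show ?thesis by (simp add: Spec_def spec_topology_def)
qed

lemma Spec_open: "is_open (Spec R) U \<longleftrightarrow> U \<subseteq> {{\<zero>}}"
  using openin_subset[of "top_space (Spec R)" U] openin_topspace[of "top_space (Spec R)"]
  by (auto simp: Spec_points subset_singleton_iff)

text \<open>
  The section with value \<open>c / 1\<close> at every point. It is defined for all \<open>U\<close> because the axioms of a presheaf
  also concern the empty set, over which all constants coincide.
\<close>

definition const :: "'a set set \<Rightarrow> 'a \<Rightarrow> 'a set \<Rightarrow> ('a \<times> 'a) set" where
  "const U c = (\<lambda>P\<in>U. fraction R (carrier R - P) c \<one>)"

lemma const_apply: "U \<subseteq> {{\<zero>}} \<Longrightarrow> P \<in> U \<Longrightarrow> const U c P = cfrac c"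
  by (auto simp: const_def)

lemma Spec_carrier:
  assumes U: "U \<subseteq> {{\<zero>}}"
  shows "carrier (sections (Spec R) U) = const U ` carrier R"
proof (intro equalityI subsetI)
  fix \<sigma> assume "\<sigma> \<in> carrier (sections (Spec R) U)"
  then have \<sigma>: "\<sigma> \<in> (\<Pi>\<^sub>E P\<in>U. carrier (localization R (carrier R - P)))"
    by (simp add: Spec_def sections_ring_def)
  have "\<exists>c\<in>carrier R. \<forall>P\<in>U. \<sigma> P = cfrac c"
  proof (cases "U = {}")
    case True
    then show ?thesis using one_closed by blast
  next
    case False
    then have "U = {{\<zero>}}" using U by auto
    then have "\<sigma> {\<zero>} \<in> cfrac ` carrier R" using \<sigma> localization_carrier by auto
    then show ?thesis using \<open>U = _\<close> by auto
  qed
  then obtain c where c: "c \<in> carrier R" "\<And>P. P \<in> U \<Longrightarrow> \<sigma> P = cfrac c" by auto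
  have "\<sigma> = const U c"
    by (rule extensionalityI[of _ U]) (use \<sigma> c const_apply[OF U] in \<open>auto simp: const_def PiE_def\<close>)
  then show "\<sigma> \<in> const U ` carrier R" using c by auto
next
  fix \<sigma> assume "\<sigma> \<in> const U ` carrier R"
  then obtain c where c: "c \<in> carrier R" "\<sigma> = const U c" by auto
  have o: "openin (spec_topology R) U" using Spec_open[of U] U by (simp add: Spec_def)
  have "const U c \<in> (\<Pi>\<^sub>E P\<in>U. carrier (localization R (carrier R - P)))"
  proof (rule PiE_I)
    fix P assume P: "P \<in> U"
    then have "P = {\<zero>}" using U by auto
    then show "const U c P \<in> carrier (localization R (carrier R - P))"
      using c(1) localization_carrier const_apply[OF U P] by auto
  qed (simp add: const_def)
  moreover have "\<exists>V a s. openin (spec_topology R) V \<and> P \<in> V \<and> V \<subseteq> U \<and> a \<in> carrier R \<and> s \<in> carrier R \<and>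
      (\<forall>Q\<in>V. s \<notin> Q \<and> const U c Q = fraction R (carrier R - Q) a s)" if P: "P \<in> U" for P
  proof (intro exI conjI ballI)
    show "openin (spec_topology R) U" by (rule o)
    fix Q assume "Q \<in> U"
    then show "\<one> \<notin> Q" "const U c Q = fraction R (carrier R - Q) c \<one>" using U by (auto simp: const_def)
  qed (use P c in auto)
  ultimately show "\<sigma> \<in> carrier (sections (Spec R) U)"
    by (simp add: Spec_def sections_ring_def c)
qed

lemma const_hom:
  assumes U: "U \<subseteq> {{\<zero>}}"
  shows "const U \<in> ring_hom R (sections (Spec R) U)" and "const U \<zero> = \<zero>\<^bsub>sections (Spec R) U\<^esub>"
proof -
  have P: "P = {\<zero>}" if "P \<in> U" for P using U that by auto
  show "const U \<in> ring_hom R (sections (Spec R) U)"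
  proof (rule ring_hom_memI)
    fix c assume "c \<in> carrier R"
    then show "const U c \<in> carrier (sections (Spec R) U)" by (simp add: Spec_carrier[OF U])
  next
    fix c d assume cd: "c \<in> carrier R" "d \<in> carrier R"
    show "const U (c \<otimes> d) = const U c \<otimes>\<^bsub>sections (Spec R) U\<^esub> const U d"
      "const U (c \<oplus> d) = const U c \<oplus>\<^bsub>sections (Spec R) U\<^esub> const U d"
      using frac_ops[OF cd] P by (auto simp: Spec_def sections_ring_def const_def intro!: restrict_ext)
  qed (auto simp: Spec_def sections_ring_def const_def localization_def intro!: restrict_ext)
  show "const U \<zero> = \<zero>\<^bsub>sections (Spec R) U\<^esub>"
    by (auto simp: Spec_def sections_ring_def const_def localization_def intro!: restrict_ext)
qed

lemma Spec_cring: "U \<subseteq> {{\<zero>}} \<Longrightarrow> cring (sections (Spec R) U)"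
  by (rule surj_hom_cring[OF is_cring const_hom(1) _ const_hom(2)]) (simp_all add: Spec_carrier)

lemma Spec_restrict:
  assumes "V \<subseteq> U" "U \<subseteq> {{\<zero>}}"
  shows "restr (Spec R) U V (const U c) = const V c"
  using assms by (auto simp: Spec_def const_def Int_absorb1 fun_eq_iff)

text \<open>
  The restriction maps send constants to constants.
\<close>

lemma Spec_one_point: "one_point (Spec R) {\<zero>}"
proof (intro one_point.intro one_point_axioms.intro ring_presheaf.intro)
  fix U assume "is_open (Spec R) U"
  then show "cring (sections (Spec R) U)" by (simp add: Spec_open Spec_cring)
next
  fix U V assume UV: "is_open (Spec R) U" "is_open (Spec R) V" "V \<subseteq> U"
  then have sub: "U \<subseteq> {{\<zero>}}" "V \<subseteq> {{\<zero>}}" by (simp_all add: Spec_open)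
  show "restr (Spec R) U V \<in> ring_hom (sections (Spec R) U) (sections (Spec R) V)"
  proof (rule ring_hom_memI)
    fix s assume "s \<in> carrier (sections (Spec R) U)"
    then obtain c where c: "c \<in> carrier R" "s = const U c" by (auto simp: Spec_carrier[OF sub(1)])
    then show "restr (Spec R) U V s \<in> carrier (sections (Spec R) V)"
      by (simp add: Spec_restrict[OF UV(3) sub(1)] Spec_carrier[OF sub(2)])
    fix t assume "t \<in> carrier (sections (Spec R) U)"
    then obtain d where d: "d \<in> carrier R" "t = const U d" by (auto simp: Spec_carrier[OF sub(1)])
    note h = const_hom(1)[OF sub(1)] const_hom(1)[OF sub(2)]
    show "restr (Spec R) U V (s \<otimes>\<^bsub>sections (Spec R) U\<^esub> t) = restr (Spec R) U V s \<otimes>\<^bsub>sections (Spec R) V\<^esub> restr (Spec R) U V t"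
      "restr (Spec R) U V (s \<oplus>\<^bsub>sections (Spec R) U\<^esub> t) = restr (Spec R) U V s \<oplus>\<^bsub>sections (Spec R) V\<^esub> restr (Spec R) U V t"
      using c d by (simp_all add: ring_hom_mult[OF h(1), symmetric] ring_hom_mult[OF h(2), symmetric]
          ring_hom_add[OF h(1), symmetric] ring_hom_add[OF h(2), symmetric] Spec_restrict[OF UV(3) sub(1)])
  next
    show "restr (Spec R) U V \<one>\<^bsub>sections (Spec R) U\<^esub> = \<one>\<^bsub>sections (Spec R) V\<^esub>"
      using ring_hom_one[OF const_hom(1)[OF sub(1)]] ring_hom_one[OF const_hom(1)[OF sub(2)]]
        Spec_restrict[OF UV(3) sub(1), of \<one>] by simp
  qed
next
  fix U s assume "is_open (Spec R) U" "s \<in> carrier (sections (Spec R) U)"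
  then have U: "U \<subseteq> {{\<zero>}}" and "s \<in> const U ` carrier R" by (simp_all add: Spec_open Spec_carrier)
  then show "restr (Spec R) U U s = s" using Spec_restrict[OF order_refl U] by auto
next
  fix U V W s assume "is_open (Spec R) U" "is_open (Spec R) V" "is_open (Spec R) W" "V \<subseteq> U" "W \<subseteq> V"
    "s \<in> carrier (sections (Spec R) U)"
  then show "restr (Spec R) V W (restr (Spec R) U V s) = restr (Spec R) U W s"
    by (auto simp: Spec_open Spec_carrier Spec_restrict)
next
  show "points (Spec R) = {{\<zero>}}" by (rule Spec_points)
  have "carrier (sections (Spec R) {}) = {const {} \<one>}" by (auto simp: Spec_carrier const_def)
  then show "\<exists>z. carrier (sections (Spec R) {}) = {z}" by blast
qed

lemma Spec_char:
  assumes "[n] \<cdot>\<^bsub>R\<^esub> \<one> = \<zero>" "is_open (Spec R) U"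
  shows "[(n::nat)] \<cdot>\<^bsub>sections (Spec R) U\<^esub> \<one>\<^bsub>sections (Spec R) U\<^esub> = \<zero>\<^bsub>sections (Spec R) U\<^esub>"
  using ring_hom_char[OF const_hom(1) is_cring Spec_cring] assms by (simp add: Spec_open)

end

text \<open>
  On constants the comorphism is \<open>c \<mapsto> c\<^sup>p\<close>, which is injective on a domain of characteristic \<open>p\<close> and
  surjective because \<open>k\<close> is perfect.
\<close>

lemma perfect_Spec_twist:
  assumes perf: "perfect_field k" and p: "ring_char k = p" "p > 0"
  shows "one_point_twist (Spec k) {\<zero>\<^bsub>k\<^esub>} (frobenius p (Spec k))"
proof -
  interpret field k using perf by (simp add: perfect_field_def)
  interpret S: one_point "Spec k" "{\<zero>\<^bsub>k\<^esub>}" by (rule Spec_one_point)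
  have prime: "Factorial_Ring.prime p" and char: "[p] \<cdot>\<^bsub>k\<^esub> \<one>\<^bsub>k\<^esub> = \<zero>\<^bsub>k\<^esub>" using prime_char p by simp_all
  have bij: "bij_betw (\<lambda>a. a [^]\<^bsub>k\<^esub> p) (carrier k) (carrier k)"
  proof -
    have "\<exists>b\<in>carrier k. a = b [^]\<^bsub>k\<^esub> p" if "a \<in> carrier k" for a
      using perf p that unfolding perfect_field_def by (metis less_irrefl)
    then have "(\<lambda>a. a [^]\<^bsub>k\<^esub> p) ` carrier k = carrier k" by auto
    then show ?thesis using frobenius_inj[OF prime char] by (simp add: bij_betw_def)
  qed
  interpret rs_map "Spec k" "Spec k" "frobenius p (Spec k)"
    by (rule S.rs_map_frobenius[OF prime]) (rule Spec_char[OF char])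
  show ?thesis
  proof (intro one_point_twist.intro one_point_twist_axioms.intro)
    show "one_point (Spec k) {\<zero>\<^bsub>k\<^esub>}" by (rule Spec_one_point)
    show "rs_map (Spec k) (Spec k) (frobenius p (Spec k))" by (rule rs_map_axioms)
    show "base (frobenius p (Spec k)) = (\<lambda>x. x)" by (simp add: frobenius_def)
    fix U assume "is_open (Spec k) U"
    then have U: "U \<subseteq> {{\<zero>\<^bsub>k\<^esub>}}" by (simp add: Spec_open)
    have pow: "sharp (frobenius p (Spec k)) U (const U c) = const U (c [^]\<^bsub>k\<^esub> p)" if "c \<in> carrier k" for c
      using ring_hom_pow[OF const_hom(1)[OF U] is_cring Spec_cring[OF U] that] by (simp add: frobenius_def)
    have im: "sharp (frobenius p (Spec k)) U ` const U ` carrier k = const U ` carrier k"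
    proof -
      have "sharp (frobenius p (Spec k)) U ` const U ` carrier k = const U ` (\<lambda>c. c [^]\<^bsub>k\<^esub> p) ` carrier k"
        using pow by (auto simp: image_image)
      then show ?thesis using bij by (simp add: bij_betw_def)
    qed
    have "inj_on (sharp (frobenius p (Spec k)) U) (const U ` carrier k)"
    proof (cases "U = {}")
      case True
      then show ?thesis by (auto simp: const_def inj_on_def)
    next
      case False
      then have U': "{\<zero>\<^bsub>k\<^esub>} \<in> U" using U by auto
      show ?thesis
      proof (rule inj_onI, clarify)
        fix c d assume cd: "c \<in> carrier k" "d \<in> carrier k"
          and "sharp (frobenius p (Spec k)) U (const U c) = sharp (frobenius p (Spec k)) U (const U d)"
        then have "const U (c [^]\<^bsub>k\<^esub> p) = const U (d [^]\<^bsub>k\<^esub> p)" by (simp add: pow)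
        then have "cfrac (c [^]\<^bsub>k\<^esub> p) = cfrac (d [^]\<^bsub>k\<^esub> p)" using const_apply[OF U U'] by metis
        then have "c [^]\<^bsub>k\<^esub> p = d [^]\<^bsub>k\<^esub> p" using cd by (intro frac_inj) auto
        then have "c = d" using cd bij by (auto simp: bij_betw_def dest: inj_onD)
        then show "const U c = const U d" by simp
      qed
    qed
    then show "bij_betw (sharp (frobenius p (Spec k)) U) (carrier (sections (Spec k) U)) (carrier (sections (Spec k) U))"
      using im by (simp add: bij_betw_def Spec_carrier[OF U])
  qed
qed

section \<open>Descent of frames\<close>

lemma vector_bundle_presheaf: "vector_bundle \<XX> r M \<Longrightarrow> module_presheaf \<XX> M"
  by (simp add: vector_bundle_def module_sheaf.module_presheaf)

text \<open>
  The descent of frames for any square \<open>G \<circ> \<xi> = \<xi> \<circ> F\<close> with \<open>F\<close> an automorphism of a one-point space. The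
  square identifies \<open>\<xi>\<^sup>*G\<^sup>*V'\<close> with \<open>F\<^sup>*\<xi>\<^sup>*V'\<close>, and a frame of \<open>V\<close> becomes an isomorphism
  \<open>\<gamma> : F\<^sup>*\<xi>\<^sup>*V' \<rightarrow> F\<^sup>*\<O>\<^sup>\<oplus>\<^sup>r\<close>, to which \<open>pullback_descent\<close> applies.
\<close>

theorem frame_descent:
  assumes tw: "one_point_twist S pt F" and X: "rs_map \<XX> \<XX> G" and xi: "rs_map S \<XX> \<xi>"
    and base: "base (comp_morphism \<XX> G \<xi>) = base (comp_morphism S \<xi> F)"
    and sharp: "\<And>V b. is_open \<XX> V \<Longrightarrow> b \<in> carrier (sections \<XX> V) \<Longrightarrow>
        sharp (comp_morphism \<XX> G \<xi>) V b = sharp (comp_morphism S \<xi> F) V b"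
    and V: "module_presheaf \<XX> V" and V': "module_presheaf \<XX> V'"
    and phi: "sheaf_iso \<XX> V (pullback \<XX> \<XX> G V') \<phi>"
    and beta: "sheaf_iso S (pullback S \<XX> \<xi> V) (free_sheaf S r) \<beta>"
  shows "\<exists>!\<beta>'. sheaf_iso S (pullback S \<XX> \<xi> V') (free_sheaf S r) \<beta>' \<and>
    \<beta> = sheaf_comp S (pullback S \<XX> \<xi> V)
        (sheaf_inv S (free_sheaf S r) (pullback S S F (free_sheaf S r)) (pullback_free S S F r))
        (sheaf_comp S (pullback S \<XX> \<xi> V)
           (pullback_map S S F (pullback S \<XX> \<xi> V') (free_sheaf S r) \<beta>')
           (sheaf_comp S (pullback S \<XX> \<xi> V)
              (sheaf_comp S (pullback S \<XX> \<xi> (pullback \<XX> \<XX> G V'))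
                 (pullback_comp S S \<XX> F \<xi> V')
                 (sheaf_inv S
                    (pullback S \<XX> (comp_morphism \<XX> G \<xi>) V')
                    (pullback S \<XX> \<xi> (pullback \<XX> \<XX> G V'))
                    (pullback_comp S \<XX> \<XX> \<xi> G V')))
              (pullback_map S \<XX> \<xi> V (pullback \<XX> \<XX> G V') \<phi>)))"
proof -
  interpret S: one_point_twist S pt F by fact
  interpret G: rs_map \<XX> \<XX> G by fact
  interpret \<xi>: rs_map S \<XX> \<xi> by fact
  interpret V: module_presheaf \<XX> V by fact
  interpret V': module_presheaf \<XX> V' by fact
  interpret GV': module_pullback \<XX> \<XX> G V' ..
  interpret A: one_point_pullback S pt \<XX> \<xi> V ..
  interpret A': one_point_pullback S pt \<XX> \<xi> V' ..
  interpret B: one_point_pullback S pt \<XX> \<xi> GV'.P ..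
  interpret FA': one_point_pullback S pt S F A'.P ..
  have "rs_map S \<XX> (comp_morphism \<XX> G \<xi>)" by (rule rs_map_comp) fact+
  then interpret C: one_point_pullback S pt \<XX> "comp_morphism \<XX> G \<xi>" V'
    by (intro one_point_pullback.intro module_pullback.intro S.one_point_axioms V'.module_presheaf_axioms)
  let ?E = "free_sheaf S r"
  have E: "module_presheaf S ?E" by (rule S.free_sheaf_presheaf)
  then interpret FE: one_point_pullback S pt S F ?E
    by (intro one_point_pullback.intro module_pullback.intro S.one_point_axioms S.rs_map_axioms)
  have same: "pullback S \<XX> (comp_morphism \<XX> G \<xi>) V' = pullback S \<XX> (comp_morphism S \<xi> F) V'"
    by (rule pullback_cong[OF base sharp])
  note c1 = pullback_comp_iso[OF S.one_point_axioms xi X V']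
  note c2 = pullback_comp_iso[OF S.one_point_axioms S.rs_map_axioms xi V', folded same]
  define \<Theta> where "\<Theta> = sheaf_comp S B.P (pullback_comp S S \<XX> F \<xi> V')
      (sheaf_inv S C.P B.P (pullback_comp S \<XX> \<XX> \<xi> G V'))"
  have \<Theta>: "sheaf_iso S B.P FA'.P \<Theta>"
    unfolding \<Theta>_def
    by (rule sheaf_iso_comp[OF sheaf_iso_inv[OF c1 C.module_presheaf_P B.module_presheaf_P] c2 B.module_presheaf_P])
  define \<epsilon> where "\<epsilon> = sheaf_comp S A.P \<Theta> (pullback_map S \<XX> \<xi> V GV'.P \<phi>)"
  have \<epsilon>: "sheaf_iso S A.P FA'.P \<epsilon>"
    unfolding \<epsilon>_def
    by (rule sheaf_iso_comp[OF pullback_map_iso[OF S.one_point_axioms xi V GV'.module_presheaf_P phi] \<Theta> A.module_presheaf_P])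
  let ?free = "pullback_free S S F r"
  note free = S.pullback_free_iso[of r]
  define \<gamma> where "\<gamma> = sheaf_comp S FA'.P ?free (sheaf_comp S FA'.P \<beta> (sheaf_inv S A.P FA'.P \<epsilon>))"
  have \<gamma>: "sheaf_iso S FA'.P FE.P \<gamma>"
    unfolding \<gamma>_def
    by (intro sheaf_iso_comp[OF _ free FA'.module_presheaf_P] sheaf_iso_comp[OF _ beta FA'.module_presheaf_P]
        sheaf_iso_inv[OF \<epsilon> A.module_presheaf_P FA'.module_presheaf_P])
  \<comment> \<open>The equation for \<open>\<beta>\<close> is the equation for \<open>\<gamma>\<close> after composition with isomorphisms on both sides.\<close>
  have key: "pullback_map S S F A'.P ?E \<beta>' = \<gamma> \<longleftrightarrow>
      \<beta> = sheaf_comp S A.P (sheaf_inv S ?E FE.P ?free) (sheaf_comp S A.P (pullback_map S S F A'.P ?E \<beta>') \<epsilon>)"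
    if \<beta>': "sheaf_iso S A'.P ?E \<beta>'" for \<beta>'
  proof -
    let ?g = "pullback_map S S F A'.P ?E \<beta>'"
    have g: "sheaf_iso S FA'.P FE.P ?g"
      by (rule pullback_map_iso[OF S.one_point_axioms S.rs_map_axioms A'.module_presheaf_P E \<beta>'])
    note e = sheaf_isoD(5)[OF \<epsilon>] and ei = sheaf_inv_apply[OF \<epsilon>] and f = sheaf_isoD(5)[OF free]
      and fi = sheaf_inv_apply[OF free] and b = sheaf_isoD(5)[OF beta] and gc = sheaf_isoD(5)[OF g]
    have \<gamma>_apply: "\<gamma> U t = ?free U (\<beta> U (sheaf_inv S A.P FA'.P \<epsilon> U t))"
      if "is_open S U" "t \<in> carrier (msections FA'.P U)" for U t
      using that by (simp add: \<gamma>_def sheaf_comp_apply)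
    let ?c = "sheaf_comp S A.P (sheaf_inv S ?E FE.P ?free) (sheaf_comp S A.P ?g \<epsilon>)"
    have c_apply: "?c U s = sheaf_inv S ?E FE.P ?free U (?g U (\<epsilon> U s))"
      if "is_open S U" "s \<in> carrier (msections A.P U)" for U s
      using that by (simp add: sheaf_comp_apply)
    show ?thesis
    proof
      assume eq: "?g = \<gamma>"
      show "\<beta> = ?c"
      proof (rule sheaf_map_eqI[OF sheaf_isoD(2)[OF beta]])
        show "normalize_map S A.P ?c = ?c" by (simp add: sheaf_comp_def normalize_map_idem)
        fix U s assume U: "is_open S U" and s: "s \<in> carrier (msections A.P U)"
        have "?c U s = sheaf_inv S ?E FE.P ?free U (\<gamma> U (\<epsilon> U s))"
          using c_apply[OF U s] by (simp only: eq)
        also have "\<dots> = \<beta> U s"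
          using U s by (simp add: \<gamma>_apply e ei fi b)
        finally show "\<beta> U s = ?c U s" ..
      qed
    next
      assume eq: "\<beta> = ?c"
      show "?g = \<gamma>"
      proof (rule sheaf_map_eqI[OF sheaf_isoD(2)[OF g] sheaf_isoD(2)[OF \<gamma>]])
        fix U t assume U: "is_open S U" and t: "t \<in> carrier (msections FA'.P U)"
        let ?s = "sheaf_inv S A.P FA'.P \<epsilon> U t"
        have s: "?s \<in> carrier (msections A.P U)" by (rule ei(1)[OF U t])
        have "\<beta> U ?s = sheaf_inv S ?E FE.P ?free U (?g U t)"
          using fun_cong[OF fun_cong[OF eq, of U], of ?s] c_apply[OF U s] ei(2)[OF U t] by simp
        then show "?g U t = \<gamma> U t"
          using \<gamma>_apply[OF U t] fi(2)[OF U gc[OF U t]] by simp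
      qed
    qed
  qed
  obtain z where z: "carrier (msections ?E {}) = {z}" using S.free_sheaf_empty by blast
  have "\<exists>!\<beta>'. sheaf_iso S A'.P ?E \<beta>' \<and> pullback_map S S F A'.P ?E \<beta>' = \<gamma>"
    by (rule S.pullback_descent[OF A'.module_presheaf_P E A'.P_empty z \<gamma>])
  then show ?thesis
    unfolding \<Theta>_def[symmetric] \<epsilon>_def[symmetric] using key by (metis (no_types, lifting))
qed

theorem lemma3p3:
  fixes k :: "'k ring"
    and p r :: nat
    and \<XX> :: "('x, 'a) ringed_space"
    and \<pi> :: "('x, 'a, 'k) over_field"
    and \<xi> :: "('k set, 'k set \<Rightarrow> ('k \<times> 'k) set, 'x, 'a) space_map"
    and V :: "('x, 'a, 'n) module_sheaf"
    and V' :: "('x, 'a, 'm) module_sheaf"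
    and \<phi> :: "('x, 'n, ('x, 'a, 'x, 'm) pullback_section) sheaf_map"
    and \<beta> :: "('k, 'x, 'n) frame_map"
  assumes "perfect_field k" and "ring_char k = p" and "p > 0"
    and "smooth_projective_variety k \<XX> \<pi>"
    and "rational_point k \<XX> \<pi> \<xi>"
    and "vector_bundle \<XX> r V" and "vector_bundle \<XX> r V'"
    and "sheaf_iso \<XX> V (pullback \<XX> \<XX> (frobenius p \<XX>) V') \<phi>"
    and "frame k \<XX> \<xi> r V \<beta>"
  shows "\<exists>!\<beta>'. frame k \<XX> \<xi> r V' \<beta>' \<and> \<beta> = frobenius_pullback_frame p k \<XX> \<xi> r V V' \<phi> \<beta>'"
proof -
  interpret k: field k using assms(1) by (simp add: perfect_field_def)
  interpret S: one_point_twist "Spec k" "{\<zero>\<^bsub>k\<^esub>}" "frobenius p (Spec k)"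
    by (rule perfect_Spec_twist) fact+
  have prime: "Factorial_Ring.prime p" and char: "[p] \<cdot>\<^bsub>k\<^esub> \<one>\<^bsub>k\<^esub> = \<zero>\<^bsub>k\<^esub>"
    using k.prime_char assms(2,3) by simp_all
  have "ringed_space \<XX>"
    using assms(4) by (simp add: smooth_projective_variety_def integral_scheme_def scheme_def locally_ringed_space_def)
  then interpret \<XX>: ring_presheaf \<XX> by (rule ringed_space.ring_presheaf)
  interpret \<pi>: rs_map \<XX> "Spec k" \<pi>
    by unfold_locales (use assms(4) in \<open>simp add: smooth_projective_variety_def lrs_morphism_def\<close>)
  interpret \<xi>: rs_map "Spec k" \<XX> \<xi>
    by unfold_locales (use assms(5) in \<open>simp add: rational_point_def lrs_morphism_def\<close>)
  \<comment> \<open>The structure morphism makes all sections of \<open>\<XX>\<close> algebras over \<open>k\<close>, hence of characteristic \<open>p\<close>.\<close>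
  have charX: "[p] \<cdot>\<^bsub>sections \<XX> U\<^esub> \<one>\<^bsub>sections \<XX> U\<^esub> = \<zero>\<^bsub>sections \<XX> U\<^esub>" if U: "is_open \<XX> U" for U
  proof -
    let ?T = "points (Spec k)"
    have T: "is_open (Spec k) ?T" and p: "is_open \<XX> (preimage \<XX> \<pi> ?T)"
      using \<pi>.preimage_open by simp_all
    have sub: "U \<subseteq> preimage \<XX> \<pi> ?T"
      using openin_subset[OF U] \<pi>.base_points by (auto simp: preimage_def)
    have "[p] \<cdot>\<^bsub>sections \<XX> (preimage \<XX> \<pi> ?T)\<^esub> \<one>\<^bsub>sections \<XX> (preimage \<XX> \<pi> ?T)\<^esub> = \<zero>\<^bsub>sections \<XX> (preimage \<XX> \<pi> ?T)\<^esub>"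
      by (rule ring_hom_char[OF \<pi>.sharp_hom[OF T] S.cring_sections[OF T] \<XX>.cring_sections[OF p] k.Spec_char[OF char T]])
    then show ?thesis
      by (rule ring_hom_char[OF \<XX>.restr_hom[OF p U sub] \<XX>.cring_sections[OF p] \<XX>.cring_sections[OF U]])
  qed
  have FX: "rs_map \<XX> \<XX> (frobenius p \<XX>)" by (rule \<XX>.rs_map_frobenius[OF prime charX])
  have pre: "preimage \<XX> (frobenius p \<XX>) W = W" if "is_open \<XX> W" for W
    using openin_subset[OF that] by (auto simp: preimage_def frobenius_def)
  \<comment> \<open>\<open>\<xi>\<^sup>#(b\<^sup>p) = \<xi>\<^sup>#(b)\<^sup>p\<close>\<close>
  have sharp: "sharp (comp_morphism \<XX> (frobenius p \<XX>) \<xi>) W b = sharp (comp_morphism (Spec k) \<xi> (frobenius p (Spec k))) W b"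
    if W: "is_open \<XX> W" and b: "b \<in> carrier (sections \<XX> W)" for W b
    using ring_hom_pow[OF \<xi>.sharp_hom[OF W] \<XX>.cring_sections[OF W] S.cring_sections[OF \<xi>.preimage_open[OF W]] b, of p]
    by (simp add: comp_morphism_def pre[OF W]) (simp add: frobenius_def)
  have base: "base (comp_morphism \<XX> (frobenius p \<XX>) \<xi>) = base (comp_morphism (Spec k) \<xi> (frobenius p (Spec k)))"
    by (simp add: comp_morphism_def frobenius_def)
  show ?thesis
    unfolding frame_def frobenius_pullback_frame_def Let_def frobenius_fibre_iso_def
    by (rule frame_descent[OF S.one_point_twist_axioms FX \<xi>.rs_map_axioms base sharp])
      (use assms in \<open>simp_all add: vector_bundle_presheaf frame_def\<close>)
qed

end
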